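(* Let $(M,g)$ be a smooth, connected, compact Riemannian manifold with $\mathcal{C}^1$ boundary $\partial M$. Let $\lambda_1>0$ be the first eigenvalue of $-\Delta_g$ with Dirichlet boundary condition and let $C=\lambda_1^{-1/2}$ be the Poincaré constant on $M$. Let $F:\mathbb{C}\to\mathbb{C}$ be a globally Lipschitz function with Lipschitz constant $C_1$, and let $f\in L^2(M)$. If $C_1C^2<1$, then the problem $$-\Delta_g u+F(u)=f \ \text{ in } M,\qquad u\equiv 0 \ \text{ on } \partial M,$$ has a weak solution $u\in H_0^1(M)$.
   Context: All function spaces consist of complex-valued functions; $d\mu$ is the Riemannian volume form. $\langle f,h\rangle_{L^2}=\int_M f\bar h\,d\mu$, $\langle f,h\rangle_E=\int_M g(\nabla f,\nabla\bar h)\,d\mu$, $\langle f,h\rangle_{H^1}=\langle f,h\rangle_{L^2}+\langle f,h\rangle_E$, and $H_0^1(M)$ is the completion of $\mathcal{C}_c^\infty(\mathring M,\mathbb{C})$ with respect to $\langle\cdot,\cdot\rangle_{H^1}$, where $\mathring M$ is the interior of $M$. $-\Delta_g$ is the Laplace-Beltrami operator with the sign convention that it is nonnegative. One has $\lambda_1=\inf\{\|\phi\|_E^2:\phi\in H_0^1(M),\ \|\phi\|_{L^2(M)}=1\}$, so $\|\phi\|_{L^2(M)}\le C\|\phi\|_E$ for $\phi\in H_0^1(M)$. A weak solution is $u\in H_0^1(M)$ such that $\langle u,v\rangle_E+\langle F(u),v\rangle_{L^2}=\langle f,v\rangle_{L^2}$ for all $v\in H_0^1(M)$. *)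

theory Defs
  imports "HOL-Analysis.Analysis"
begin

section \<open>Smooth maps\<close>

text \<open>\<open>Ck_on k S f\<close> is meant for open \<open>S\<close>. As the domain is finite-dimensional, quantifying
  over all directions \<open>v\<close> gives the usual notion of a \<open>C^k\<close> map.\<close>

primrec Ck_on ::
  "nat \<Rightarrow> 'e::euclidean_space set \<Rightarrow> ('e \<Rightarrow> 'f::real_normed_vector) \<Rightarrow> bool" where
  "Ck_on 0 S f \<longleftrightarrow> continuous_on S f"
| "Ck_on (Suc k) S f \<longleftrightarrow>
     (\<forall>x\<in>S. f differentiable (at x)) \<and>
     (\<forall>v. Ck_on k S (\<lambda>x. frechet_derivative f (at x) v))"

text \<open>Smoothness on an arbitrary set: local extendability to a smooth map on an open set.\<close>

definition smooth_on ::
  "'e::euclidean_space set \<Rightarrow> ('e \<Rightarrow> 'f::real_normed_vector) \<Rightarrow> bool" where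
  "smooth_on S f \<longleftrightarrow>
     (\<forall>x\<in>S. \<exists>V h. open V \<and> x \<in> V \<and> (\<forall>k. Ck_on k V h) \<and> (\<forall>y\<in>S \<inter> V. h y = f y))"


section \<open>Smooth manifolds with \<open>C^1\<close> boundary\<close>

text \<open>Near each of its points, \<open>S\<close> is, in suitable orthonormal coordinates, the closed epigraph of
  a \<open>C^1\<close> function of the remaining \<open>n - 1\<close> coordinates (the component of \<open>y\<close> orthogonal to \<open>e\<close>).
  Interior points are covered too: take \<open>\<gamma>\<close> to be a sufficiently small constant.\<close>

definition C1_domain :: "'e::euclidean_space set \<Rightarrow> bool" where
  "C1_domain S \<longleftrightarrow>
     (\<forall>x\<in>S. \<exists>r>0. \<exists>e \<gamma>. norm e = 1 \<and> Ck_on 1 UNIV \<gamma> \<and>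
        S \<inter> ball x r = {y \<in> ball x r. \<gamma> (y - (y \<bullet> e) *\<^sub>R e) \<le> y \<bullet> e})"

type_synonym ('a, 'n) chart = "'a set \<times> ('a \<Rightarrow> real ^ 'n)"

definition transition :: "('a, 'n) chart \<Rightarrow> ('a, 'n) chart \<Rightarrow> real ^ 'n \<Rightarrow> real ^ 'n" where
  "transition c c' = snd c' \<circ> inv_into (fst c) (snd c)"

text \<open>The manifold is a subset \<open>M\<close> of a Hausdorff space, with the subspace topology. The smooth
  structure extends up to the boundary, while the boundary itself is only \<open>C^1\<close>: the charts
  are modelled on \<open>C^1\<close> domains of \<open>\<real>^n\<close> and the transition maps are smooth.\<close>

definition smooth_manifold_C1_boundary ::
  "'a::t2_space set \<Rightarrow> ('a, 'n::finite) chart set \<Rightarrow> bool" where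
  "smooth_manifold_C1_boundary M A \<longleftrightarrow>
     (\<Union>c\<in>A. fst c) = M \<and>
     (\<forall>(U, \<psi>)\<in>A. openin (top_of_set M) U \<and>
        homeomorphism U (\<psi> ` U) \<psi> (inv_into U \<psi>) \<and> C1_domain (\<psi> ` U)) \<and>
     (\<forall>c\<in>A. \<forall>c'\<in>A. smooth_on (snd c ` (fst c \<inter> fst c')) (transition c c'))"

definition manifold_interior :: "('a, 'n::finite) chart set \<Rightarrow> 'a set" where
  "manifold_interior A = {p. \<exists>(U, \<psi>)\<in>A. p \<in> U \<and> \<psi> p \<in> interior (\<psi> ` U)}"


section \<open>Riemannian metric and volume\<close>

text \<open>\<open>g c p\<close> is the matrix of the metric at \<open>p\<close> in the coordinates of the chart \<open>c\<close>. The last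
  clause is the transformation law of a covariant 2-tensor; derivatives are taken within the
  chart image, which determines them uniquely also at boundary points.\<close>

definition riemannian_metric ::
  "('a, 'n::finite) chart set \<Rightarrow> (('a, 'n) chart \<Rightarrow> 'a \<Rightarrow> real ^ 'n ^ 'n) \<Rightarrow> bool" where
  "riemannian_metric A g \<longleftrightarrow>
     (\<forall>c\<in>A. \<forall>p\<in>fst c.
        transpose (g c p) = g c p \<and> (\<forall>v. v \<noteq> 0 \<longrightarrow> 0 < v \<bullet> (g c p *v v))) \<and>
     (\<forall>c\<in>A. smooth_on (snd c ` fst c) (g c \<circ> inv_into (fst c) (snd c))) \<and>
     (\<forall>c\<in>A. \<forall>c'\<in>A. \<forall>p\<in>fst c \<inter> fst c'. \<forall>D.
        (transition c c' has_derivative D) (at (snd c p) within snd c ` (fst c \<inter> fst c')) \<longrightarrow>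
        g c p = transpose (matrix D) ** g c' p ** matrix D)"

text \<open>The volume measure on the Borel sets of \<open>M\<close>, characterized by \<open>d\<mu> = sqrt (det g) dx\<close> in
  every chart; on a compact manifold it exists and is unique.\<close>

definition riemannian_volume ::
  "'a::t2_space set \<Rightarrow> ('a, 'n::finite) chart set \<Rightarrow> (('a, 'n) chart \<Rightarrow> 'a \<Rightarrow> real ^ 'n ^ 'n) \<Rightarrow>
   'a measure \<Rightarrow> bool" where
  "riemannian_volume M A g \<mu> \<longleftrightarrow>
     space \<mu> = M \<and> sets \<mu> = sets (restrict_space borel M) \<and>
     (\<forall>c\<in>A. \<forall>B\<in>sets \<mu>. B \<subseteq> fst c \<longrightarrow>
        emeasure \<mu> B =
          (\<integral>\<^sup>+x. ennreal (sqrt (det (g c (inv_into (fst c) (snd c) x)))) *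
                indicator (snd c ` B) x \<partial>lborel))"

definition partial_in :: "('a, 'n::finite) chart \<Rightarrow> ('a \<Rightarrow> complex) \<Rightarrow> 'a \<Rightarrow> 'n \<Rightarrow> complex" where
  "partial_in c \<phi> p i =
     frechet_derivative (\<phi> \<circ> inv_into (fst c) (snd c)) (at (snd c p) within snd c ` fst c) (axis i 1)"

definition gradient_in ::
  "(('a, 'n::finite) chart \<Rightarrow> 'a \<Rightarrow> real ^ 'n ^ 'n) \<Rightarrow> ('a, 'n) chart \<Rightarrow> ('a \<Rightarrow> complex) \<Rightarrow> 'a \<Rightarrow>
   complex ^ 'n" where
  "gradient_in g c \<phi> p =
     (\<chi> i. \<Sum>j\<in>UNIV. of_real (matrix_inv (g c p) $ i $ j) * partial_in c \<phi> p j)"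

text \<open>The metric extended complex-bilinearly to complexified tangent vectors.\<close>

definition metric_in ::
  "(('a, 'n::finite) chart \<Rightarrow> 'a \<Rightarrow> real ^ 'n ^ 'n) \<Rightarrow> ('a, 'n) chart \<Rightarrow> 'a \<Rightarrow>
   complex ^ 'n \<Rightarrow> complex ^ 'n \<Rightarrow> complex" where
  "metric_in g c p X Y = (\<Sum>i\<in>UNIV. \<Sum>j\<in>UNIV. of_real (g c p $ i $ j) * X $ i * Y $ j)"

text \<open>The function \<open>g(\<nabla>\<phi>, \<nabla>\<eta>)\<close> for smooth \<open>\<phi>\<close> and \<open>\<eta>\<close>; its value at \<open>p\<close> does not depend on
  the chosen chart around \<open>p\<close>.\<close>

definition grad_product ::
  "('a, 'n::finite) chart set \<Rightarrow> (('a, 'n) chart \<Rightarrow> 'a \<Rightarrow> real ^ 'n ^ 'n) \<Rightarrow>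
   ('a \<Rightarrow> complex) \<Rightarrow> ('a \<Rightarrow> complex) \<Rightarrow> 'a \<Rightarrow> complex" where
  "grad_product A g \<phi> \<eta> p =
     (let c = (SOME c. c \<in> A \<and> p \<in> fst c)
      in metric_in g c p (gradient_in g c \<phi> p) (gradient_in g c \<eta> p))"


section \<open>Function spaces\<close>

text \<open>Elements of \<open>L^2\<close> and \<open>H_0^1\<close> are represented by functions, equality being almost everywhere.\<close>

definition L2 :: "'a measure \<Rightarrow> ('a \<Rightarrow> complex) set" where
  "L2 \<mu> = {f \<in> borel_measurable \<mu>. integrable \<mu> (\<lambda>p. (cmod (f p))\<^sup>2)}"

definition L2_inner :: "'a measure \<Rightarrow> ('a \<Rightarrow> complex) \<Rightarrow> ('a \<Rightarrow> complex) \<Rightarrow> complex" where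
  "L2_inner \<mu> f h = (LINT p|\<mu>. f p * cnj (h p))"

definition L2_norm :: "'a measure \<Rightarrow> ('a \<Rightarrow> complex) \<Rightarrow> real" where
  "L2_norm \<mu> f = sqrt (Re (L2_inner \<mu> f f))"

text \<open>\<open>C_c^\<infinity>\<close> of the interior, extended by zero to \<open>M\<close>.\<close>

definition test_functions ::
  "'a::t2_space set \<Rightarrow> ('a, 'n::finite) chart set \<Rightarrow> ('a \<Rightarrow> complex) set" where
  "test_functions M A =
     {\<phi>. (\<forall>(U, \<psi>)\<in>A. smooth_on (\<psi> ` (U \<inter> manifold_interior A)) (\<phi> \<circ> inv_into U \<psi>)) \<and>
         (\<exists>K. compact K \<and> K \<subseteq> manifold_interior A \<and> (\<forall>p\<in>M - K. \<phi> p = 0))}"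

definition test_E_inner ::
  "('a, 'n::finite) chart set \<Rightarrow> (('a, 'n) chart \<Rightarrow> 'a \<Rightarrow> real ^ 'n ^ 'n) \<Rightarrow> 'a measure \<Rightarrow>
   ('a \<Rightarrow> complex) \<Rightarrow> ('a \<Rightarrow> complex) \<Rightarrow> complex" where
  "test_E_inner A g \<mu> \<phi> \<eta> = (LINT p|\<mu>. grad_product A g \<phi> (\<lambda>q. cnj (\<eta> q)) p)"

definition test_H1_norm ::
  "('a, 'n::finite) chart set \<Rightarrow> (('a, 'n) chart \<Rightarrow> 'a \<Rightarrow> real ^ 'n ^ 'n) \<Rightarrow> 'a measure \<Rightarrow>
   ('a \<Rightarrow> complex) \<Rightarrow> real" where
  "test_H1_norm A g \<mu> \<phi> = sqrt (Re (L2_inner \<mu> \<phi> \<phi> + test_E_inner A g \<mu> \<phi> \<phi>))"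

text \<open>The completion of the test functions for the \<open>H^1\<close> norm, realized inside \<open>L^2\<close>: its elements
  are the \<open>L^2\<close> limits of \<open>H^1\<close>-Cauchy sequences of test functions, and the inner product
  \<open>\<langle>\<cdot>,\<cdot>\<rangle>_E\<close> is extended by continuity along such sequences. (The limit does not depend on the
  sequences, because the gradient on test functions is a closable operator in \<open>L^2\<close>.)\<close>

definition H1_approx ::
  "'a::t2_space set \<Rightarrow> ('a, 'n::finite) chart set \<Rightarrow> (('a, 'n) chart \<Rightarrow> 'a \<Rightarrow> real ^ 'n ^ 'n) \<Rightarrow>
   'a measure \<Rightarrow> (nat \<Rightarrow> 'a \<Rightarrow> complex) \<Rightarrow> ('a \<Rightarrow> complex) \<Rightarrow> bool" where
  "H1_approx M A g \<mu> \<phi> u \<longleftrightarrow>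
     (\<forall>n. \<phi> n \<in> test_functions M A) \<and>
     (\<forall>\<epsilon>>0. \<exists>N. \<forall>m\<ge>N. \<forall>n\<ge>N. test_H1_norm A g \<mu> (\<lambda>p. \<phi> m p - \<phi> n p) < \<epsilon>) \<and>
     (\<lambda>n. L2_norm \<mu> (\<lambda>p. \<phi> n p - u p)) \<longlonglongrightarrow> 0"

definition H01 ::
  "'a::t2_space set \<Rightarrow> ('a, 'n::finite) chart set \<Rightarrow> (('a, 'n) chart \<Rightarrow> 'a \<Rightarrow> real ^ 'n ^ 'n) \<Rightarrow>
   'a measure \<Rightarrow> ('a \<Rightarrow> complex) set" where
  "H01 M A g \<mu> = {u \<in> L2 \<mu>. \<exists>\<phi>. H1_approx M A g \<mu> \<phi> u}"

definition E_inner ::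
  "'a::t2_space set \<Rightarrow> ('a, 'n::finite) chart set \<Rightarrow> (('a, 'n) chart \<Rightarrow> 'a \<Rightarrow> real ^ 'n ^ 'n) \<Rightarrow>
   'a measure \<Rightarrow> ('a \<Rightarrow> complex) \<Rightarrow> ('a \<Rightarrow> complex) \<Rightarrow> complex" where
  "E_inner M A g \<mu> u v =
     (THE l. \<forall>\<phi> \<eta>. H1_approx M A g \<mu> \<phi> u \<longrightarrow> H1_approx M A g \<mu> \<eta> v \<longrightarrow>
        (\<lambda>n. test_E_inner A g \<mu> (\<phi> n) (\<eta> n)) \<longlonglongrightarrow> l)"


section \<open>Dirichlet eigenvalues and weak solutions\<close>

text \<open>Restricting to real \<open>lam\<close> is harmless, since \<open>\<langle>\<cdot>,\<cdot>\<rangle>_E\<close> is Hermitian.\<close>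

definition dirichlet_eigenvalue ::
  "'a::t2_space set \<Rightarrow> ('a, 'n::finite) chart set \<Rightarrow> (('a, 'n) chart \<Rightarrow> 'a \<Rightarrow> real ^ 'n ^ 'n) \<Rightarrow>
   'a measure \<Rightarrow> real \<Rightarrow> bool" where
  "dirichlet_eigenvalue M A g \<mu> lam \<longleftrightarrow>
     (\<exists>u\<in>H01 M A g \<mu>. \<not> (AE p in \<mu>. u p = 0) \<and>
        (\<forall>v\<in>H01 M A g \<mu>. E_inner M A g \<mu> u v = of_real lam * L2_inner \<mu> u v))"

definition first_dirichlet_eigenvalue ::
  "'a::t2_space set \<Rightarrow> ('a, 'n::finite) chart set \<Rightarrow> (('a, 'n) chart \<Rightarrow> 'a \<Rightarrow> real ^ 'n ^ 'n) \<Rightarrow>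
   'a measure \<Rightarrow> real \<Rightarrow> bool" where
  "first_dirichlet_eigenvalue M A g \<mu> lam \<longleftrightarrow>
     dirichlet_eigenvalue M A g \<mu> lam \<and> (\<forall>kappa. dirichlet_eigenvalue M A g \<mu> kappa \<longrightarrow> lam \<le> kappa)"

text \<open>Weak solutions of \<open>-\<Delta> u + F(u) = f\<close> in \<open>M\<close>, \<open>u = 0\<close> on the boundary.\<close>

definition weak_solution ::
  "'a::t2_space set \<Rightarrow> ('a, 'n::finite) chart set \<Rightarrow> (('a, 'n) chart \<Rightarrow> 'a \<Rightarrow> real ^ 'n ^ 'n) \<Rightarrow>
   'a measure \<Rightarrow> (complex \<Rightarrow> complex) \<Rightarrow> ('a \<Rightarrow> complex) \<Rightarrow> ('a \<Rightarrow> complex) \<Rightarrow> bool" where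
  "weak_solution M A g \<mu> F f u \<longleftrightarrow>
     u \<in> H01 M A g \<mu> \<and>
     (\<forall>v\<in>H01 M A g \<mu>.
        E_inner M A g \<mu> u v + L2_inner \<mu> (\<lambda>p. F (u p)) v = L2_inner \<mu> f v)"

end

theory Submission
  imports Defs "HOL-Library.Diagonal_Subsequence"
begin

text \<open>
  The infimum \<open>\<nu>\<close> of the Rayleigh quotient over the test functions is an eigenvalue: a minimizing
  sequence has an \<open>L\<^sup>2\<close>-convergent subsequence by Rellich's theorem, and it is then Cauchy in the energy
  norm because the form \<open>\<langle>\<cdot>,\<cdot>\<rangle>_E - \<nu> \<langle>\<cdot>,\<cdot>\<rangle>_{L\<^sup>2}\<close> is nonnegative and tends to zero along it. Hence
  \<open>\<lambda>_1 \<le> \<nu>\<close>, which is the Poincare inequality with constant \<open>\<lambda>_1\<^sup>-\<^sup>1\<^sup>/\<^sup>2\<close>. For \<open>w \<in> L\<^sup>2\<close> the linear problem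
  \<open>-\<Delta> u = f - F(w)\<close> has a weak solution \<open>T w\<close> (minimize the quadratic functional), and \<open>T\<close> is a contraction
  of \<open>L\<^sup>2\<close> with constant \<open>C\<^sub>1 / \<lambda>_1 = C\<^sub>1 C\<^sup>2 < 1\<close>; its fixed point is the solution.

  Rellich's theorem comes from the Poincare inequality on small boxes: since test functions extend by
  zero across the boundary in every chart, boundary charts need no separate treatment, and the averages over finitely many boxes
  control the \<open>L\<^sup>2\<close> norm up to \<open>\<epsilon>\<close> times the energy. The energy form is closable because, after multiplication with a
  cut-off in a chart, integration by parts moves the derivative off the sequence that tends to zero in \<open>L\<^sup>2\<close>.
\<close>

subsection \<open>Semi-inner product spaces of functions\<close>

text \<open>Members of \<open>L2\<close> and \<open>H01\<close> are functions rather than classes,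
  so every form here is only positive semidefinite and limits are fixed only almost everywhere;
  hence an own locale of semi-inner products. \<open>H01\<close> and \<open>E_inner\<close> are
  given by approximating sequences and a definite description, so \<open>E_inner\<close> is
  inaccessible until closability shows that its value is independent of the sequences. Inequalities
  are therefore proved for test functions and passed to the limit. The first eigenvalue is given as
  the least number that has a weak eigenfunction, not as an infimum: the Poincare inequality becomes
  available only once the infimum is known to be attained, and this is what calls for compactness.
  The contraction runs in \<open>L2\<close>, where completeness is at hand and \<open>F\<close> acts
  as a Lipschitz map. The geometric obstacle lies at the boundary: derivatives there are taken
  within the chart image and have to be identified with ordinary derivatives of an extension before
  Euclidean analysis applies.\<close>

locale semi_inner =
  fixes V :: "('a \<Rightarrow> complex) set" and B :: "('a \<Rightarrow> complex) \<Rightarrow> ('a \<Rightarrow> complex) \<Rightarrow> complex"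
  assumes lincomb: "u \<in> V \<Longrightarrow> v \<in> V \<Longrightarrow> (\<lambda>p. a * u p + b * v p) \<in> V"
    and lincomb_left: "u \<in> V \<Longrightarrow> v \<in> V \<Longrightarrow> w \<in> V \<Longrightarrow>
          B (\<lambda>p. a * u p + b * v p) w = a * B u w + b * B v w"
    and hermitian: "u \<in> V \<Longrightarrow> v \<in> V \<Longrightarrow> B v u = cnj (B u v)"
    and nonneg: "u \<in> V \<Longrightarrow> 0 \<le> Re (B u u)"
begin

lemma add_closed: "u \<in> V \<Longrightarrow> v \<in> V \<Longrightarrow> (\<lambda>p. u p + v p) \<in> V"
  using lincomb[of u v 1 1] by simp

lemma diff_closed: "u \<in> V \<Longrightarrow> v \<in> V \<Longrightarrow> (\<lambda>p. u p - v p) \<in> V"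
  using lincomb[of u v 1 "-1"] by simp

lemma scale_closed: "u \<in> V \<Longrightarrow> (\<lambda>p. a * u p) \<in> V"
  using lincomb[of u u a 0] by simp

lemma diff_left: "u \<in> V \<Longrightarrow> v \<in> V \<Longrightarrow> w \<in> V \<Longrightarrow> B (\<lambda>p. u p - v p) w = B u w - B v w"
  using lincomb_left[of u v w 1 "-1"] by simp

lemma lincomb_right:
  assumes "u \<in> V" "v \<in> V" "w \<in> V"
  shows "B w (\<lambda>p. a * u p + b * v p) = cnj a * B w u + cnj b * B w v"
  using hermitian[OF lincomb[of u v a b] assms(3)] lincomb_left[OF assms, of a b]
    hermitian[OF assms(1,3)] hermitian[OF assms(2,3)] assms by simp

lemma diff_right: "u \<in> V \<Longrightarrow> v \<in> V \<Longrightarrow> w \<in> V \<Longrightarrow> B w (\<lambda>p. u p - v p) = B w u - B w v"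
  using lincomb_right[of u v w 1 "-1"] by simp

lemma Im_self: "u \<in> V \<Longrightarrow> Im (B u u) = 0"
  using hermitian[of u u] by (simp add: complex_eq_iff)

text \<open>All quadratic identities used later, for sums, differences, multiples and midpoints, are
  instances of this expansion.\<close>

lemma Re_lincomb:
  assumes "u \<in> V" "v \<in> V"
  shows "Re (B (\<lambda>p. a * u p + b * v p) (\<lambda>p. a * u p + b * v p)) =
    (cmod a)\<^sup>2 * Re (B u u) + (cmod b)\<^sup>2 * Re (B v v) + 2 * Re (a * cnj b * B u v)"
proof -
  have "B (\<lambda>p. a * u p + b * v p) (\<lambda>p. a * u p + b * v p) =
      a * cnj a * B u u + b * cnj b * B v v + (a * cnj b * B u v + cnj (a * cnj b * B u v))"
    using assms lincomb[OF assms, of a b]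
    by (simp add: lincomb_left lincomb_right hermitian[OF assms] algebra_simps)
  then show ?thesis
    by (simp add: Im_self assms complex_norm_square[symmetric] cmod_power2 algebra_simps power2_eq_square)
qed

lemma Re_add: "u \<in> V \<Longrightarrow> v \<in> V \<Longrightarrow>
    Re (B (\<lambda>p. u p + v p) (\<lambda>p. u p + v p)) = Re (B u u) + Re (B v v) + 2 * Re (B u v)"
  using Re_lincomb[of u v 1 1] by simp

lemma Re_diff: "u \<in> V \<Longrightarrow> v \<in> V \<Longrightarrow>
    Re (B (\<lambda>p. u p - v p) (\<lambda>p. u p - v p)) = Re (B u u) + Re (B v v) - 2 * Re (B u v)"
  using Re_lincomb[of u v 1 "-1"] by simp

lemma Re_scale: "u \<in> V \<Longrightarrow> Re (B (\<lambda>p. a * u p) (\<lambda>p. a * u p)) = (cmod a)\<^sup>2 * Re (B u u)"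
  using Re_lincomb[of u u a 0] by simp

lemma cauchy_schwarz_sq:
  assumes "u \<in> V" "v \<in> V"
  shows "(cmod (B u v))\<^sup>2 \<le> Re (B u u) * Re (B v v)"
proof -
  define z where "z = B u v"
  \<comment> \<open>The square of \<open>u - t z v\<close> for real \<open>t\<close>. Taking
    \<open>z = B u v\<close> as coefficient absorbs the phase and leaves a real polynomial in
    \<open>t\<close>.\<close>
  have *: "0 \<le> Re (B u u) + t\<^sup>2 * (cmod z)\<^sup>2 * Re (B v v) - 2 * t * (cmod z)\<^sup>2" for t :: real
  proof -
    have "Re (z * cnj z) = (cmod z)\<^sup>2"
      by (simp add: complex_norm_square[symmetric] cmod_power2 power2_eq_square)
    moreover have "1 * cnj (- of_real t * z) * z = of_real (- t) * (z * cnj z)"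
      by simp
    then have "Re (1 * cnj (- of_real t * z) * B u v) = - t * Re (z * cnj z)"
      unfolding z_def[symmetric] by (metis Re_complex_of_real scaleR_conv_of_real scaleR_complex.simps(1))
    ultimately show ?thesis
      using nonneg[OF lincomb[OF assms, of 1 "- of_real t * z"]] Re_lincomb[OF assms, of 1 "- of_real t * z"]
      by (simp add: norm_mult power_mult_distrib)
  qed
  have "(cmod z)\<^sup>2 \<le> Re (B u u) * Re (B v v)"
  proof (cases "Re (B v v) = 0")
    case True
    show ?thesis
    proof (cases "z = 0")
      case False
      \<comment> \<open>The polynomial is affine in \<open>t\<close> here, and this \<open>t\<close>
        would give it the value -1.\<close>
      then show ?thesis using *[of "(Re (B u u) + 1) / (2 * (cmod z)\<^sup>2)"] True by simp
    qed (use nonneg assms in simp)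
  next
    case False
    then have "0 < Re (B v v)" using nonneg[OF assms(2)] by simp
    \<comment> \<open>The minimizer of the quadratic polynomial.\<close>
    then show ?thesis using *[of "1 / Re (B v v)"]
      by (simp add: field_simps power2_eq_square)
  qed
  then show ?thesis by (simp add: z_def)
qed

definition nrm :: "('a \<Rightarrow> complex) \<Rightarrow> real" where
  "nrm u = sqrt (Re (B u u))"

lemma nrm_nonneg: "u \<in> V \<Longrightarrow> 0 \<le> nrm u"
  using nonneg by (simp add: nrm_def)

lemma nrm_sq: "u \<in> V \<Longrightarrow> (nrm u)\<^sup>2 = Re (B u u)"
  using nonneg by (simp add: nrm_def)

lemma cauchy_schwarz: "u \<in> V \<Longrightarrow> v \<in> V \<Longrightarrow> cmod (B u v) \<le> nrm u * nrm v"
  by (rule power2_le_imp_le) (auto simp: power_mult_distrib nrm_sq cauchy_schwarz_sq nrm_nonneg)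

lemma nrm_add: 
  assumes "u \<in> V" "v \<in> V"
  shows "nrm (\<lambda>p. u p + v p) \<le> nrm u + nrm v"
proof (rule power2_le_imp_le)
  have "Re (B u v) \<le> nrm u * nrm v"
    using cauchy_schwarz[OF assms] complex_Re_le_cmod[of "B u v"] by linarith
  then show "(nrm (\<lambda>p. u p + v p))\<^sup>2 \<le> (nrm u + nrm v)\<^sup>2"
    using assms by (simp add: nrm_sq add_closed Re_add power2_sum)
qed (use assms nrm_nonneg in simp)

lemma nrm_scale: "u \<in> V \<Longrightarrow> nrm (\<lambda>p. a * u p) = cmod a * nrm u"
  by (simp add: nrm_def Re_scale real_sqrt_mult)

lemma nrm_diff_commute: "u \<in> V \<Longrightarrow> v \<in> V \<Longrightarrow> nrm (\<lambda>p. u p - v p) = nrm (\<lambda>p. v p - u p)"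
  using nrm_scale[of "\<lambda>p. v p - u p" "-1"] diff_closed by simp

lemma nrm_triangle:
  assumes "u \<in> V" "v \<in> V" "w \<in> V"
  shows "nrm (\<lambda>p. u p - w p) \<le> nrm (\<lambda>p. u p - v p) + nrm (\<lambda>p. v p - w p)"
  using nrm_add[of "\<lambda>p. u p - v p" "\<lambda>p. v p - w p"] diff_closed assms by simp

lemma nrm_diff: "u \<in> V \<Longrightarrow> v \<in> V \<Longrightarrow> nrm (\<lambda>p. u p - v p) \<le> nrm u + nrm v"
  using nrm_add[of u "\<lambda>p. - 1 * v p"] nrm_scale[of v "-1"] scale_closed[of v "-1"] by simp

lemma nrm_le: "u \<in> V \<Longrightarrow> v \<in> V \<Longrightarrow> nrm u \<le> nrm v + nrm (\<lambda>p. u p - v p)"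
  using nrm_add[of v "\<lambda>p. u p - v p"] diff_closed by simp

definition nCauchy :: "(nat \<Rightarrow> 'a \<Rightarrow> complex) \<Rightarrow> bool" where
  "nCauchy \<phi> \<longleftrightarrow> (\<forall>\<epsilon>>0. \<exists>N. \<forall>m\<ge>N. \<forall>n\<ge>N. nrm (\<lambda>p. \<phi> m p - \<phi> n p) < \<epsilon>)"

lemma nCauchyI_sq:
  assumes "\<And>\<epsilon>. 0 < \<epsilon> \<Longrightarrow> \<exists>N. \<forall>m\<ge>N. \<forall>n\<ge>N. Re (B (\<lambda>p. \<phi> m p - \<phi> n p) (\<lambda>p. \<phi> m p - \<phi> n p)) < \<epsilon>"
  shows "nCauchy \<phi>"
  unfolding nCauchy_def
proof (intro allI impI)
  fix e :: real assume "0 < e"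
  with assms[of "e\<^sup>2"] obtain N where "\<forall>m\<ge>N. \<forall>n\<ge>N. 
      Re (B (\<lambda>p. \<phi> m p - \<phi> n p) (\<lambda>p. \<phi> m p - \<phi> n p)) < e\<^sup>2" by auto
  then show "\<exists>N. \<forall>m\<ge>N. \<forall>n\<ge>N. nrm (\<lambda>p. \<phi> m p - \<phi> n p) < e"
    unfolding nrm_def using \<open>0 < e\<close> by (metis real_less_rsqrt real_sqrt_less_mono real_sqrt_unique order_less_imp_le)
qed

lemma nCauchy_bounded:
  assumes "\<And>n. \<phi> n \<in> V" "nCauchy \<phi>"
  obtains K where "0 < K" "\<And>n. nrm (\<phi> n) \<le> K"
proof -
  obtain N where N: "\<forall>m\<ge>N. \<forall>n\<ge>N. nrm (\<lambda>p. \<phi> m p - \<phi> n p) < 1"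
    using assms(2) unfolding nCauchy_def by (meson zero_less_one)
  define K where "K = 1 + (\<Sum>n\<le>N. nrm (\<phi> n))"
  have s: "nrm (\<phi> n) \<le> (\<Sum>n\<le>N. nrm (\<phi> n))" if "n \<le> N" for n
    using that by (intro member_le_sum) (auto simp: nrm_nonneg assms(1))
  have "nrm (\<phi> n) \<le> K" for n
  proof (cases "n \<le> N")
    case True then show ?thesis using s[of n] by (simp add: K_def)
  next
    case False
    then have "nrm (\<lambda>p. \<phi> n p - \<phi> N p) < 1" using N by simp
    then show ?thesis using s[of N] nrm_le[OF assms(1)[of n] assms(1)[of N]] by (simp add: K_def)
  qed
  moreover have "0 < K" unfolding K_def by (intro add_pos_nonneg sum_nonneg) (auto simp: nrm_nonneg assms(1))
  ultimately show thesis using that by blast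
qed

lemma form_diff_bound:
  assumes "u \<in> V" "u' \<in> V" "v \<in> V" "v' \<in> V"
  shows "cmod (B u v - B u' v') \<le> nrm (\<lambda>p. u p - u' p) * nrm v + nrm u' * nrm (\<lambda>p. v p - v' p)"
proof -
  have "B u v - B u' v' = B (\<lambda>p. u p - u' p) v + B u' (\<lambda>p. v p - v' p)"
    using assms by (simp add: diff_left diff_right)
  also have "cmod \<dots> \<le> cmod (B (\<lambda>p. u p - u' p) v) + cmod (B u' (\<lambda>p. v p - v' p))"
    by (rule norm_triangle_ineq)
  finally show ?thesis
    using cauchy_schwarz[of "\<lambda>p. u p - u' p" v] cauchy_schwarz[of u' "\<lambda>p. v p - v' p"]
      assms diff_closed[OF assms(1,2)] diff_closed[OF assms(3,4)] by linarith
qed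

lemma form_convergent:
  assumes "\<And>n. \<phi> n \<in> V" "\<And>n. \<eta> n \<in> V" "nCauchy \<phi>" "nCauchy \<eta>"
  shows "convergent (\<lambda>n. B (\<phi> n) (\<eta> n))"
proof -
  obtain K where K: "0 < K" "\<And>n. nrm (\<phi> n) \<le> K" using nCauchy_bounded assms by metis
  obtain L where L: "0 < L" "\<And>n. nrm (\<eta> n) \<le> L" using nCauchy_bounded assms by metis
  have "Cauchy (\<lambda>n. B (\<phi> n) (\<eta> n))"
  proof (rule metric_CauchyI)
    fix e :: real assume e: "0 < e"
    obtain N1 where N1: "\<forall>m\<ge>N1. \<forall>n\<ge>N1. nrm (\<lambda>p. \<phi> m p - \<phi> n p) < e / (2 * L)"
      using assms(3) L e unfolding nCauchy_def by (meson divide_pos_pos mult_pos_pos zero_less_numeral)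
    obtain N2 where N2: "\<forall>m\<ge>N2. \<forall>n\<ge>N2. nrm (\<lambda>p. \<eta> m p - \<eta> n p) < e / (2 * K)"
      using assms(4) K e unfolding nCauchy_def by (meson divide_pos_pos mult_pos_pos zero_less_numeral)
    have "dist (B (\<phi> m) (\<eta> m)) (B (\<phi> n) (\<eta> n)) < e" if "m \<ge> max N1 N2" "n \<ge> max N1 N2" for m n
    proof -
      have "nrm (\<lambda>p. \<phi> m p - \<phi> n p) * nrm (\<eta> m) \<le> nrm (\<lambda>p. \<phi> m p - \<phi> n p) * L"
        using L(2)[of m] by (intro mult_left_mono nrm_nonneg diff_closed assms)
      also have "\<dots> < e / (2 * L) * L"
        using N1 that L(1) by (intro mult_strict_right_mono) auto
      finally have 1: "nrm (\<lambda>p. \<phi> m p - \<phi> n p) * nrm (\<eta> m) < e / 2" using L(1) by simp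
      have "nrm (\<phi> n) * nrm (\<lambda>p. \<eta> m p - \<eta> n p) \<le> K * nrm (\<lambda>p. \<eta> m p - \<eta> n p)"
        using K(2)[of n] by (intro mult_right_mono nrm_nonneg diff_closed assms)
      also have "\<dots> < K * (e / (2 * K))"
        using N2 that K(1) by (intro mult_strict_left_mono) auto
      finally have 2: "nrm (\<phi> n) * nrm (\<lambda>p. \<eta> m p - \<eta> n p) < e / 2" using K(1) by simp
      show ?thesis using 1 2 form_diff_bound[of "\<phi> m" "\<phi> n" "\<eta> m" "\<eta> n"] assms(1,2)
        unfolding dist_norm by fastforce
    qed
    then show "\<exists>N. \<forall>m\<ge>N. \<forall>n\<ge>N. dist (B (\<phi> m) (\<eta> m)) (B (\<phi> n) (\<eta> n)) < e" by blast
  qed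
  then show ?thesis by (rule Cauchy_convergent)
qed

text \<open>The splitting in \<open>form_diff_bound\<close> multiplies one difference by
  \<open>nrm (\<eta> n)\<close> and the other by \<open>nrm (\<phi>' n)\<close>. This is why
  precisely \<open>\<eta>\<close> and \<open>\<phi>'\<close> are assumed Cauchy: it makes them
  bounded.\<close>

lemma form_limit_unique:
  assumes "\<And>n. \<phi> n \<in> V" "\<And>n. \<eta> n \<in> V" "\<And>n. \<phi>' n \<in> V" "\<And>n. \<eta>' n \<in> V"
    and "nCauchy \<phi>'" "nCauchy \<eta>"
    and "(\<lambda>n. nrm (\<lambda>p. \<phi> n p - \<phi>' n p)) \<longlonglongrightarrow> 0" "(\<lambda>n. nrm (\<lambda>p. \<eta> n p - \<eta>' n p)) \<longlonglongrightarrow> 0"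
  shows "(\<lambda>n. B (\<phi> n) (\<eta> n) - B (\<phi>' n) (\<eta>' n)) \<longlonglongrightarrow> 0"
proof -
  obtain K where K: "0 < K" "\<And>n. nrm (\<phi>' n) \<le> K" using nCauchy_bounded assms by metis
  obtain L where L: "0 < L" "\<And>n. nrm (\<eta> n) \<le> L" using nCauchy_bounded assms by metis
  have "(\<lambda>n. nrm (\<lambda>p. \<phi> n p - \<phi>' n p) * L + K * nrm (\<lambda>p. \<eta> n p - \<eta>' n p)) \<longlonglongrightarrow> 0 * L + K * 0"
    by (intro tendsto_intros assms)
  moreover have "cmod (B (\<phi> n) (\<eta> n) - B (\<phi>' n) (\<eta>' n)) \<le>
      nrm (\<lambda>p. \<phi> n p - \<phi>' n p) * L + K * nrm (\<lambda>p. \<eta> n p - \<eta>' n p)" for n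
    using form_diff_bound[OF assms(1)[of n] assms(3)[of n] assms(2)[of n] assms(4)[of n]]
      mult_left_mono[OF L(2)[of n] nrm_nonneg[OF diff_closed[OF assms(1)[of n] assms(3)[of n]]]]
      mult_right_mono[OF K(2)[of n] nrm_nonneg[OF diff_closed[OF assms(2)[of n] assms(4)[of n]]]]
    by linarith
  ultimately show ?thesis
    using Lim_null_comparison[OF always_eventually] by (metis (no_types, lifting) mult_zero_left mult_zero_right add_0)
qed

text \<open>Split \<open>B (\<phi> n) (\<phi> n)\<close> into the pairings of
  \<open>\<phi> n\<close> with \<open>\<phi> n - \<phi> N\<close> and with \<open>\<phi> N\<close>;
  the first is small by the Cauchy property, the second by weak convergence. Closability thus
  reduces to pairings with fixed members of the sequence, where derivatives can be moved.\<close>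

lemma nrm_tendsto_zero_of_weak:
  assumes "\<And>n. \<phi> n \<in> V" "nCauchy \<phi>" "\<And>N. (\<lambda>n. B (\<phi> n) (\<phi> N)) \<longlonglongrightarrow> 0"
  shows "(\<lambda>n. nrm (\<phi> n)) \<longlonglongrightarrow> 0"
proof -
  obtain K where K: "0 < K" "\<And>n. nrm (\<phi> n) \<le> K" using nCauchy_bounded assms by metis
  have "(\<lambda>n. (nrm (\<phi> n))\<^sup>2) \<longlonglongrightarrow> 0"
  proof (rule LIMSEQ_I)
    fix e :: real assume e: "0 < e"
    then obtain N where N: "\<forall>m\<ge>N. \<forall>n\<ge>N. nrm (\<lambda>p. \<phi> m p - \<phi> n p) < e / (2 * K)"
      using assms(2) K e unfolding nCauchy_def by (meson divide_pos_pos mult_pos_pos zero_less_numeral)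
    obtain N' where N': "\<forall>n\<ge>N'. cmod (B (\<phi> n) (\<phi> N)) < e / 2"
      using LIMSEQ_D[OF assms(3)[of N], of "e/2"] e by auto
    have "norm ((nrm (\<phi> n))\<^sup>2 - 0) < e" if n: "n \<ge> max N N'" for n
    proof -
      have "Re (B (\<phi> n) (\<phi> n)) = Re (B (\<phi> n) (\<lambda>p. \<phi> n p - \<phi> N p)) + Re (B (\<phi> n) (\<phi> N))"
        using assms(1) by (simp add: diff_right)
      also have "\<dots> \<le> cmod (B (\<phi> n) (\<lambda>p. \<phi> n p - \<phi> N p)) + cmod (B (\<phi> n) (\<phi> N))"
        by (intro add_mono complex_Re_le_cmod)
      also have "cmod (B (\<phi> n) (\<lambda>p. \<phi> n p - \<phi> N p)) \<le> nrm (\<phi> n) * nrm (\<lambda>p. \<phi> n p - \<phi> N p)"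
        by (intro cauchy_schwarz diff_closed assms)
      also have "\<dots> \<le> K * (e / (2 * K))"
        using n by (intro mult_mono K nrm_nonneg diff_closed assms less_imp_le[OF N[rule_format]]) (use K in auto)
      finally show ?thesis using N'[rule_format, of n] n K(1) assms(1)
        by (simp add: nrm_sq nonneg)
    qed
    then show "\<exists>no. \<forall>n\<ge>no. norm ((nrm (\<phi> n))\<^sup>2 - 0) < e" by blast
  qed
  then have "(\<lambda>n. sqrt ((nrm (\<phi> n))\<^sup>2)) \<longlonglongrightarrow> sqrt 0" by (rule tendsto_real_sqrt)
  then show ?thesis using assms(1) by (simp add: nrm_nonneg)
qed

end

section \<open>Square integrable functions as a semi-inner product space\<close>

lemma L2_mult_integrable:
  assumes "f \<in> L2 M" "h \<in> L2 M"
  shows "integrable M (\<lambda>p. f p * cnj (h p))"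
proof (rule Bochner_Integration.integrable_bound)
  show "integrable M (\<lambda>p. (cmod (f p))\<^sup>2 + (cmod (h p))\<^sup>2)"
    using assms by (auto simp: L2_def)
  have [measurable]: "f \<in> borel_measurable M" "h \<in> borel_measurable M" using assms by (auto simp: L2_def)
  show "(\<lambda>p. f p * cnj (h p)) \<in> borel_measurable M" 
    by (intro borel_measurable_times borel_measurable_continuous_on[where f=cnj] continuous_intros) auto
  show "AE p in M. norm (f p * cnj (h p)) \<le> norm ((cmod (f p))\<^sup>2 + (cmod (h p))\<^sup>2)"
  proof (rule AE_I2)
    fix p
    have "2 * (cmod (f p) * cmod (h p)) \<le> (cmod (f p))\<^sup>2 + (cmod (h p))\<^sup>2"
      using sum_squares_bound[of "cmod (f p)" "cmod (h p)"] by simp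
    moreover have "0 \<le> cmod (f p) * cmod (h p)" by simp
    ultimately show "norm (f p * cnj (h p)) \<le> norm ((cmod (f p))\<^sup>2 + (cmod (h p))\<^sup>2)"
      unfolding norm_mult complex_mod_cnj real_norm_def by linarith
  qed
qed

lemma L2_lincomb:
  assumes "f \<in> L2 M" "h \<in> L2 M"
  shows "(\<lambda>p. a * f p + b * h p) \<in> L2 M"
proof -
  have [measurable]: "f \<in> borel_measurable M" "h \<in> borel_measurable M" using assms by (auto simp: L2_def)
  have "integrable M (\<lambda>p. (cmod (a * f p + b * h p))\<^sup>2)"
  proof (rule Bochner_Integration.integrable_bound)
    show "integrable M (\<lambda>p. 2 * (cmod a)\<^sup>2 * (cmod (f p))\<^sup>2 + 2 * (cmod b)\<^sup>2 * (cmod (h p))\<^sup>2)"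
      using assms by (auto simp: L2_def)
    show "AE p in M. norm ((cmod (a * f p + b * h p))\<^sup>2) \<le>
        norm (2 * (cmod a)\<^sup>2 * (cmod (f p))\<^sup>2 + 2 * (cmod b)\<^sup>2 * (cmod (h p))\<^sup>2)"
    proof (rule AE_I2)
      fix p
      have "(cmod (a * f p + b * h p))\<^sup>2 \<le> (cmod (a * f p) + cmod (b * h p))\<^sup>2"
        by (intro power_mono norm_triangle_ineq) auto
      also have "\<dots> \<le> 2 * (cmod (a * f p))\<^sup>2 + 2 * (cmod (b * h p))\<^sup>2"
        using sum_squares_bound[of "cmod (a * f p)" "cmod (b * h p)"] by (simp add: power2_sum)
      finally show "norm ((cmod (a * f p + b * h p))\<^sup>2) \<le>
        norm (2 * (cmod a)\<^sup>2 * (cmod (f p))\<^sup>2 + 2 * (cmod b)\<^sup>2 * (cmod (h p))\<^sup>2)"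
        by (simp add: norm_mult power_mult_distrib)
    qed
  qed measurable
  then show ?thesis by (simp add: L2_def)
qed

lemma L2_inner_self: "Re (L2_inner M f f) = (LINT p|M. (cmod (f p))\<^sup>2)"
proof -
  have "L2_inner M f f = (LINT p|M. complex_of_real ((cmod (f p))\<^sup>2))"
    unfolding L2_inner_def complex_norm_square ..
  then show ?thesis by (simp only: integral_complex_of_real Re_complex_of_real)
qed

lemma semi_inner_L2: "semi_inner (L2 M) (L2_inner M)"
proof
  fix u v w :: "'a \<Rightarrow> complex" and a b :: complex
  assume u: "u \<in> L2 M" and v: "v \<in> L2 M"
  show "(\<lambda>p. a * u p + b * v p) \<in> L2 M" by (rule L2_lincomb[OF u v])
  show "L2_inner M v u = cnj (L2_inner M u v)"
    unfolding L2_inner_def using Bochner_Integration.integral_cnj[of M "\<lambda>p. u p * cnj (v p)"] by (simp add: mult.commute)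
  assume w: "w \<in> L2 M"
  have "(LINT p|M. a * (u p * cnj (w p)) + b * (v p * cnj (w p))) =
      a * (LINT p|M. u p * cnj (w p)) + b * (LINT p|M. v p * cnj (w p))"
    using L2_mult_integrable[OF u w] L2_mult_integrable[OF v w] by simp
  then show "L2_inner M (\<lambda>p. a * u p + b * v p) w = a * L2_inner M u w + b * L2_inner M v w"
    unfolding L2_inner_def by (simp add: algebra_simps)
next
  fix u show "0 \<le> Re (L2_inner M u u)" by (simp add: L2_inner_self)
qed

interpretation L2: semi_inner "L2 M" "L2_inner M" for M by (rule semi_inner_L2)

lemma L2_nrm: "L2.nrm M = L2_norm M"
  by (simp add: L2.nrm_def L2_norm_def fun_eq_iff)

lemma L2_nn_integral:
  assumes "f \<in> L2 M"
  shows "(\<integral>\<^sup>+p. ennreal ((cmod (f p))\<^sup>2) \<partial>M) = ennreal ((L2_norm M f)\<^sup>2)"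
  using assms by (subst nn_integral_eq_integral) (auto simp: L2_def L2_norm_def L2_inner_self)

subsection \<open>Completeness of \<open>L\<^sup>2\<close>\<close>

lemma (in finite_measure) L2_integrable:
  assumes "f \<in> L2 M"
  shows "integrable M f" "(LINT p|M. cmod (f p)) \<le> L2_norm M f * sqrt (measure M (space M))"
proof -
  have 1: "(\<lambda>p. 1) \<in> L2 M" by (simp add: L2_def)
  have m: "f \<in> borel_measurable M" using assms by (simp add: L2_def)
  have f: "(\<lambda>p. complex_of_real (cmod (f p))) \<in> L2 M"
    using assms by (auto simp: L2_def)
  show "integrable M f"
    using L2_mult_integrable[OF assms 1] by simp
  have "L2_inner M (\<lambda>p. complex_of_real (cmod (f p))) (\<lambda>p. 1) = of_real (LINT p|M. cmod (f p))"
    by (simp add: L2_inner_def)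
  moreover have "L2_norm M (\<lambda>p. complex_of_real (cmod (f p))) = L2_norm M f"
    by (simp add: L2_norm_def L2_inner_self)
  moreover have "L2_norm M (\<lambda>p. 1) = sqrt (measure M (space M))"
    by (simp add: L2_norm_def L2_inner_self)
  ultimately show "(LINT p|M. cmod (f p)) \<le> L2_norm M f * sqrt (measure M (space M))"
    using L2.cauchy_schwarz[OF f 1] by (simp add: L2_nrm)
qed

text \<open>Riesz-Fischer: a rapidly converging subsequence converges almost everywhere, and Fatou's
  lemma turns its pointwise limit into a limit in norm.\<close>

theorem (in finite_measure) L2_complete:
  assumes mem: "\<And>n. \<phi> n \<in> L2 M" and cauchy: "L2.nCauchy M \<phi>"
  obtains u where "u \<in> L2 M" "(\<lambda>n. L2_norm M (\<lambda>p. \<phi> n p - u p)) \<longlonglongrightarrow> 0"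
proof -
  define N where "N k = (SOME N. \<forall>m\<ge>N. \<forall>n\<ge>N. L2_norm M (\<lambda>p. \<phi> m p - \<phi> n p) < (1/2)^k)" for k
  have N: "\<forall>m\<ge>N k. \<forall>n\<ge>N k. L2_norm M (\<lambda>p. \<phi> m p - \<phi> n p) < (1/2)^k" for k
  proof -
    have "0 < (1/2::real)^k" by simp
    then have "\<exists>N. \<forall>m\<ge>N. \<forall>n\<ge>N. L2_norm M (\<lambda>p. \<phi> m p - \<phi> n p) < (1/2)^k"
      using cauchy unfolding L2.nCauchy_def L2_nrm by blast
    then show ?thesis unfolding N_def by (rule someI_ex)
  qed
  \<comment> \<open>Adding up the moduli makes the indices nondecreasing and keeps
    \<open>N k \<le> r k\<close>, so consecutive members of the subsequence differ by at most
    \<open>(1/2)^k\<close> in norm.\<close>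
  define r where "r k = (\<Sum>i\<le>k. N i)" for k
  have r: "N k \<le> r k" for k unfolding r_def by (rule member_le_sum) auto
  have r_Suc: "r k \<le> r (Suc k)" for k unfolding r_def by simp
  have [measurable]: "\<phi> n \<in> borel_measurable M" for n using mem by (simp add: L2_def)
  define h where "h k p = \<phi> (r (Suc k)) p - \<phi> (r k) p" for k p
  have hL2: "h k \<in> L2 M" for k unfolding h_def by (intro L2.diff_closed mem)
  have h_small: "L2_norm M (h k) \<le> (1/2)^k" for k
    using N[of k] r[of k] r_Suc[of k] unfolding h_def by (meson order_trans less_imp_le)
  define S where "S = sqrt (measure M (space M))"
  \<comment> \<open>Finite total measure turns the \<open>L2\<close> bound into an \<open>L1\<close>
    bound, so the telescoping series converges absolutely almost everywhere.\<close>
  have h_int: "(\<integral>\<^sup>+p. ennreal (cmod (h k p)) \<partial>M) \<le> ennreal ((1/2)^k * S)" for k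
  proof -
    have "(\<integral>\<^sup>+p. ennreal (cmod (h k p)) \<partial>M) = ennreal (LINT p|M. cmod (h k p))"
      by (intro nn_integral_eq_integral integrable_norm L2_integrable hL2) auto
    also have "\<dots> \<le> ennreal ((1/2)^k * S)"
      using L2_integrable(2)[OF hL2[of k]] mult_right_mono[OF h_small[of k], of S]
      by (intro ennreal_leI) (simp add: S_def)
    finally show ?thesis .
  qed
  have [measurable]: "h k \<in> borel_measurable M" for k using hL2 by (simp add: L2_def)
  have "(\<integral>\<^sup>+p. (\<Sum>k. ennreal (cmod (h k p))) \<partial>M) = (\<Sum>k. \<integral>\<^sup>+p. ennreal (cmod (h k p)) \<partial>M)"
    by (rule nn_integral_suminf) measurable
  also have "\<dots> \<le> (\<Sum>k. ennreal ((1/2)^k * S))"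
    by (intro suminf_le h_int) auto
  also have "\<dots> = ennreal (\<Sum>k. (1/2)^k * S)"
    by (intro suminf_ennreal2 summable_mult2 summable_geometric) (auto simp: S_def)
  also have "\<dots> < \<infinity>" by simp
  finally have "AE p in M. (\<Sum>k. ennreal (cmod (h k p))) \<noteq> \<infinity>"
    by (intro nn_integral_noteq_infinite) auto
  then have conv: "AE p in M. convergent (\<lambda>k. \<phi> (r k) p)"
  proof (rule AE_mp, intro AE_I2 impI)
    fix p assume "(\<Sum>k. ennreal (cmod (h k p))) \<noteq> \<infinity>"
    then have "summable (\<lambda>k. cmod (h k p))"
      by (intro summable_suminf_not_top) auto
    then have "summable (\<lambda>k. h k p)" by (rule summable_norm_cancel)
    then have "convergent (\<lambda>k. \<Sum>i<k. h i p)"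
      by (simp add: summable_iff_convergent)
    then have "convergent (\<lambda>k. \<phi> (r k) p - \<phi> (r 0) p)"
      by (simp add: h_def sum_lessThan_telescope[where f="\<lambda>k. \<phi> (r k) p"])
    then show "convergent (\<lambda>k. \<phi> (r k) p)"
      using convergent_add[OF _ convergent_const[of "\<phi> (r 0) p"]] by fastforce
  qed
  define u where "u p = lim (\<lambda>k. \<phi> (r k) p)" for p
  have [measurable]: "u \<in> borel_measurable M" unfolding u_def by measurable
  have lim: "AE p in M. (\<lambda>k. \<phi> (r k) p) \<longlonglongrightarrow> u p"
    using conv by (rule AE_mp) (auto simp: u_def convergent_LIMSEQ_iff)
  \<comment> \<open>Fatou along the subsequence with \<open>n\<close> held fixed: the limit inherits
    the Cauchy rate for the whole sequence, not only for the subsequence.\<close>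
  have bound: "(\<integral>\<^sup>+p. ennreal ((cmod (\<phi> n p - u p))\<^sup>2) \<partial>M) \<le> ennreal (((1/2)^j)\<^sup>2)" if "n \<ge> N j" for n j
  proof -
    have "(\<integral>\<^sup>+p. ennreal ((cmod (\<phi> n p - u p))\<^sup>2) \<partial>M) =
        (\<integral>\<^sup>+p. liminf (\<lambda>k. ennreal ((cmod (\<phi> n p - \<phi> (r k) p))\<^sup>2)) \<partial>M)"
    proof (rule nn_integral_cong_AE, use lim in \<open>rule AE_mp\<close>, intro AE_I2 impI)
      fix p assume "(\<lambda>k. \<phi> (r k) p) \<longlonglongrightarrow> u p"
      then have "(\<lambda>k. ennreal ((cmod (\<phi> n p - \<phi> (r k) p))\<^sup>2)) \<longlonglongrightarrow> ennreal ((cmod (\<phi> n p - u p))\<^sup>2)"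
        by (intro tendsto_intros tendsto_ennrealI)
      then show "ennreal ((cmod (\<phi> n p - u p))\<^sup>2) = liminf (\<lambda>k. ennreal ((cmod (\<phi> n p - \<phi> (r k) p))\<^sup>2))"
        by (rule lim_imp_Liminf[OF sequentially_bot, symmetric])
    qed
    also have "\<dots> \<le> liminf (\<lambda>k. \<integral>\<^sup>+p. ennreal ((cmod (\<phi> n p - \<phi> (r k) p))\<^sup>2) \<partial>M)"
      by (rule nn_integral_liminf) measurable
    also have "\<dots> \<le> liminf (\<lambda>k. ennreal (((1/2)^j)\<^sup>2))"
    proof (rule Liminf_mono, rule eventually_sequentiallyI)
      fix k assume k: "j \<le> k"
      have "r j \<le> r k" using k by (metis lift_Suc_mono_le r_Suc)
      then have "N j \<le> r k" using r[of j] by linarith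
      then have "L2_norm M (\<lambda>p. \<phi> n p - \<phi> (r k) p) \<le> (1/2)^j"
        using N[of j] that less_imp_le by blast
      then have "(L2_norm M (\<lambda>p. \<phi> n p - \<phi> (r k) p))\<^sup>2 \<le> ((1/2)^j)\<^sup>2"
        using L2.nrm_nonneg[OF L2.diff_closed[OF mem[of n] mem[of "r k"]]] 
        by (intro power_mono) (auto simp: L2_nrm)
      then show "(\<integral>\<^sup>+p. ennreal ((cmod (\<phi> n p - \<phi> (r k) p))\<^sup>2) \<partial>M) \<le> ennreal (((1/2)^j)\<^sup>2)"
        by (subst L2_nn_integral[OF L2.diff_closed[OF mem mem]]) (rule ennreal_leI)
    qed
    finally show ?thesis by (simp add: Liminf_const)
  qed
  have diffL2: "(\<lambda>p. \<phi> n p - u p) \<in> L2 M" if "n \<ge> N 0" for n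
    using le_less_trans[OF bound[OF that] ennreal_less_top]
    by (auto simp: L2_def integrable_iff_bounded)
  have uL2: "u \<in> L2 M"
    using L2.diff_closed[OF mem[of "N 0"] diffL2[of "N 0"]] by simp
  have diffL2': "(\<lambda>p. \<phi> n p - u p) \<in> L2 M" for n by (intro L2.diff_closed mem uL2)
  have "(\<lambda>n. L2_norm M (\<lambda>p. \<phi> n p - u p)) \<longlonglongrightarrow> 0"
  proof (rule LIMSEQ_I)
    fix e :: real assume "0 < e"
    then obtain j where j: "(1/2::real)^j < e" using real_arch_pow_inv[of e "1/2"] by auto
    have "norm (L2_norm M (\<lambda>p. \<phi> n p - u p) - 0) < e" if "n \<ge> N j" for n
    proof -
      have "ennreal ((L2_norm M (\<lambda>p. \<phi> n p - u p))\<^sup>2) \<le> ennreal (((1/2)^j)\<^sup>2)"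
        using bound[OF that] L2_nn_integral[OF diffL2'[of n]] by simp
      then have "(L2_norm M (\<lambda>p. \<phi> n p - u p))\<^sup>2 \<le> ((1/2)^j)\<^sup>2"
        by (subst (asm) ennreal_le_iff) simp_all
      then have "L2_norm M (\<lambda>p. \<phi> n p - u p) \<le> (1/2)^j"
        by (rule power2_le_imp_le) simp
      then show ?thesis using j L2.nrm_nonneg[OF diffL2'[of n]] by (simp add: L2_nrm)
    qed
    then show "\<exists>no. \<forall>n\<ge>no. norm (L2_norm M (\<lambda>p. \<phi> n p - u p) - 0) < e" by blast
  qed
  with uL2 show thesis by (rule that)
qed

subsection \<open>Closable energy forms with compact embedding\<close>

text \<open>All that the existence proof takes from geometry: \<open>closable\<close> makes the
  extended form well defined, and \<open>compact_embedding\<close> makes minimizing sequences of the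
  Rayleigh quotient converge.\<close>

locale energy_form = finite_measure M + E: semi_inner V E
  for M :: "'a measure" and V :: "('a \<Rightarrow> complex) set" and E +
  assumes V_L2: "V \<subseteq> L2 M"
    and closable: "(\<And>n. \<phi> n \<in> V) \<Longrightarrow> E.nCauchy \<phi> \<Longrightarrow> (\<lambda>n. L2_norm M (\<phi> n)) \<longlonglongrightarrow> 0 \<Longrightarrow>
          (\<lambda>n. E.nrm (\<phi> n)) \<longlonglongrightarrow> 0"
    and compact_embedding: "(\<And>n. \<phi> n \<in> V) \<Longrightarrow> (\<And>n. L2_norm M (\<phi> n) \<le> K) \<Longrightarrow> (\<And>n. E.nrm (\<phi> n) \<le> K) \<Longrightarrow>
          \<exists>r::nat \<Rightarrow> nat. strict_mono r \<and> L2.nCauchy M (\<phi> \<circ> r)"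
begin

lemma V_L2': "u \<in> V \<Longrightarrow> u \<in> L2 M"
  using V_L2 by blast

text \<open>\<open>approx\<close>, \<open>H\<close> and \<open>Ext\<close> copy the shape of
  \<open>H1_approx\<close>, \<open>H01\<close> and \<open>E_inner\<close> literally, so that on a
  manifold they coincide by unfolding.\<close>

definition approx :: "(nat \<Rightarrow> 'a \<Rightarrow> complex) \<Rightarrow> ('a \<Rightarrow> complex) \<Rightarrow> bool" where
  "approx \<phi> u \<longleftrightarrow> (\<forall>n. \<phi> n \<in> V) \<and>
     (\<forall>\<epsilon>>0. \<exists>N. \<forall>m\<ge>N. \<forall>n\<ge>N. sqrt (Re (L2_inner M (\<lambda>p. \<phi> m p - \<phi> n p) (\<lambda>p. \<phi> m p - \<phi> n p) +
        E (\<lambda>p. \<phi> m p - \<phi> n p) (\<lambda>p. \<phi> m p - \<phi> n p))) < \<epsilon>) \<and>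
     (\<lambda>n. L2_norm M (\<lambda>p. \<phi> n p - u p)) \<longlonglongrightarrow> 0"

definition H :: "('a \<Rightarrow> complex) set" where
  "H = {u \<in> L2 M. \<exists>\<phi>. approx \<phi> u}"

definition Ext :: "('a \<Rightarrow> complex) \<Rightarrow> ('a \<Rightarrow> complex) \<Rightarrow> complex" where
  "Ext u v = (THE l. \<forall>\<phi> \<eta>. approx \<phi> u \<longrightarrow> approx \<eta> v \<longrightarrow> (\<lambda>n. E (\<phi> n) (\<eta> n)) \<longlonglongrightarrow> l)"

lemma approxD:
  assumes "approx \<phi> u"
  shows "\<phi> n \<in> V" "\<phi> n \<in> L2 M" "(\<lambda>n. L2_norm M (\<lambda>p. \<phi> n p - u p)) \<longlonglongrightarrow> 0"
    and "E.nCauchy \<phi>" "L2.nCauchy M \<phi>"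
proof -
  show V: "\<phi> n \<in> V" for n using assms by (auto simp: approx_def)
  then show "\<phi> n \<in> L2 M" using V_L2 by blast
  show "(\<lambda>n. L2_norm M (\<lambda>p. \<phi> n p - u p)) \<longlonglongrightarrow> 0" using assms by (auto simp: approx_def)
  have *: "\<exists>N. \<forall>m\<ge>N. \<forall>n\<ge>N. E.nrm (\<lambda>p. \<phi> m p - \<phi> n p) < e \<and> L2.nrm M (\<lambda>p. \<phi> m p - \<phi> n p) < e"
    if e: "0 < e" for e
  proof -
    obtain N where N: "\<forall>m\<ge>N. \<forall>n\<ge>N. sqrt (Re (L2_inner M (\<lambda>p. \<phi> m p - \<phi> n p) (\<lambda>p. \<phi> m p - \<phi> n p) +
        E (\<lambda>p. \<phi> m p - \<phi> n p) (\<lambda>p. \<phi> m p - \<phi> n p))) < e"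
      using assms e unfolding approx_def by blast
    have "E.nrm (\<lambda>p. \<phi> m p - \<phi> n p) < e \<and> L2.nrm M (\<lambda>p. \<phi> m p - \<phi> n p) < e" if "m \<ge> N" "n \<ge> N" for m n
    proof -
      have d: "(\<lambda>p. \<phi> m p - \<phi> n p) \<in> V" by (intro E.diff_closed V)
      show ?thesis
        using N[rule_format, OF that] E.nonneg[OF d] L2.nonneg[OF V_L2'[OF d]]
        unfolding E.nrm_def L2.nrm_def
        by (auto elim!: le_less_trans[rotated] intro!: real_sqrt_le_mono)
    qed
    then show ?thesis by blast
  qed
  then show "E.nCauchy \<phi>" "L2.nCauchy M \<phi>" unfolding E.nCauchy_def L2.nCauchy_def by meson+
qed

lemma nCauchy_of_limit:
  assumes "\<And>n. \<phi> n \<in> L2 M" "u \<in> L2 M" "(\<lambda>n. L2_norm M (\<lambda>p. \<phi> n p - u p)) \<longlonglongrightarrow> 0"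
  shows "L2.nCauchy M \<phi>"
  unfolding L2.nCauchy_def
proof (intro allI impI)
  fix e :: real assume "0 < e"
  then obtain N where N: "\<forall>n\<ge>N. norm (L2_norm M (\<lambda>p. \<phi> n p - u p)) < e / 2"
    using LIMSEQ_D[OF assms(3), of "e/2"] by auto
  have "L2.nrm M (\<lambda>p. \<phi> m p - \<phi> n p) < e" if "m \<ge> N" "n \<ge> N" for m n
    using L2.nrm_triangle[OF assms(1)[of m] assms(2) assms(1)[of n]] N[rule_format, OF that(1)] N[rule_format, OF that(2)]
      L2.nrm_diff_commute[OF assms(2) assms(1)[of n]]
    by (simp add: L2_nrm)
  then show "\<exists>N. \<forall>m\<ge>N. \<forall>n\<ge>N. L2.nrm M (\<lambda>p. \<phi> m p - \<phi> n p) < e" by blast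
qed

lemma approxI:
  assumes V: "\<And>n. \<phi> n \<in> V" and EC: "E.nCauchy \<phi>" and u: "u \<in> L2 M"
    and lim: "(\<lambda>n. L2_norm M (\<lambda>p. \<phi> n p - u p)) \<longlonglongrightarrow> 0"
  shows "approx \<phi> u"
  unfolding approx_def
proof (intro conjI allI impI V lim)
  fix e :: real assume e: "0 < e"
  obtain N1 where N1: "\<forall>m\<ge>N1. \<forall>n\<ge>N1. E.nrm (\<lambda>p. \<phi> m p - \<phi> n p) < e / 2"
    using EC e unfolding E.nCauchy_def by (meson half_gt_zero)
  obtain N2 where N2: "\<forall>m\<ge>N2. \<forall>n\<ge>N2. L2.nrm M (\<lambda>p. \<phi> m p - \<phi> n p) < e / 2"
    using nCauchy_of_limit[OF V_L2'[OF V] u lim] e unfolding L2.nCauchy_def by (meson half_gt_zero)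
  have "sqrt (Re (L2_inner M (\<lambda>p. \<phi> m p - \<phi> n p) (\<lambda>p. \<phi> m p - \<phi> n p) +
        E (\<lambda>p. \<phi> m p - \<phi> n p) (\<lambda>p. \<phi> m p - \<phi> n p))) < e" if "m \<ge> max N1 N2" "n \<ge> max N1 N2" for m n
  proof -
    have d: "(\<lambda>p. \<phi> m p - \<phi> n p) \<in> V" by (intro E.diff_closed V)
    show ?thesis
      using N1[rule_format, of m n] N2[rule_format, of m n] that
        sqrt_add_le_add_sqrt[OF L2.nonneg[OF V_L2'[OF d]] E.nonneg[OF d]]
      unfolding E.nrm_def L2.nrm_def by simp
  qed
  then show "\<exists>N. \<forall>m\<ge>N. \<forall>n\<ge>N. sqrt (Re (L2_inner M (\<lambda>p. \<phi> m p - \<phi> n p) (\<lambda>p. \<phi> m p - \<phi> n p) +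
        E (\<lambda>p. \<phi> m p - \<phi> n p) (\<lambda>p. \<phi> m p - \<phi> n p))) < e" by blast
qed

lemma approx_diff:
  assumes "approx \<phi> u" "approx \<eta> v" "u \<in> L2 M" "v \<in> L2 M"
  shows "approx (\<lambda>n p. \<phi> n p - \<eta> n p) (\<lambda>p. u p - v p)"
proof (rule approxI)
  note a = approxD[OF assms(1)] and b = approxD[OF assms(2)]
  show "(\<lambda>p. \<phi> n p - \<eta> n p) \<in> V" for n using a b by (intro E.diff_closed)
  show "(\<lambda>p. u p - v p) \<in> L2 M" using assms by (intro L2.diff_closed)
  show "E.nCauchy (\<lambda>n p. \<phi> n p - \<eta> n p)"
    unfolding E.nCauchy_def
  proof (intro allI impI)
    fix e :: real assume e: "0 < e"
    obtain N1 where N1: "\<forall>m\<ge>N1. \<forall>n\<ge>N1. E.nrm (\<lambda>p. \<phi> m p - \<phi> n p) < e / 2"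
      using a(4) e unfolding E.nCauchy_def by (meson half_gt_zero)
    obtain N2 where N2: "\<forall>m\<ge>N2. \<forall>n\<ge>N2. E.nrm (\<lambda>p. \<eta> m p - \<eta> n p) < e / 2"
      using b(4) e unfolding E.nCauchy_def by (meson half_gt_zero)
    have "E.nrm (\<lambda>p. \<phi> m p - \<eta> m p - (\<phi> n p - \<eta> n p)) < e" if "m \<ge> max N1 N2" "n \<ge> max N1 N2" for m n
    proof -
      have "E.nrm (\<lambda>p. (\<phi> m p - \<phi> n p) - (\<eta> m p - \<eta> n p)) < e"
        using E.nrm_diff[OF E.diff_closed[OF a(1)[of m] a(1)[of n]] E.diff_closed[OF b(1)[of m] b(1)[of n]]]
          N1[rule_format, of m n] N2[rule_format, of m n] that by simp
      moreover have "(\<lambda>p. (\<phi> m p - \<phi> n p) - (\<eta> m p - \<eta> n p)) = (\<lambda>p. \<phi> m p - \<eta> m p - (\<phi> n p - \<eta> n p))"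
        by (simp add: algebra_simps)
      ultimately show ?thesis by simp
    qed
    then show "\<exists>N. \<forall>m\<ge>N. \<forall>n\<ge>N. E.nrm (\<lambda>p. \<phi> m p - \<eta> m p - (\<phi> n p - \<eta> n p)) < e" by blast
  qed
  show "(\<lambda>n. L2_norm M (\<lambda>p. \<phi> n p - \<eta> n p - (u p - v p))) \<longlonglongrightarrow> 0"
  proof (rule Lim_null_comparison[OF always_eventually])
    show "(\<lambda>n. L2_norm M (\<lambda>p. \<phi> n p - u p) + L2_norm M (\<lambda>p. \<eta> n p - v p)) \<longlonglongrightarrow> 0"
      using tendsto_add[OF a(3) b(3)] by simp
    show "\<forall>n. norm (L2_norm M (\<lambda>p. \<phi> n p - \<eta> n p - (u p - v p))) \<le>
        L2_norm M (\<lambda>p. \<phi> n p - u p) + L2_norm M (\<lambda>p. \<eta> n p - v p)"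
    proof
      fix n
      have c: "(\<lambda>p. \<phi> n p - u p) \<in> L2 M" "(\<lambda>p. \<eta> n p - v p) \<in> L2 M"
        using a(2) b(2) assms by (auto intro: L2.diff_closed)
      have "(\<lambda>p. (\<phi> n p - u p) - (\<eta> n p - v p)) = (\<lambda>p. \<phi> n p - \<eta> n p - (u p - v p))"
        by (simp add: algebra_simps)
      then show "norm (L2_norm M (\<lambda>p. \<phi> n p - \<eta> n p - (u p - v p))) \<le>
        L2_norm M (\<lambda>p. \<phi> n p - u p) + L2_norm M (\<lambda>p. \<eta> n p - v p)"
        using L2.nrm_diff[OF c] L2.nrm_nonneg[OF L2.diff_closed[OF c]] by (simp add: L2_nrm)
    qed
  qed
qed

lemma H_diff: "u \<in> H \<Longrightarrow> v \<in> H \<Longrightarrow> (\<lambda>p. u p - v p) \<in> H"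
  unfolding H_def using approx_diff L2.diff_closed by blast

lemma approx_unique:
  assumes "approx \<phi> u" "approx \<eta> u" "u \<in> L2 M"
  shows "(\<lambda>n. E.nrm (\<lambda>p. \<phi> n p - \<eta> n p)) \<longlonglongrightarrow> 0"
proof -
  \<comment> \<open>The difference approximates the zero function, which is the situation of
    \<open>closable\<close>.\<close>
  have a: "approx (\<lambda>n p. \<phi> n p - \<eta> n p) (\<lambda>p. u p - u p)"
    by (intro approx_diff assms)
  show ?thesis using approxD(3)[OF a] by (intro closable approxD(1,4)[OF a]) simp
qed

text \<open>This turns the definite description in \<open>Ext\<close> into a usable limit: one pair
  of sequences converges by the Cauchy property, and closability transfers its limit to every other
  pair.\<close>

theorem Ext_limit:
  assumes "approx \<phi> u" "approx \<eta> v" "u \<in> L2 M" "v \<in> L2 M"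
  shows "(\<lambda>n. E (\<phi> n) (\<eta> n)) \<longlonglongrightarrow> Ext u v"
proof -
  note a = approxD[OF assms(1)] and b = approxD[OF assms(2)]
  obtain l where l: "(\<lambda>n. E (\<phi> n) (\<eta> n)) \<longlonglongrightarrow> l"
    using E.form_convergent[OF a(1) b(1) a(4) b(4)] by (auto simp: convergent_def)
  have *: "(\<lambda>n. E (\<phi>' n) (\<eta>' n)) \<longlonglongrightarrow> l" if "approx \<phi>' u" "approx \<eta>' v" for \<phi>' \<eta>'
  proof -
    have "(\<lambda>n. E (\<phi> n) (\<eta> n) - E (\<phi>' n) (\<eta>' n)) \<longlonglongrightarrow> 0"
      by (intro E.form_limit_unique approx_unique[OF _ that(1)] approx_unique[OF _ that(2)]
            a b approxD[OF that(1)] approxD[OF that(2)] assms)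
    from tendsto_diff[OF l this] show ?thesis by simp
  qed
  have "Ext u v = l"
    unfolding Ext_def
  proof (rule the_equality)
    \<comment> \<open>The given approximating sequences keep this condition from being vacuous;
      without any, every number would satisfy it.\<close>
    fix l' assume "\<forall>\<phi> \<eta>. approx \<phi> u \<longrightarrow> approx \<eta> v \<longrightarrow> (\<lambda>n. E (\<phi> n) (\<eta> n)) \<longlonglongrightarrow> l'"
    then show "l' = l" using l LIMSEQ_unique assms by blast
  qed (use * in blast)
  with l show ?thesis by simp
qed

lemma L2_inner_limit:
  assumes "\<And>n. \<phi> n \<in> L2 M" "\<And>n. \<eta> n \<in> L2 M" "u \<in> L2 M" "v \<in> L2 M"
    and "(\<lambda>n. L2_norm M (\<lambda>p. \<phi> n p - u p)) \<longlonglongrightarrow> 0" "(\<lambda>n. L2_norm M (\<lambda>p. \<eta> n p - v p)) \<longlonglongrightarrow> 0"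
  shows "(\<lambda>n. L2_inner M (\<phi> n) (\<eta> n)) \<longlonglongrightarrow> L2_inner M u v"
proof -
  have "(\<lambda>n. L2_norm M (\<lambda>p. u p - u p)) \<longlonglongrightarrow> 0"
    by (simp add: L2_norm_def L2_inner_def)
  then have "L2.nCauchy M (\<lambda>n. u)" by (rule nCauchy_of_limit[OF assms(3,3)])
  then have "(\<lambda>n. L2_inner M (\<phi> n) (\<eta> n) - L2_inner M u v) \<longlonglongrightarrow> 0"
    using assms nCauchy_of_limit[OF assms(2,4,6)]
    by (intro L2.form_limit_unique[where \<phi>'="\<lambda>_. u" and \<eta>'="\<lambda>_. v"]) (auto simp: L2_nrm)
  then show ?thesis by (rule LIM_zero_cancel)
qed

lemma L2_norm_limit:
  assumes "\<And>n. \<phi> n \<in> L2 M" "u \<in> L2 M" "(\<lambda>n. L2_norm M (\<lambda>p. \<phi> n p - u p)) \<longlonglongrightarrow> 0"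
  shows "(\<lambda>n. L2_norm M (\<phi> n)) \<longlonglongrightarrow> L2_norm M u"
  unfolding L2_norm_def
  by (intro tendsto_real_sqrt tendsto_Re L2_inner_limit assms)

text \<open>The minimizer lies in \<open>H\<close> and not in \<open>V\<close>, so the eigenvalue
  equation is not found by varying the quotient at \<open>u\<close> but as the limit of a defect
  form along approximating sequences.\<close>

theorem rayleigh_minimizer:
  assumes "\<phi>0 \<in> V" "L2_norm M \<phi>0 > 0"
  obtains \<nu> u where "0 \<le> \<nu>" "u \<in> H" "L2_norm M u = 1" "\<And>v. v \<in> H \<Longrightarrow> Ext u v = of_real \<nu> * L2_inner M u v"
    "\<And>\<phi>. \<phi> \<in> V \<Longrightarrow> \<nu> * (L2_norm M \<phi>)\<^sup>2 \<le> Re (E \<phi> \<phi>)"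
proof -
  define R where "R = {Re (E \<phi> \<phi>) | \<phi>. \<phi> \<in> V \<and> L2_norm M \<phi> = 1}"
  define \<nu> where "\<nu> = Inf R"
  have normalize: "\<exists>w \<in> V. L2_norm M w = 1 \<and> Re (E \<phi> \<phi>) = (L2_norm M \<phi>)\<^sup>2 * Re (E w w)"
    if "\<phi> \<in> V" "L2_norm M \<phi> > 0" for \<phi>
  proof (intro bexI conjI)
    let ?a = "complex_of_real (1 / L2_norm M \<phi>)"
    show "(\<lambda>p. ?a * \<phi> p) \<in> V" by (intro E.scale_closed that)
    show "L2_norm M (\<lambda>p. ?a * \<phi> p) = 1"
      using that L2.nrm_scale[of \<phi> M ?a] V_L2'[OF that(1)] by (simp add: L2_nrm norm_divide)
    show "Re (E \<phi> \<phi>) = (L2_norm M \<phi>)\<^sup>2 * Re (E (\<lambda>p. ?a * \<phi> p) (\<lambda>p. ?a * \<phi> p))"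
      using that by (subst E.Re_scale) (auto simp: norm_divide power_divide)
  qed
  have ne: "R \<noteq> {}" using normalize[OF assms] by (auto simp: R_def)
  have bdd: "bdd_below R" using E.nonneg by (intro bdd_belowI[of _ 0]) (auto simp: R_def)
  have \<nu>0: "0 \<le> \<nu>" unfolding \<nu>_def using ne E.nonneg by (intro cInf_greatest) (auto simp: R_def)
  have poin: "\<nu> * (L2_norm M \<phi>)\<^sup>2 \<le> Re (E \<phi> \<phi>)" if mem: "\<phi> \<in> V" for \<phi>
  proof (cases "L2_norm M \<phi> = 0")
    case True then show ?thesis using E.nonneg that by simp
  next
    case False
    then have pos: "L2_norm M \<phi> > 0"
      using L2.nrm_nonneg[OF V_L2'[OF that]] by (simp add: L2_nrm)
    obtain w where w: "w \<in> V" "L2_norm M w = 1" "Re (E \<phi> \<phi>) = (L2_norm M \<phi>)\<^sup>2 * Re (E w w)"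
      using normalize[OF mem pos] by blast
    have "\<nu> \<le> Re (E w w)" unfolding \<nu>_def using w bdd by (intro cInf_lower) (auto simp: R_def)
    then show ?thesis using mult_left_mono[of \<nu> "Re (E w w)" "(L2_norm M \<phi>)\<^sup>2"] w by (simp add: mult.commute)
  qed
  \<comment> \<open>The defect form. It is nonnegative because \<open>\<nu>\<close> is the infimum,
    so Cauchy-Schwarz is available for it; along the minimizing sequence its seminorm tends to
    zero.\<close>
  define a where "a u v = E u v - of_real \<nu> * L2_inner M u v" for u v
  interpret a: semi_inner V a
  proof
    fix u v w b c assume u: "u \<in> V" and v: "v \<in> V"
    show "(\<lambda>p. b * u p + c * v p) \<in> V" by (intro E.lincomb u v)
    show "a v u = cnj (a u v)"
      unfolding a_def using E.hermitian[OF u v] L2.hermitian[OF V_L2'[OF u] V_L2'[OF v]] by simp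
    assume w: "w \<in> V"
    show "a (\<lambda>p. b * u p + c * v p) w = b * a u w + c * a v w"
      unfolding a_def E.lincomb_left[OF u v w] L2.lincomb_left[OF V_L2'[OF u] V_L2'[OF v] V_L2'[OF w]]
      by (simp add: algebra_simps)
  next
    fix u assume "u \<in> V"
    then show "0 \<le> Re (a u u)"
      using poin[of u] L2.nrm_sq[OF V_L2', of u] by (simp add: a_def L2_nrm)
  qed
  have a_self: "Re (a u u) = Re (E u u) - \<nu> * (L2_norm M u)\<^sup>2" if "u \<in> V" for u
    using L2.nrm_sq[OF V_L2'[OF that]] by (simp add: a_def L2_nrm)
  have "\<exists>\<phi>. \<phi> \<in> V \<and> L2_norm M \<phi> = 1 \<and> Re (E \<phi> \<phi>) < \<nu> + 1 / Suc n" for n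
    using cInf_lessD[OF ne, of "\<nu> + 1 / Suc n"] unfolding \<nu>_def R_def by auto
  then obtain \<phi> where \<phi>: "\<And>n. \<phi> n \<in> V" "\<And>n. L2_norm M (\<phi> n) = 1" "\<And>n. Re (E (\<phi> n) (\<phi> n)) < \<nu> + 1 / Suc n"
    by metis
  have b: "E.nrm (\<phi> n) \<le> sqrt (\<nu> + 1)" for n
  proof -
    have "1 / real (Suc n) \<le> 1" by simp
    then show ?thesis unfolding E.nrm_def using \<phi>(3)[of n] by (intro real_sqrt_le_mono) linarith
  qed
  \<comment> \<open>A single constant has to dominate both norms: 1 comes from the normalization and
    \<open>sqrt (\<nu> + 1)\<close> from the energy.\<close>
  obtain r :: "nat \<Rightarrow> nat" where r: "strict_mono r" "L2.nCauchy M (\<phi> \<circ> r)"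
    using compact_embedding[of \<phi> "1 + sqrt (\<nu> + 1)"] \<phi> b \<nu>0
    by (smt (verit, best) real_sqrt_ge_zero)
  define \<psi> where "\<psi> = \<phi> \<circ> r"
  have \<psi>: "\<psi> n \<in> V" "L2_norm M (\<psi> n) = 1" for n using \<phi> by (auto simp: \<psi>_def)
  have "(\<lambda>n. Re (a (\<phi> n) (\<phi> n))) \<longlonglongrightarrow> 0"
  proof (rule Lim_null_comparison[OF always_eventually])
    show "\<forall>n. norm (Re (a (\<phi> n) (\<phi> n))) \<le> 1 / Suc n"
    proof
      fix n
      show "norm (Re (a (\<phi> n) (\<phi> n))) \<le> 1 / Suc n"
        using a.nonneg[OF \<phi>(1)[of n]] a_self[OF \<phi>(1)[of n]] \<phi>(2)[of n] \<phi>(3)[of n] by simp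
    qed
    show "(\<lambda>n. 1 / real (Suc n)) \<longlonglongrightarrow> 0" by (rule LIMSEQ_Suc[OF lim_1_over_n])
  qed
  then have "(\<lambda>n. a.nrm (\<phi> n)) \<longlonglongrightarrow> 0"
    unfolding a.nrm_def using tendsto_real_sqrt[of _ 0] by simp
  then have anrm: "(\<lambda>n. a.nrm (\<psi> n)) \<longlonglongrightarrow> 0"
    unfolding \<psi>_def using LIMSEQ_subseq_LIMSEQ[OF _ r(1)] by (fastforce simp: o_def)
  have EC: "E.nCauchy \<psi>"
    unfolding E.nCauchy_def
  proof (intro allI impI)
    fix e :: real assume e: "0 < e"
    obtain N1 where N1: "\<forall>n\<ge>N1. norm (a.nrm (\<psi> n)) < e / 4"
      using LIMSEQ_D[OF anrm, of "e/4"] e by auto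
    \<comment> \<open>The summand 1 keeps the denominator positive when
      \<open>\<nu> = 0\<close>.\<close>
    have "0 < e / (2 * (sqrt \<nu> + 1))" using e \<nu>0 by (intro divide_pos_pos) (auto simp: add_nonneg_pos)
    then obtain N2 where N2: "\<forall>m\<ge>N2. \<forall>n\<ge>N2. L2.nrm M (\<lambda>p. \<psi> m p - \<psi> n p) < e / (2 * (sqrt \<nu> + 1))"
      using r(2) unfolding L2.nCauchy_def \<psi>_def by blast
    have "E.nrm (\<lambda>p. \<psi> m p - \<psi> n p) < e" if "m \<ge> max N1 N2" "n \<ge> max N1 N2" for m n
    proof -
      have d: "(\<lambda>p. \<psi> m p - \<psi> n p) \<in> V" by (intro E.diff_closed \<psi>)
      let ?d = "\<lambda>p. \<psi> m p - \<psi> n p"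
      have "Re (E ?d ?d) = Re (a ?d ?d) + \<nu> * (L2_norm M ?d)\<^sup>2" using a_self[OF d] by simp
      then have "E.nrm ?d \<le> sqrt (Re (a ?d ?d)) + sqrt (\<nu> * (L2_norm M ?d)\<^sup>2)"
        unfolding E.nrm_def using sqrt_add_le_add_sqrt[OF a.nonneg[OF d], of "\<nu> * (L2_norm M ?d)\<^sup>2"] \<nu>0 by simp
      also have "sqrt (\<nu> * (L2_norm M ?d)\<^sup>2) = sqrt \<nu> * L2.nrm M ?d"
        using L2.nrm_nonneg[OF V_L2'[OF d]] by (simp add: real_sqrt_mult L2_nrm)
      also have "sqrt \<nu> * L2.nrm M ?d \<le> (sqrt \<nu> + 1) * L2.nrm M ?d"
        using L2.nrm_nonneg[OF V_L2'[OF d]] by (intro mult_right_mono) auto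
      also have "(sqrt \<nu> + 1) * L2.nrm M ?d < (sqrt \<nu> + 1) * (e / (2 * (sqrt \<nu> + 1)))"
        using N2 that \<nu>0 by (intro mult_strict_left_mono) (auto simp: add_nonneg_pos)
      also have "(sqrt \<nu> + 1) * (e / (2 * (sqrt \<nu> + 1))) = e / 2"
      proof -
        have "sqrt \<nu> + 1 \<noteq> 0" using real_sqrt_ge_zero[OF \<nu>0] by linarith
        then show ?thesis by (metis mult.commute mult_2 nonzero_mult_div_cancel_left nonzero_mult_divide_mult_cancel_left times_divide_eq_right)
      qed
      finally have "E.nrm ?d < a.nrm ?d + e / 2" by (simp add: a.nrm_def)
      moreover have "a.nrm ?d \<le> a.nrm (\<psi> m) + a.nrm (\<psi> n)" by (intro a.nrm_diff \<psi>)
      ultimately show ?thesis using N1[rule_format, of m] N1[rule_format, of n] that by simp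
    qed
    then show "\<exists>N. \<forall>m\<ge>N. \<forall>n\<ge>N. E.nrm (\<lambda>p. \<psi> m p - \<psi> n p) < e" by blast
  qed
  obtain u where u: "u \<in> L2 M" "(\<lambda>n. L2_norm M (\<lambda>p. \<psi> n p - u p)) \<longlonglongrightarrow> 0"
    using L2_complete[of \<psi>] V_L2'[OF \<psi>(1)] r(2) unfolding \<psi>_def by blast
  have ap: "approx \<psi> u" by (intro approxI \<psi> EC u)
  have uH: "u \<in> H" using ap u by (auto simp: H_def)
  have "(\<lambda>n. L2_norm M (\<psi> n)) \<longlonglongrightarrow> L2_norm M u"
    by (intro L2_norm_limit u V_L2' \<psi>)
  then have u1: "L2_norm M u = 1" using \<psi>(2) by (simp add: LIMSEQ_const_iff)
  have eig: "Ext u v = of_real \<nu> * L2_inner M u v" if vH: "v \<in> H" for v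
  proof -
    obtain \<eta> where \<eta>: "approx \<eta> v" "v \<in> L2 M" using vH by (auto simp: H_def)
    note b = approxD[OF \<eta>(1)]
    obtain K where K: "0 < K" "\<And>n. E.nrm (\<eta> n) \<le> K" using E.nCauchy_bounded[OF b(1,4)] by metis
    have "(\<lambda>n. a (\<psi> n) (\<eta> n)) \<longlonglongrightarrow> Ext u v - of_real \<nu> * L2_inner M u v"
      unfolding a_def by (intro tendsto_intros Ext_limit[OF ap \<eta>(1) u(1) \<eta>(2)] L2_inner_limit V_L2' \<psi> b u \<eta>(2))
    \<comment> \<open>Cauchy-Schwarz for \<open>a\<close>: the first factor tends to zero, and the
      second is bounded since \<open>a\<close> is dominated by \<open>E\<close>. With the limit just
      computed this is the eigenvalue equation.\<close>
    moreover have "(\<lambda>n. a (\<psi> n) (\<eta> n)) \<longlonglongrightarrow> 0"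
    proof (rule Lim_null_comparison[OF always_eventually])
      show "(\<lambda>n. a.nrm (\<psi> n) * K) \<longlonglongrightarrow> 0" using tendsto_mult_right[OF anrm, of K] by simp
      show "\<forall>n. norm (a (\<psi> n) (\<eta> n)) \<le> a.nrm (\<psi> n) * K"
      proof
        fix n
        have "a.nrm (\<eta> n) \<le> E.nrm (\<eta> n)"
          unfolding a.nrm_def E.nrm_def using a_self[OF b(1)[of n]] \<nu>0 by simp
        then show "norm (a (\<psi> n) (\<eta> n)) \<le> a.nrm (\<psi> n) * K"
          using a.cauchy_schwarz[OF \<psi>(1)[of n] b(1)[of n]] K(2)[of n]
            mult_left_mono[of "a.nrm (\<eta> n)" K, OF _ a.nrm_nonneg[OF \<psi>(1)[of n]]] by linarith
      qed
    qed
    ultimately show ?thesis using LIMSEQ_unique by fastforce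
  qed
  show thesis by (rule that[OF \<nu>0 uH u1 eig poin])
qed

section \<open>Linear and semilinear problems under a Poincare inequality\<close>

context
  fixes lam :: real and \<phi>0 :: "'a \<Rightarrow> complex"
  assumes lam: "0 < lam" and poincare: "\<And>\<phi>. \<phi> \<in> V \<Longrightarrow> lam * (L2_norm M \<phi>)\<^sup>2 \<le> Re (E \<phi> \<phi>)"
    and V_nonempty: "\<phi>0 \<in> V"
begin

lemma poincare_nrm: "\<phi> \<in> V \<Longrightarrow> L2_norm M \<phi> \<le> E.nrm \<phi> / sqrt lam"
  using real_sqrt_le_mono[OF poincare[of \<phi>]] lam L2.nrm_nonneg[OF V_L2', of \<phi>]
  by (simp add: E.nrm_def pos_le_divide_eq L2_nrm real_sqrt_mult mult.commute)

text \<open>\<open>J\<close> is minimized over \<open>V\<close>, where the form is explicit, so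
  completeness of \<open>L2\<close> is enough: the Poincare inequality makes an energy-Cauchy
  minimizing sequence also \<open>L2\<close>-Cauchy.\<close>

theorem riesz:
  assumes h: "h \<in> L2 M"
  shows "\<exists>u\<in>H. \<forall>v\<in>H. Ext u v = L2_inner M h v"
proof -
  define J where "J \<phi> = Re (E \<phi> \<phi>) - 2 * Re (L2_inner M h \<phi>)" for \<phi>
  define c where "c = L2_norm M h / sqrt lam"
  have Jb: "- (c\<^sup>2) \<le> J \<phi>" if "\<phi> \<in> V" for \<phi>
  proof -
    have "Re (L2_inner M h \<phi>) \<le> L2_norm M h * L2_norm M \<phi>"
      using L2.cauchy_schwarz[OF h V_L2'[OF that]] complex_Re_le_cmod[of "L2_inner M h \<phi>"] by (simp add: L2_nrm)
    also have "\<dots> \<le> c * E.nrm \<phi>"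
      using mult_left_mono[OF poincare_nrm[OF that], of "L2_norm M h"] L2.nrm_nonneg[OF h]
      by (simp add: c_def L2_nrm)
    finally have "J \<phi> \<ge> (E.nrm \<phi>)\<^sup>2 - 2 * (c * E.nrm \<phi>)" unfolding J_def using E.nrm_sq[OF that] by simp
    \<comment> \<open>Completing the square bounds \<open>J\<close> from below.\<close>
    moreover have "0 \<le> (E.nrm \<phi> - c)\<^sup>2" by simp
    ultimately show ?thesis by (simp add: power2_diff algebra_simps)
  qed
  define d where "d = Inf (J ` V)"
  have bdd: "bdd_below (J ` V)" using Jb by (intro bdd_belowI[of _ "- (c\<^sup>2)"]) auto
  have dJ: "d \<le> J \<phi>" if "\<phi> \<in> V" for \<phi> unfolding d_def using that bdd by (intro cInf_lower) auto
  have "\<exists>\<phi>. \<phi> \<in> V \<and> J \<phi> < d + 1 / Suc n" for n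
    using cInf_lessD[of "J ` V" "d + 1 / Suc n"] V_nonempty unfolding d_def by auto
  then obtain \<phi> where \<phi>: "\<And>n. \<phi> n \<in> V" "\<And>n. J (\<phi> n) < d + 1 / Suc n" by metis
  have lim1: "(\<lambda>n. 1 / real (Suc n)) \<longlonglongrightarrow> 0" by (rule LIMSEQ_Suc[OF lim_1_over_n])
  have EC: "E.nCauchy \<phi>"
  proof (rule E.nCauchyI_sq)
    fix e :: real assume "0 < e"
    then obtain N where N: "\<forall>n\<ge>N. 1 / real (Suc n) < e / 4"
      using LIMSEQ_D[OF lim1, of "e/4"] by auto
    have "Re (E (\<lambda>p. \<phi> m p - \<phi> n p) (\<lambda>p. \<phi> m p - \<phi> n p)) < e" if "m \<ge> N" "n \<ge> N" for m n
    proof -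
      \<comment> \<open>Parallelogram identity at the midpoint: the linear part of \<open>J\<close>
        cancels, and \<open>d \<le> J w\<close> leaves only the excess of the two values over the
        infimum.\<close>
      define w where "w = (\<lambda>p. 1/2 * \<phi> m p + 1/2 * \<phi> n p)"
      have w: "w \<in> V" unfolding w_def by (intro E.lincomb \<phi>)
      have 1: "Re (E w w) = (1/4) * Re (E (\<phi> m) (\<phi> m)) + (1/4) * Re (E (\<phi> n) (\<phi> n)) + (1/2) * Re (E (\<phi> m) (\<phi> n))"
        unfolding w_def using E.Re_lincomb[OF \<phi>(1)[of m] \<phi>(1)[of n], of "1/2" "1/2"]
        by (simp add: power_divide norm_divide)
      have 2: "Re (L2_inner M h w) = (1/2) * Re (L2_inner M h (\<phi> m)) + (1/2) * Re (L2_inner M h (\<phi> n))"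
        unfolding w_def using L2.lincomb_right[OF V_L2'[OF \<phi>(1)[of m]] V_L2'[OF \<phi>(1)[of n]] h, of "1/2" "1/2"] by simp
      have "Re (E (\<lambda>p. \<phi> m p - \<phi> n p) (\<lambda>p. \<phi> m p - \<phi> n p)) = 2 * J (\<phi> m) + 2 * J (\<phi> n) - 4 * J w"
        unfolding J_def 1 2 E.Re_diff[OF \<phi>(1) \<phi>(1)] by simp
      then show ?thesis using dJ[OF w] \<phi>(2)[of m] \<phi>(2)[of n] N[rule_format, OF that(1)] N[rule_format, OF that(2)] by linarith
    qed
    then show "\<exists>N. \<forall>m\<ge>N. \<forall>n\<ge>N. Re (E (\<lambda>p. \<phi> m p - \<phi> n p) (\<lambda>p. \<phi> m p - \<phi> n p)) < e" by blast
  qed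
  \<comment> \<open>Quantitative Euler equation: a move from \<open>\<phi> n\<close> along
    \<open>- s z v\<close> lowers \<open>J\<close> by at least \<open>s * (cmod z)^2\<close>, while
    at most \<open>1 / Suc n\<close> remains above the infimum. The bound depends on
    \<open>v\<close> only through its energy, so \<open>v\<close> may later vary with
    \<open>n\<close>.\<close>
  have euler: "(cmod (E (\<phi> n) v - L2_inner M h v))\<^sup>2 \<le> (Re (E v v) + 1) * (1 / Suc n)" if v: "v \<in> V" for n v
  proof -
    define z where "z = E (\<phi> n) v - L2_inner M h v"
    \<comment> \<open>A step length with \<open>s * Re (E v v) \<le> 1\<close> that also makes sense
      for \<open>v\<close> of zero energy.\<close>
    define s where "s = 1 / (Re (E v v) + 1)"
    define w where "w = (\<lambda>p. 1 * \<phi> n p + (- of_real s * z) * v p)"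
    have w: "w \<in> V" unfolding w_def by (intro E.lincomb \<phi> v)
    have s: "0 < s" "s * Re (E v v) \<le> 1" using E.nonneg[OF v] by (auto simp: s_def divide_le_eq)
    have 1: "Re (E w w) = Re (E (\<phi> n) (\<phi> n)) + s\<^sup>2 * (cmod z)\<^sup>2 * Re (E v v) - 2 * s * Re (cnj z * E (\<phi> n) v)"
      unfolding w_def E.Re_lincomb[OF \<phi>(1) v] by (simp add: norm_mult power_mult_distrib algebra_simps)
    have 2: "Re (L2_inner M h w) = Re (L2_inner M h (\<phi> n)) - s * Re (cnj z * L2_inner M h v)"
      unfolding w_def L2.lincomb_right[OF V_L2'[OF \<phi>(1)] V_L2'[OF v] h] by (simp add: algebra_simps)
    have "Re (cnj z * E (\<phi> n) v) - Re (cnj z * L2_inner M h v) = Re (cnj z * z)"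
      unfolding z_def by (simp add: algebra_simps)
    also have "\<dots> = (cmod z)\<^sup>2" by (simp only: cmod_power2) (simp add: power2_eq_square)
    finally have 3: "Re (cnj z * E (\<phi> n) v) = (cmod z)\<^sup>2 + Re (cnj z * L2_inner M h v)" by simp
    have "J w = J (\<phi> n) + s * (cmod z)\<^sup>2 * (s * Re (E v v)) - 2 * s * (cmod z)\<^sup>2"
      unfolding J_def 1 2 3 by (simp add: algebra_simps power2_eq_square)
    also have "s * (cmod z)\<^sup>2 * (s * Re (E v v)) \<le> s * (cmod z)\<^sup>2 * 1"
      using s by (intro mult_left_mono) auto
    finally have "s * (cmod z)\<^sup>2 \<le> 1 / Suc n" using dJ[OF w] \<phi>(2)[of n] by simp
    then show ?thesis using E.nonneg[OF v] unfolding z_def[symmetric] s_def by (simp add: field_simps)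
  qed
  have LC: "L2.nCauchy M \<phi>"
    unfolding L2.nCauchy_def
  proof (intro allI impI)
    fix e :: real assume e: "0 < e"
    then obtain N where N: "\<forall>m\<ge>N. \<forall>n\<ge>N. E.nrm (\<lambda>p. \<phi> m p - \<phi> n p) < e * sqrt lam"
      using EC lam unfolding E.nCauchy_def by (meson mult_pos_pos real_sqrt_gt_zero)
    have "L2.nrm M (\<lambda>p. \<phi> m p - \<phi> n p) < e" if "m \<ge> N" "n \<ge> N" for m n
      using poincare_nrm[OF E.diff_closed[OF \<phi>(1) \<phi>(1)], of m n] N[rule_format, OF that] lam
      by (simp add: L2_nrm) (smt (verit) pos_divide_less_eq real_sqrt_gt_zero)
    then show "\<exists>N. \<forall>m\<ge>N. \<forall>n\<ge>N. L2.nrm M (\<lambda>p. \<phi> m p - \<phi> n p) < e" by blast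
  qed
  obtain u where u: "u \<in> L2 M" "(\<lambda>n. L2_norm M (\<lambda>p. \<phi> n p - u p)) \<longlonglongrightarrow> 0"
    using L2_complete[of \<phi>] V_L2'[OF \<phi>(1)] LC by blast
  have ap: "approx \<phi> u" by (intro approxI \<phi> EC u)
  have "Ext u v = L2_inner M h v" if vH: "v \<in> H" for v
  proof -
    obtain \<eta> where \<eta>: "approx \<eta> v" "v \<in> L2 M" using vH by (auto simp: H_def)
    note b = approxD[OF \<eta>(1)]
    obtain K where K: "0 < K" "\<And>n. E.nrm (\<eta> n) \<le> K" using E.nCauchy_bounded[OF b(1,4)] by metis
    have "(\<lambda>n. L2_norm M (\<lambda>p. h p - h p)) \<longlonglongrightarrow> 0" by (simp add: L2_norm_def L2_inner_def)
    then have "(\<lambda>n. E (\<phi> n) (\<eta> n) - L2_inner M h (\<eta> n)) \<longlonglongrightarrow> Ext u v - L2_inner M h v"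
      by (intro tendsto_intros Ext_limit[OF ap \<eta>(1) u(1) \<eta>(2)] L2_inner_limit[where \<phi>="\<lambda>_. h"] h b \<eta>(2))
    moreover have "(\<lambda>n. (cmod (E (\<phi> n) (\<eta> n) - L2_inner M h (\<eta> n)))\<^sup>2) \<longlonglongrightarrow> 0"
    proof (rule Lim_null_comparison[OF always_eventually])
      show "(\<lambda>n. (K\<^sup>2 + 1) * (1 / real (Suc n))) \<longlonglongrightarrow> 0" using tendsto_mult_left[OF lim1, of "K\<^sup>2 + 1"] by simp
      show "\<forall>n. norm ((cmod (E (\<phi> n) (\<eta> n) - L2_inner M h (\<eta> n)))\<^sup>2) \<le> (K\<^sup>2 + 1) * (1 / real (Suc n))"
      proof
        fix n
        have "Re (E (\<eta> n) (\<eta> n)) \<le> K\<^sup>2"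
          using E.nrm_sq[OF b(1)[of n]] power_mono[OF K(2)[of n] E.nrm_nonneg[OF b(1)[of n]], of 2] by simp
        then have "(Re (E (\<eta> n) (\<eta> n)) + 1) * (1 / real (Suc n)) \<le> (K\<^sup>2 + 1) * (1 / real (Suc n))"
          by (intro mult_right_mono) auto
        then show "norm ((cmod (E (\<phi> n) (\<eta> n) - L2_inner M h (\<eta> n)))\<^sup>2) \<le> (K\<^sup>2 + 1) * (1 / real (Suc n))"
          using euler[OF b(1)[of n], of n] by (simp only: real_norm_def abs_power2)
      qed
    qed
    then have "(\<lambda>n. cmod (E (\<phi> n) (\<eta> n) - L2_inner M h (\<eta> n))) \<longlonglongrightarrow> 0"
      using tendsto_real_sqrt[of "\<lambda>n. (cmod (E (\<phi> n) (\<eta> n) - L2_inner M h (\<eta> n)))\<^sup>2" 0] by simp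
    then have "(\<lambda>n. E (\<phi> n) (\<eta> n) - L2_inner M h (\<eta> n)) \<longlonglongrightarrow> 0" by (simp add: tendsto_norm_zero_iff)
    ultimately show ?thesis using LIMSEQ_unique by fastforce
  qed
  then show ?thesis using ap u by (auto simp: H_def)
qed

text \<open>Testing both equations with \<open>u - u'\<close> gives its energy as
  \<open>\<langle>h - h', u - u'\<rangle>\<close>; the Poincare inequality from below and
  Cauchy-Schwarz from above leave one factor of the norm to cancel.\<close>

lemma riesz_lipschitz:
  assumes h: "h \<in> L2 M" "h' \<in> L2 M" and u: "u \<in> H" "u' \<in> H"
    and eq: "\<And>v. v \<in> H \<Longrightarrow> Ext u v = L2_inner M h v" "\<And>v. v \<in> H \<Longrightarrow> Ext u' v = L2_inner M h' v"
  shows "lam * L2_norm M (\<lambda>p. u p - u' p) \<le> L2_norm M (\<lambda>p. h p - h' p)"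
proof -
  obtain \<phi> \<phi>' where \<phi>: "approx \<phi> u" "approx \<phi>' u'" and uL: "u \<in> L2 M" "u' \<in> L2 M"
    using u by (auto simp: H_def)
  define w where "w = (\<lambda>p. u p - u' p)"
  define \<psi> where "\<psi> = (\<lambda>n p. \<phi> n p - \<phi>' n p)"
  have ap: "approx \<psi> w" unfolding w_def \<psi>_def by (intro approx_diff \<phi> uL)
  have wL: "w \<in> L2 M" unfolding w_def by (intro L2.diff_closed uL)
  have wH: "w \<in> H" unfolding w_def by (intro H_diff u)
  have "(\<lambda>n. E (\<phi> n) (\<psi> n) - E (\<phi>' n) (\<psi> n)) \<longlonglongrightarrow> Ext u w - Ext u' w"
    by (intro tendsto_diff Ext_limit[OF _ ap] \<phi> uL wL)
  \<comment> \<open>The same sequence \<open>\<psi>\<close> stands in both arguments, so the limit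
    of the energies of \<open>\<psi> n\<close> is known and Poincare applies before passing to the
    limit.\<close>
  moreover have "E (\<phi> n) (\<psi> n) - E (\<phi>' n) (\<psi> n) = E (\<psi> n) (\<psi> n)" for n
    using E.diff_left[OF approxD(1)[OF \<phi>(1)] approxD(1)[OF \<phi>(2)] approxD(1)[OF ap]] by (simp add: \<psi>_def)
  moreover have "Ext u w - Ext u' w = L2_inner M (\<lambda>p. h p - h' p) w"
    using eq wH L2.diff_left[OF h wL] by simp
  ultimately have "(\<lambda>n. E (\<psi> n) (\<psi> n)) \<longlonglongrightarrow> L2_inner M (\<lambda>p. h p - h' p) w" by simp
  then have 1: "(\<lambda>n. Re (E (\<psi> n) (\<psi> n))) \<longlonglongrightarrow> Re (L2_inner M (\<lambda>p. h p - h' p) w)" by (rule tendsto_Re)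
  have "(\<lambda>n. L2_norm M (\<psi> n)) \<longlonglongrightarrow> L2_norm M w"
    by (intro L2_norm_limit wL approxD[OF ap])
  then have 2: "(\<lambda>n. lam * (L2_norm M (\<psi> n))\<^sup>2) \<longlonglongrightarrow> lam * (L2_norm M w)\<^sup>2"
    by (intro tendsto_intros)
  have "lam * (L2_norm M w)\<^sup>2 \<le> Re (L2_inner M (\<lambda>p. h p - h' p) w)"
    by (rule LIMSEQ_le[OF 2 1]) (use poincare[OF approxD(1)[OF ap]] in blast)
  also have "\<dots> \<le> L2_norm M (\<lambda>p. h p - h' p) * L2_norm M w"
    using L2.cauchy_schwarz[OF L2.diff_closed[OF h] wL] complex_Re_le_cmod[of "L2_inner M (\<lambda>p. h p - h' p) w"]
    by (simp add: L2_nrm)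
  finally have 3: "lam * (L2_norm M w)\<^sup>2 \<le> L2_norm M (\<lambda>p. h p - h' p) * L2_norm M w" .
  show ?thesis
  proof (cases "L2_norm M w = 0")
    case True then show ?thesis using L2.nrm_nonneg[OF L2.diff_closed[OF h]] by (simp add: w_def L2_nrm)
  next
    case False
    then have "0 < L2_norm M w" using L2.nrm_nonneg[OF wL] by (simp add: L2_nrm)
    then show ?thesis using 3 unfolding w_def[symmetric] by (simp add: power2_eq_square)
  qed
qed

lemma L2_lipschitz:
  assumes F: "C1-lipschitz_on UNIV F"
  shows "u \<in> L2 M \<Longrightarrow> (\<lambda>p. F (u p)) \<in> L2 M"
    and "u \<in> L2 M \<Longrightarrow> u' \<in> L2 M \<Longrightarrow> L2_norm M (\<lambda>p. F (u p) - F (u' p)) \<le> C1 * L2_norm M (\<lambda>p. u p - u' p)"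
proof -
  have C1: "0 \<le> C1" using F lipschitz_on_nonneg by blast
  have lip: "cmod (F x - F y) \<le> C1 * cmod (x - y)" for x y
    using lipschitz_onD[OF F, of x y] by (simp add: dist_norm)
  have cont: "continuous_on UNIV F" using F by (rule lipschitz_on_continuous_on)
  show L: "(\<lambda>p. F (u p)) \<in> L2 M" if u: "u \<in> L2 M" for u
  proof -
    have [measurable]: "u \<in> borel_measurable M" using u by (simp add: L2_def)
    have [measurable]: "(\<lambda>p. F (u p)) \<in> borel_measurable M"
      by (rule borel_measurable_continuous_on[OF cont]) measurable
    have "integrable M (\<lambda>p. (cmod (F (u p)))\<^sup>2)"
    proof (rule Bochner_Integration.integrable_bound)
      \<comment> \<open>\<open>F\<close> need not vanish at 0; the constant is integrable because
        the measure is finite.\<close>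
      show "integrable M (\<lambda>p. 2 * (cmod (F 0))\<^sup>2 + 2 * C1\<^sup>2 * (cmod (u p))\<^sup>2)"
        using u by (simp add: L2_def)
      show "AE p in M. norm ((cmod (F (u p)))\<^sup>2) \<le> norm (2 * (cmod (F 0))\<^sup>2 + 2 * C1\<^sup>2 * (cmod (u p))\<^sup>2)"
      proof (rule AE_I2)
        fix p
        have "cmod (F (u p)) \<le> cmod (F 0) + C1 * cmod (u p)"
          using lip[of "u p" 0] norm_triangle_sub[of "F (u p)" "F 0"] by simp
        then have "(cmod (F (u p)))\<^sup>2 \<le> (cmod (F 0) + C1 * cmod (u p))\<^sup>2"
          by (intro power_mono) auto
        also have "\<dots> \<le> 2 * (cmod (F 0))\<^sup>2 + 2 * (C1 * cmod (u p))\<^sup>2"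
          using sum_squares_bound[of "cmod (F 0)" "C1 * cmod (u p)"] by (simp add: power2_sum)
        finally show "norm ((cmod (F (u p)))\<^sup>2) \<le> norm (2 * (cmod (F 0))\<^sup>2 + 2 * C1\<^sup>2 * (cmod (u p))\<^sup>2)"
          by (simp add: power_mult_distrib)
      qed
    qed measurable
    then show ?thesis by (simp add: L2_def)
  qed
  assume u: "u \<in> L2 M" and u': "u' \<in> L2 M"
  have "(L2_norm M (\<lambda>p. F (u p) - F (u' p)))\<^sup>2 \<le> (C1 * L2_norm M (\<lambda>p. u p - u' p))\<^sup>2"
  proof -
    have d: "(\<lambda>p. F (u p) - F (u' p)) \<in> L2 M" "(\<lambda>p. u p - u' p) \<in> L2 M"
      by (intro L2.diff_closed L u u')+
    have "(LINT p|M. (cmod (F (u p) - F (u' p)))\<^sup>2) \<le> (LINT p|M. C1\<^sup>2 * (cmod (u p - u' p))\<^sup>2)"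
    proof (rule integral_mono)
      fix p
      show "(cmod (F (u p) - F (u' p)))\<^sup>2 \<le> C1\<^sup>2 * (cmod (u p - u' p))\<^sup>2"
        unfolding power_mult_distrib[symmetric] by (intro power_mono lip) auto
    qed (use d in \<open>auto simp: L2_def\<close>)
    then show ?thesis
      using L2.nrm_sq[OF d(1)] L2.nrm_sq[OF d(2)] unfolding L2_nrm L2_inner_self power_mult_distrib by simp
  qed
  then show "L2_norm M (\<lambda>p. F (u p) - F (u' p)) \<le> C1 * L2_norm M (\<lambda>p. u p - u' p)"
    by (rule power2_le_imp_le) (use L2.nrm_nonneg[OF L2.diff_closed[OF u u']] C1 in \<open>simp add: L2_nrm\<close>)
qed

theorem semilinear_solution:
  assumes F: "C1-lipschitz_on UNIV F" and f: "f \<in> L2 M" and small: "C1 < lam"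
  shows "\<exists>u\<in>H. \<forall>v\<in>H. Ext u v + L2_inner M (\<lambda>p. F (u p)) v = L2_inner M f v"
proof -
  have C1: "0 \<le> C1" using F lipschitz_on_nonneg by blast
  define G where "G w = (\<lambda>p. f p - F (w p))" for w
  have GL: "G w \<in> L2 M" if "w \<in> L2 M" for w unfolding G_def by (intro L2.diff_closed f L2_lipschitz[OF F] that)
  \<comment> \<open>The solution is determined only up to a null set. Any choice serves, since the
    contraction estimate below does not see null sets.\<close>
  define T where "T w = (SOME u. u \<in> H \<and> (\<forall>v\<in>H. Ext u v = L2_inner M (G w) v))" for w
  have T: "T w \<in> H \<and> (\<forall>v\<in>H. Ext (T w) v = L2_inner M (G w) v)" if "w \<in> L2 M" for w
  proof -
    have "\<exists>u. u \<in> H \<and> (\<forall>v\<in>H. Ext u v = L2_inner M (G w) v)" using riesz[OF GL[OF that]] by blast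
    from someI_ex[OF this] show ?thesis unfolding T_def .
  qed
  have TL: "T w \<in> L2 M" if "w \<in> L2 M" for w using T[OF that] by (auto simp: H_def)
  define q where "q = C1 / lam"
  have q: "0 \<le> q" "q < 1" using C1 small lam by (auto simp: q_def)
  have contr: "L2_norm M (\<lambda>p. T w p - T w' p) \<le> q * L2_norm M (\<lambda>p. w p - w' p)"
    if w: "w \<in> L2 M" "w' \<in> L2 M" for w w'
  proof -
    have "lam * L2_norm M (\<lambda>p. T w p - T w' p) \<le> L2_norm M (\<lambda>p. G w p - G w' p)"
      using T[OF w(1)] T[OF w(2)] by (intro riesz_lipschitz GL w) auto
    also have "(\<lambda>p. G w p - G w' p) = (\<lambda>p. F (w' p) - F (w p))" by (simp add: G_def)
    also have "L2_norm M (\<lambda>p. F (w' p) - F (w p)) \<le> C1 * L2_norm M (\<lambda>p. w' p - w p)"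
      by (intro L2_lipschitz[OF F] w)
    also have "L2_norm M (\<lambda>p. w' p - w p) = L2_norm M (\<lambda>p. w p - w' p)"
      using L2.nrm_diff_commute[OF w] by (simp add: L2_nrm)
    finally show ?thesis using lam by (simp add: q_def field_simps)
  qed
  define x where "x n = (T ^^ n) f" for n
  have xL: "x n \<in> L2 M" for n by (induction n) (auto simp: x_def f TL)
  define D where "D = L2_norm M (\<lambda>p. x 1 p - x 0 p)"
  have D: "0 \<le> D" using L2.nrm_nonneg[OF L2.diff_closed[OF xL[of 1] xL[of 0]]] by (simp add: D_def L2_nrm)
  have step: "L2_norm M (\<lambda>p. x (Suc n) p - x n p) \<le> q ^ n * D" for n
  proof (induction n)
    case 0 then show ?case by (simp add: D_def)
  next
    case (Suc n)
    have "L2_norm M (\<lambda>p. x (Suc (Suc n)) p - x (Suc n) p) \<le> q * L2_norm M (\<lambda>p. x (Suc n) p - x n p)"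
      using contr[OF xL[of "Suc n"] xL[of n]] by (simp add: x_def)
    also have "\<dots> \<le> q * (q ^ n * D)" using Suc q by (intro mult_left_mono) auto
    finally show ?case by simp
  qed
  have tail: "L2_norm M (\<lambda>p. x (n + k) p - x n p) \<le> (\<Sum>i<k. q ^ (n + i) * D)" for n k
  proof (induction k)
    case 0 then show ?case by (simp add: L2_norm_def L2_inner_def)
  next
    case (Suc k)
    have "L2_norm M (\<lambda>p. x (n + Suc k) p - x n p) \<le> L2_norm M (\<lambda>p. x (n + Suc k) p - x (n + k) p) + L2_norm M (\<lambda>p. x (n + k) p - x n p)"
      using L2.nrm_triangle[OF xL[of "n + Suc k"] xL[of "n + k"] xL[of n]] by (simp add: L2_nrm)
    then show ?case using Suc step[of "n + k"] by simp
  qed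
  \<comment> \<open>The geometric series bounds the distance to all later iterates uniformly in
    \<open>k\<close>.\<close>
  have tail': "L2_norm M (\<lambda>p. x (n + k) p - x n p) \<le> q ^ n * (D / (1 - q))" for n k
  proof -
    have "(\<Sum>i<k. q ^ (n + i) * D) = q ^ n * D * (\<Sum>i<k. q ^ i)"
      by (simp add: power_add sum_distrib_left mult_ac)
    also have "\<dots> \<le> q ^ n * D * (1 / (1 - q))"
      using q D by (intro mult_left_mono) (auto simp: sum_gp_strict divide_right_mono)
    finally show ?thesis using tail[where n=n and k=k] by simp
  qed
  have "(\<lambda>n. q ^ n * (D / (1 - q))) \<longlonglongrightarrow> 0 * (D / (1 - q))"
    by (intro tendsto_intros LIMSEQ_realpow_zero q)
  then have lim0: "(\<lambda>n. q ^ n * (D / (1 - q))) \<longlonglongrightarrow> 0" by simp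
  have "L2.nCauchy M x"
    unfolding L2.nCauchy_def L2_nrm
  proof (intro allI impI)
    fix e :: real assume e: "0 < e"
    then obtain N where N: "\<forall>n\<ge>N. norm (q ^ n * (D / (1 - q))) < e / 2" using LIMSEQ_D[OF lim0, of "e/2"] by auto
    have "L2_norm M (\<lambda>p. x m p - x n p) < e" if "m \<ge> N" "n \<ge> N" for m n
    proof -
      have *: "L2_norm M (\<lambda>p. x m p - x N p) < e / 2" if "m \<ge> N" for m
        using tail'[where n=N and k="m - N"] abs_ge_self[of "q ^ N * (D / (1 - q))"] N[rule_format, of N] that
        by (simp del: times_divide_eq_right)
      show ?thesis
        using L2.nrm_triangle[OF xL[of m] xL[of N] xL[of n]] *[OF that(1)] *[OF that(2)]
          L2.nrm_diff_commute[OF xL[of n] xL[of N]] by (simp add: L2_nrm)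
    qed
    then show "\<exists>N. \<forall>m\<ge>N. \<forall>n\<ge>N. L2_norm M (\<lambda>p. x m p - x n p) < e" by blast
  qed
  then obtain y where y: "y \<in> L2 M" "(\<lambda>n. L2_norm M (\<lambda>p. x n p - y p)) \<longlonglongrightarrow> 0"
    using L2_complete[of x] xL by blast
  \<comment> \<open>The limit \<open>y\<close> is only known to lie in \<open>L2\<close>; its image
    under \<open>T\<close> lies in \<open>H\<close>. Both agree in \<open>L2\<close> norm but
    possibly not pointwise, so \<open>F (y p)\<close> is replaced by \<open>F (u p)\<close> only
    inside the inner product.\<close>
  define u where "u = T y"
  have u: "u \<in> H" "\<And>v. v \<in> H \<Longrightarrow> Ext u v = L2_inner M (G y) v" using T[OF y(1)] by (auto simp: u_def)
  have uL: "u \<in> L2 M" using TL y by (simp add: u_def)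
  have "L2_norm M (\<lambda>p. u p - y p) = 0"
  proof -
    have "L2_norm M (\<lambda>p. u p - y p) \<le> q * L2_norm M (\<lambda>p. x n p - y p) + L2_norm M (\<lambda>p. x (Suc n) p - y p)" for n
      using L2.nrm_triangle[OF uL xL[of "Suc n"] y(1)] contr[OF y(1) xL[of n]] L2.nrm_diff_commute[OF xL[of n] y(1)]
      by (simp add: L2_nrm u_def x_def)
    moreover have "(\<lambda>n. q * L2_norm M (\<lambda>p. x n p - y p) + L2_norm M (\<lambda>p. x (Suc n) p - y p)) \<longlonglongrightarrow> q * 0 + 0"
      by (intro tendsto_intros y LIMSEQ_Suc[OF y(2)])
    ultimately have "L2_norm M (\<lambda>p. u p - y p) \<le> 0"
      using LIMSEQ_le_const[of _ 0] by fastforce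
    then show ?thesis using L2.nrm_nonneg[OF L2.diff_closed[OF uL y(1)]] by (simp add: L2_nrm)
  qed
  then have z: "L2_norm M (\<lambda>p. F (y p) - F (u p)) = 0"
    using L2_lipschitz(2)[OF F y(1) uL] L2.nrm_diff_commute[OF uL y(1)]
      L2.nrm_nonneg[OF L2.diff_closed[OF L2_lipschitz(1)[OF F y(1)] L2_lipschitz(1)[OF F uL]]] by (simp add: L2_nrm)
  have "Ext u v + L2_inner M (\<lambda>p. F (u p)) v = L2_inner M f v" if v: "v \<in> H" for v
  proof -
    have vL: "v \<in> L2 M" using v by (simp add: H_def)
    note FL = L2_lipschitz(1)[OF F y(1)] L2_lipschitz(1)[OF F uL]
    have "L2_inner M (\<lambda>p. F (y p)) v - L2_inner M (\<lambda>p. F (u p)) v = L2_inner M (\<lambda>p. F (y p) - F (u p)) v"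
      using L2.diff_left[OF FL vL] by simp
    also have "\<dots> = 0" using L2.cauchy_schwarz[OF L2.diff_closed[OF FL] vL] z by (simp add: L2_nrm)
    finally show ?thesis using u(2)[OF v] L2.diff_left[OF f FL(1) vL] by (simp add: G_def)
  qed
  with u(1) show ?thesis by blast
qed

end

end

subsection \<open>\<open>C\<^sup>k\<close> functions and the Poincare inequality on convex sets\<close>

lemma frechet_derivative_cong_open:
  assumes "open S" "x \<in> S" "\<And>y. y \<in> S \<Longrightarrow> f y = g y"
  shows "frechet_derivative f (at x) = frechet_derivative g (at x)"
    and "f differentiable at x \<longleftrightarrow> g differentiable at x"
proof -
  have "(f has_derivative D) (at x) \<longleftrightarrow> (g has_derivative D) (at x)" for D
    using has_derivative_transform_within_open[OF _ assms(1,2), of f D UNIV g] assms(3)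
      has_derivative_transform_within_open[OF _ assms(1,2), of g D UNIV f] by metis
  then show "frechet_derivative f (at x) = frechet_derivative g (at x)"
    and "f differentiable at x \<longleftrightarrow> g differentiable at x"
    by (auto simp: frechet_derivative_def differentiable_def)
qed

lemma Ck_on_cong:
  assumes "open S" "\<And>y. y \<in> S \<Longrightarrow> f y = g y" "Ck_on k S f"
  shows "Ck_on k S g"
  using assms
proof (induction k arbitrary: f g)
  case 0 then show ?case by (auto cong: continuous_on_cong)
next
  case (Suc k)
  have eq: "frechet_derivative f (at x) = frechet_derivative g (at x)"
      "f differentiable at x \<longleftrightarrow> g differentiable at x" if "x \<in> S" for x
    using frechet_derivative_cong_open[OF Suc.prems(1) that, of f g] Suc.prems(2) by blast+
  have "Ck_on k S (\<lambda>x. frechet_derivative g (at x) v)" for v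
  proof (rule Suc.IH[OF Suc.prems(1)])
    show "Ck_on k S (\<lambda>x. frechet_derivative f (at x) v)" using Suc.prems(3) by simp
  qed (simp add: eq)
  moreover have "g differentiable at x" if "x \<in> S" for x
    using Suc.prems(3) that eq(2)[OF that] by simp
  ultimately show ?case by simp
qed

lemma Ck_on_subset: "Ck_on k S f \<Longrightarrow> T \<subseteq> S \<Longrightarrow> Ck_on k T f"
  by (induction k arbitrary: f) (auto intro: continuous_on_subset)

text \<open>Locality is what glues a function to its extension by zero: each point has a
  neighbourhood where one of the two descriptions applies.\<close>

lemma Ck_on_local:
  assumes "\<And>x. x \<in> S \<Longrightarrow> \<exists>T. open T \<and> x \<in> T \<and> Ck_on k T f"
  shows "Ck_on k S f"
  using assms
proof (induction k arbitrary: f)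
  case 0
  have "isCont f x" if "x \<in> S" for x
    using 0[OF that] by (auto simp: continuous_on_eq_continuous_at)
  then show ?case by (simp add: continuous_at_imp_continuous_on)
next
  case (Suc k)
  have "Ck_on k S (\<lambda>x. frechet_derivative f (at x) v)" for v
  proof (rule Suc.IH)
    fix x assume "x \<in> S"
    from Suc.prems[OF this] show "\<exists>T. open T \<and> x \<in> T \<and> Ck_on k T (\<lambda>x. frechet_derivative f (at x) v)"
      by (metis Ck_on.simps(2))
  qed
  moreover have "f differentiable (at x)" if "x \<in> S" for x
    using Suc.prems[OF that] by (metis Ck_on.simps(2))
  ultimately show ?case by simp
qed

lemma Ck_on_const: "Ck_on k S (\<lambda>x. c)"
  by (induction k arbitrary: c) auto

lemma Ck_on_add:
  assumes "open S" "Ck_on k S f" "Ck_on k S g"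
  shows "Ck_on k S (\<lambda>x. f x + g x)"
  using assms
proof (induction k arbitrary: f g)
  case 0 then show ?case by (auto intro: continuous_intros)
next
  case (Suc k)
  have "Ck_on k S (\<lambda>x. frechet_derivative (\<lambda>x. f x + g x) (at x) v)" for v
  proof (rule Ck_on_cong[OF Suc.prems(1)])
    show "Ck_on k S (\<lambda>x. frechet_derivative f (at x) v + frechet_derivative g (at x) v)"
      by (rule Suc.IH[OF Suc.prems(1)]) (use Suc.prems(2,3) in simp_all)
    show "frechet_derivative f (at y) v + frechet_derivative g (at y) v =
        frechet_derivative (\<lambda>x. f x + g x) (at y) v" if "y \<in> S" for y
    proof -
      have "((\<lambda>x. f x + g x) has_derivative
          (\<lambda>v. frechet_derivative f (at y) v + frechet_derivative g (at y) v)) (at y)"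
        by (intro has_derivative_add) (use Suc.prems(2,3) that in \<open>simp_all add: frechet_derivative_works[symmetric]\<close>)
      from frechet_derivative_at[OF this] show ?thesis by metis
    qed
  qed
  moreover have "(\<lambda>x. f x + g x) differentiable at x" if "x \<in> S" for x
    using Suc.prems(2,3) that by (intro differentiable_add) simp_all
  ultimately show ?case by simp
qed

lemma Ck_on_bounded_linear:
  assumes "bounded_linear L" "open S" "Ck_on k S f"
  shows "Ck_on k S (\<lambda>x. L (f x))"
  using assms
proof (induction k arbitrary: f)
  case 0 then show ?case by (auto intro: bounded_linear.continuous_on)
next
  case (Suc k)
  have d: "((\<lambda>x. L (f x)) has_derivative (\<lambda>v. L (frechet_derivative f (at x) v))) (at x)" if "x \<in> S" for x
    by (rule bounded_linear.has_derivative[OF Suc.prems(1)])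
       (use Suc.prems(3) that in \<open>simp add: frechet_derivative_works[symmetric]\<close>)
  have "Ck_on k S (\<lambda>x. frechet_derivative (\<lambda>x. L (f x)) (at x) v)" for v
  proof (rule Ck_on_cong[OF Suc.prems(2)])
    show "Ck_on k S (\<lambda>x. L (frechet_derivative f (at x) v))"
      by (rule Suc.IH[OF Suc.prems(1,2)]) (use Suc.prems(3) in simp)
    show "L (frechet_derivative f (at y) v) = frechet_derivative (\<lambda>x. L (f x)) (at y) v" if "y \<in> S" for y
      using frechet_derivative_at[OF d[OF that]] by metis
  qed
  moreover have "(\<lambda>x. L (f x)) differentiable at x" if "x \<in> S" for x
    using d[OF that] by (rule differentiableI)
  ultimately show ?case by simp
qed

lemma Ck_on_Suc_imp:
  assumes "open S" "Ck_on (Suc k) S f"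
  shows "Ck_on k S f"
  using assms
proof (induction k arbitrary: f)
  case 0
  then show ?case by (auto intro!: continuous_at_imp_continuous_on differentiable_imp_continuous_within)
next
  case (Suc k)
  then show ?case by (metis Ck_on.simps(2))
qed

lemma Ck_on_le: "j \<le> k \<Longrightarrow> open S \<Longrightarrow> Ck_on k S f \<Longrightarrow> Ck_on j S f"
  by (induction rule: inc_induct) (auto intro: Ck_on_Suc_imp simp del: Ck_on.simps)

section \<open>Partial derivatives and the Euclidean gradient\<close>

definition pd :: "(real ^ 'n \<Rightarrow> complex) \<Rightarrow> 'n \<Rightarrow> real ^ 'n \<Rightarrow> complex" where
  "pd f i x = frechet_derivative f (at x) (axis i 1)"

lemma C1_onD:
  assumes "open S" "Ck_on 1 S f"
  shows "x \<in> S \<Longrightarrow> f differentiable at x" "continuous_on S f" "continuous_on S (pd f i)"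
    "x \<in> S \<Longrightarrow> (f has_derivative frechet_derivative f (at x)) (at x)"
proof -
  show "continuous_on S f" using Ck_on_Suc_imp[of S 0 f] assms by simp
qed (use assms in \<open>auto simp: pd_def[abs_def] frechet_derivative_works[symmetric]\<close>)

lemma C2_onD:
  assumes "Ck_on 2 S f"
  shows "Ck_on 1 S (pd f i)"
  using assms by (simp add: pd_def[abs_def] numeral_2_eq_2)

lemma linear_axis_expansion:
  fixes D :: "real ^ 'n \<Rightarrow> complex"
  assumes "linear D"
  shows "D v = (\<Sum>i\<in>UNIV. of_real (v $ i) * D (axis i 1))"
proof -
  have "v = (\<Sum>i\<in>UNIV. (v $ i) *\<^sub>R axis i 1)"
    by (simp add: vec_eq_iff axis_def if_distrib cong: if_cong)
  then have "D v = D (\<Sum>i\<in>UNIV. (v $ i) *\<^sub>R axis i 1)" by simp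
  also have "\<dots> = (\<Sum>i\<in>UNIV. of_real (v $ i) * D (axis i 1))"
    by (simp only: linear_sum[OF assms] linear_cmul[OF assms] scaleR_conv_of_real[where 'a=complex])
  finally show ?thesis .
qed

text \<open>The squared Euclidean length of the complex gradient, the coordinate counterpart of the
  energy density.\<close>

definition gsq :: "(real ^ 'n \<Rightarrow> complex) \<Rightarrow> real ^ 'n \<Rightarrow> real" where
  "gsq f x = (\<Sum>i\<in>UNIV. (cmod (pd f i x))\<^sup>2)"

lemma gsq_nonneg: "0 \<le> gsq f x"
  by (simp add: gsq_def sum_nonneg)

lemma derivative_bound_gsq:
  assumes "f differentiable at x"
  shows "(cmod (frechet_derivative f (at x) v))\<^sup>2 \<le> (norm v)\<^sup>2 * gsq f x"
proof -
  have lin: "linear (frechet_derivative f (at x))" using assms by (rule linear_frechet_derivative)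
  have "cmod (frechet_derivative f (at x) v) = cmod (\<Sum>i\<in>UNIV. of_real (v $ i) * pd f i x)"
    using linear_axis_expansion[OF lin, of v] by (simp add: pd_def)
  also have "\<dots> \<le> (\<Sum>i\<in>UNIV. \<bar>v $ i\<bar> * cmod (pd f i x))"
    by (rule order_trans[OF norm_sum]) (simp add: norm_mult)
  finally have "(cmod (frechet_derivative f (at x) v))\<^sup>2 \<le> (\<Sum>i\<in>UNIV. \<bar>v $ i\<bar> * cmod (pd f i x))\<^sup>2"
    by (intro power_mono) auto
  also have "\<dots> \<le> (\<Sum>i\<in>UNIV. \<bar>v $ i\<bar>\<^sup>2) * (\<Sum>i\<in>UNIV. (cmod (pd f i x))\<^sup>2)"
    by (rule Cauchy_Schwarz_ineq_sum)
  also have "(\<Sum>i\<in>UNIV. \<bar>v $ i\<bar>\<^sup>2) = (norm v)\<^sup>2"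
    by (simp add: norm_vec_def L2_set_def sum_nonneg)
  finally show ?thesis by (simp add: gsq_def)
qed

section \<open>Poincare inequality by averaging over segments\<close>

lemma line_bound:
  assumes S: "open S" "Ck_on 1 S u" and seg: "\<And>t. t \<in> {0..1} \<Longrightarrow> x + t *\<^sub>R (y - x) \<in> S"
  shows "ennreal ((cmod (u y - u x))\<^sup>2) \<le>
    (\<integral>\<^sup>+t. ennreal ((norm (y - x))\<^sup>2 * gsq u (x + t *\<^sub>R (y - x))) * indicator {0..1} t \<partial>lborel)"
proof -
  define h where "h t = frechet_derivative u (at (x + t *\<^sub>R (y - x))) (y - x)" for t :: real
  \<comment> \<open>The unit interval has total mass 1, so its \<open>L1\<close> norm is at most its
    \<open>L2\<close> norm; applied to the derivative along the segment, this squares the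
    fundamental theorem of calculus without loss.\<close>
  define \<nu> where "\<nu> = restrict_space lborel {0..1::real}"
  have sp: "space \<nu> = {0..1}" by (simp add: \<nu>_def space_restrict_space)
  have meas: "measure \<nu> (space \<nu>) = 1"
    unfolding \<nu>_def by (subst measure_restrict_space) (auto simp: space_restrict_space)
  interpret \<nu>: finite_measure \<nu>
    unfolding \<nu>_def by (rule finite_measureI) (subst emeasure_restrict_space, auto simp: space_restrict_space)
  have cont: "continuous_on {0..1} h"
  proof -
    have "continuous_on S (\<lambda>z. frechet_derivative u (at z) (y - x))" using S(2) by simp
    then show ?thesis unfolding h_def
      by (rule continuous_on_compose2) (use seg in \<open>auto intro!: continuous_intros\<close>)
  qed
  have hm: "h \<in> borel_measurable \<nu>"
    unfolding \<nu>_def using borel_measurable_continuous_on_restrict[OF cont]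
    by (subst measurable_cong_sets[OF sets_restrict_space_cong[OF sets_lborel] refl])
  obtain B where B: "\<And>t. t \<in> {0..1} \<Longrightarrow> cmod (h t) \<le> B"
    using compact_imp_bounded[OF compact_continuous_image[OF cont compact_Icc]] unfolding bounded_iff by blast
  have hL: "h \<in> L2 \<nu>"
    unfolding L2_def
  proof (intro CollectI conjI hm \<nu>.integrable_const_bound[where B="B\<^sup>2"])
    show "AE t in \<nu>. norm ((cmod (h t))\<^sup>2) \<le> B\<^sup>2" using B by (intro AE_I2) (auto simp: sp intro!: power_mono)
  qed (use hm in measurable)
  have "((\<lambda>t. u (x + t *\<^sub>R (y - x))) has_vector_derivative h t) (at t within {0..1})" if "t \<in> {0..1}" for t
    unfolding has_vector_derivative_def
  proof (rule has_derivative_eq_rhs)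
    show "((\<lambda>t. u (x + t *\<^sub>R (y - x))) has_derivative
        (\<lambda>s. frechet_derivative u (at (x + t *\<^sub>R (y - x))) (s *\<^sub>R (y - x)))) (at t within {0..1})"
      by (rule has_derivative_compose[where f="\<lambda>t. x + t *\<^sub>R (y - x)" and g=u and g'="frechet_derivative u (at (x + t *\<^sub>R (y - x)))" and f'="\<lambda>s. s *\<^sub>R (y - x)"])
         (use C1_onD(4)[OF S seg[OF that]] in \<open>auto intro!: derivative_eq_intros\<close>)
    show "(\<lambda>s. frechet_derivative u (at (x + t *\<^sub>R (y - x))) (s *\<^sub>R (y - x))) = (\<lambda>s. s *\<^sub>R h t)"
      using C1_onD(1)[OF S seg[OF that]] by (simp add: h_def linear_cmul[OF linear_frechet_derivative])
  qed
  then have "(\<integral>t. indicator {0..1} t *\<^sub>R h t \<partial>lborel) = u (x + 1 *\<^sub>R (y - x)) - u (x + 0 *\<^sub>R (y - x))"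
    by (intro integral_FTC_Icc) (use cont in auto)
  then have "u y - u x = (LINT t|\<nu>. h t)"
    unfolding \<nu>_def by (subst integral_restrict_space) auto
  then have "cmod (u y - u x) \<le> (LINT t|\<nu>. cmod (h t))"
    using integral_norm_bound[of \<nu> h] by simp
  also have "\<dots> \<le> L2_norm \<nu> h" using \<nu>.L2_integrable(2)[OF hL] meas by simp
  finally have "(cmod (u y - u x))\<^sup>2 \<le> (L2_norm \<nu> h)\<^sup>2" by (intro power_mono) auto
  then have "ennreal ((cmod (u y - u x))\<^sup>2) \<le> (\<integral>\<^sup>+t. ennreal ((cmod (h t))\<^sup>2) \<partial>\<nu>)"
    unfolding L2_nn_integral[OF hL] by (rule ennreal_leI)
  also have "\<dots> = (\<integral>\<^sup>+t. ennreal ((cmod (h t))\<^sup>2) * indicator {0..1} t \<partial>lborel)"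
    unfolding \<nu>_def by (subst nn_integral_restrict_space) auto
  also have "\<dots> \<le> (\<integral>\<^sup>+t. ennreal ((norm (y - x))\<^sup>2 * gsq u (x + t *\<^sub>R (y - x))) * indicator {0..1} t \<partial>lborel)"
    unfolding h_def
    by (intro nn_integral_mono) (auto simp: indicator_def intro!: ennreal_leI derivative_bound_gsq C1_onD(1)[OF S seg])
  finally show ?thesis .
qed


text \<open>The substitution has Jacobian factor \<open>\<bar>c\<bar>^(-DIM('e))\<close>, which is
  at most \<open>2^DIM('e)\<close> for such \<open>c\<close>.\<close>

lemma nn_integral_affine_le:
  fixes G :: "'e::euclidean_space \<Rightarrow> ennreal"
  assumes [measurable]: "G \<in> borel_measurable borel" and c: "1 / 2 \<le> \<bar>c\<bar>"
  shows "(\<integral>\<^sup>+y. G (z + c *\<^sub>R y) \<partial>lborel) \<le> 2 ^ DIM('e) * (\<integral>\<^sup>+y. G y \<partial>lborel)"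
proof -
  have c0: "c \<noteq> 0" using c by auto
  have "(\<integral>\<^sup>+y. G y \<partial>lborel) = (\<integral>\<^sup>+y. ennreal (\<bar>c\<bar> ^ DIM('e)) * G (z + c *\<^sub>R y) \<partial>lborel)"
    by (subst lborel_affine[OF c0, of z]) (simp add: nn_integral_density nn_integral_distr)
  also have "\<dots> = ennreal (\<bar>c\<bar> ^ DIM('e)) * (\<integral>\<^sup>+y. G (z + c *\<^sub>R y) \<partial>lborel)"
    by (rule nn_integral_cmult) measurable
  finally have eq: "(\<integral>\<^sup>+y. G y \<partial>lborel) = ennreal (\<bar>c\<bar> ^ DIM('e)) * (\<integral>\<^sup>+y. G (z + c *\<^sub>R y) \<partial>lborel)" .
  have "1 \<le> (2 * \<bar>c\<bar>) ^ DIM('e)" using c by (intro one_le_power) auto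
  then have "1 \<le> ennreal (2 ^ DIM('e) * \<bar>c\<bar> ^ DIM('e))"
    by (simp add: power_mult_distrib)
  then have 1: "1 \<le> 2 ^ DIM('e) * ennreal (\<bar>c\<bar> ^ DIM('e))"
    by (simp add: ennreal_mult ennreal_power[symmetric])
  have "1 * (\<integral>\<^sup>+y. G (z + c *\<^sub>R y) \<partial>lborel) \<le> 2 ^ DIM('e) * ennreal (\<bar>c\<bar> ^ DIM('e)) * (\<integral>\<^sup>+y. G (z + c *\<^sub>R y) \<partial>lborel)"
    by (rule mult_right_mono[OF 1]) simp
  then show ?thesis unfolding eq by (simp add: mult.assoc)
qed

text \<open>The point on the segment is \<open>(1 - t) x + t y\<close>. For
  \<open>t \<ge> 1/2\<close> one substitutes in \<open>y\<close>, otherwise one exchanges the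
  integrals and substitutes in \<open>x\<close>; the scaling factor is then never below 1/2 and the
  bound is uniform in \<open>t\<close>.\<close>

lemma nn_integral_segments_le:
  fixes G :: "'e::euclidean_space \<Rightarrow> ennreal"
  assumes G[measurable]: "G \<in> borel_measurable borel" and K[measurable]: "K \<in> sets borel" and t: "t \<in> {0..1}"
  shows "(\<integral>\<^sup>+x. (\<integral>\<^sup>+y. G (x + t *\<^sub>R (y - x)) * indicator K y \<partial>lborel) * indicator K x \<partial>lborel)
    \<le> 2 ^ DIM('e) * emeasure lborel K * (\<integral>\<^sup>+y. G y \<partial>lborel)"
proof (cases "1 / 2 \<le> t")
  case True
  have "(\<integral>\<^sup>+y. G (x + t *\<^sub>R (y - x)) * indicator K y \<partial>lborel) \<le> 2 ^ DIM('e) * (\<integral>\<^sup>+y. G y \<partial>lborel)" for x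
  proof -
    have "(\<integral>\<^sup>+y. G (x + t *\<^sub>R (y - x)) * indicator K y \<partial>lborel) \<le> (\<integral>\<^sup>+y. G ((1 - t) *\<^sub>R x + t *\<^sub>R y) \<partial>lborel)"
      by (intro nn_integral_mono) (auto simp: indicator_def algebra_simps)
    also have "\<dots> \<le> 2 ^ DIM('e) * (\<integral>\<^sup>+y. G y \<partial>lborel)"
      using True by (intro nn_integral_affine_le) auto
    finally show ?thesis .
  qed
  then have "(\<integral>\<^sup>+x. (\<integral>\<^sup>+y. G (x + t *\<^sub>R (y - x)) * indicator K y \<partial>lborel) * indicator K x \<partial>lborel)
      \<le> (\<integral>\<^sup>+x. 2 ^ DIM('e) * (\<integral>\<^sup>+y. G y \<partial>lborel) * indicator K x \<partial>lborel)"
    by (intro nn_integral_mono mult_right_mono) auto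
  also have "\<dots> = 2 ^ DIM('e) * (\<integral>\<^sup>+y. G y \<partial>lborel) * emeasure lborel K"
    by (rule nn_integral_cmult_indicator) simp
  finally show ?thesis by (simp add: mult_ac)
next
  case False
  have "(\<integral>\<^sup>+x. G (x + t *\<^sub>R (y - x)) * indicator K x \<partial>lborel) \<le> 2 ^ DIM('e) * (\<integral>\<^sup>+y. G y \<partial>lborel)" for y
  proof -
    have "(\<integral>\<^sup>+x. G (x + t *\<^sub>R (y - x)) * indicator K x \<partial>lborel) \<le> (\<integral>\<^sup>+x. G (t *\<^sub>R y + (1 - t) *\<^sub>R x) \<partial>lborel)"
      by (intro nn_integral_mono) (auto simp: indicator_def algebra_simps)
    also have "\<dots> \<le> 2 ^ DIM('e) * (\<integral>\<^sup>+y. G y \<partial>lborel)"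
      using False t by (intro nn_integral_affine_le) auto
    finally show ?thesis .
  qed
  then have le: "(\<integral>\<^sup>+y. (\<integral>\<^sup>+x. G (x + t *\<^sub>R (y - x)) * indicator K x \<partial>lborel) * indicator K y \<partial>lborel)
      \<le> (\<integral>\<^sup>+y. 2 ^ DIM('e) * (\<integral>\<^sup>+y. G y \<partial>lborel) * indicator K y \<partial>lborel)"
    by (intro nn_integral_mono mult_right_mono) auto
  have "(\<integral>\<^sup>+x. (\<integral>\<^sup>+y. G (x + t *\<^sub>R (y - x)) * indicator K y \<partial>lborel) * indicator K x \<partial>lborel) =
      (\<integral>\<^sup>+x. (\<integral>\<^sup>+y. G (x + t *\<^sub>R (y - x)) * indicator K y * indicator K x \<partial>lborel) \<partial>lborel)"
    by (intro nn_integral_cong nn_integral_multc[symmetric]) measurable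
  also have "\<dots> = (\<integral>\<^sup>+y. (\<integral>\<^sup>+x. G (x + t *\<^sub>R (y - x)) * indicator K y * indicator K x \<partial>lborel) \<partial>lborel)"
    by (rule lborel_pair.Fubini') measurable
  also have "\<dots> = (\<integral>\<^sup>+y. (\<integral>\<^sup>+x. G (x + t *\<^sub>R (y - x)) * indicator K x \<partial>lborel) * indicator K y \<partial>lborel)"
  proof (intro nn_integral_cong)
    fix y
    have "(\<integral>\<^sup>+x. G (x + t *\<^sub>R (y - x)) * indicator K y * indicator K x \<partial>lborel) =
        (\<integral>\<^sup>+x. (G (x + t *\<^sub>R (y - x)) * indicator K x) * indicator K y \<partial>lborel)"
      by (simp add: mult_ac)
    also have "\<dots> = (\<integral>\<^sup>+x. G (x + t *\<^sub>R (y - x)) * indicator K x \<partial>lborel) * indicator K y"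
      by (rule nn_integral_multc) measurable
    finally show "(\<integral>\<^sup>+x. G (x + t *\<^sub>R (y - x)) * indicator K y * indicator K x \<partial>lborel) = \<dots>" .
  qed
  also have "\<dots> \<le> 2 ^ DIM('e) * (\<integral>\<^sup>+y. G y \<partial>lborel) * emeasure lborel K"
    using le by (simp add: nn_integral_cmult_indicator)
  finally show ?thesis by (simp add: mult_ac)
qed

lemma nn_integral_difference_le:
  fixes u :: "real ^ 'n \<Rightarrow> complex"
  assumes S: "open S" "Ck_on 1 S u" and K: "compact K" "convex K" "K \<subseteq> S"
    and d: "\<And>x y. x \<in> K \<Longrightarrow> y \<in> K \<Longrightarrow> dist x y \<le> d"
  shows "(\<integral>\<^sup>+x. (\<integral>\<^sup>+y. ennreal ((cmod (u y - u x))\<^sup>2) * indicator K y \<partial>lborel) * indicator K x \<partial>lborel)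
    \<le> ennreal (d\<^sup>2) * 2 ^ CARD('n) * emeasure lborel K * (\<integral>\<^sup>+y. ennreal (gsq u y) * indicator K y \<partial>lborel)"
proof -
  \<comment> \<open>Cutting off outside \<open>K\<close> makes the integrand Borel on the whole
    space; by convexity no segment between points of \<open>K\<close> meets the cut.\<close>
  define G where "G y = ennreal (gsq u y * indicator K y)" for y
  have Kb: "K \<in> sets borel" using K(1) by (rule borel_compact)
  note [measurable] = Kb
  have [measurable]: "G \<in> borel_measurable borel"
  proof -
    have "continuous_on K (gsq u)" unfolding gsq_def
      using continuous_on_subset[OF C1_onD(3)[OF S] K(3)] by (intro continuous_intros)
    from borel_measurable_continuous_on_indicator[OF Kb this] show ?thesis
      unfolding G_def by (simp add: mult.commute)
  qed
  have pt: "ennreal ((cmod (u y - u x))\<^sup>2) * indicator K y * indicator K x \<le>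
      (\<integral>\<^sup>+t. ennreal (d\<^sup>2) * (G (x + t *\<^sub>R (y - x)) * indicator {0..1} t * indicator K y * indicator K x) \<partial>lborel)" for x y
  proof (cases "x \<in> K \<and> y \<in> K")
    case True
    have seg: "x + t *\<^sub>R (y - x) \<in> K" if "t \<in> {0..1}" for t
      using convexD_alt[OF K(2), of x y t] True that by (simp add: algebra_simps)
    have "ennreal ((cmod (u y - u x))\<^sup>2) \<le>
        (\<integral>\<^sup>+t. ennreal ((norm (y - x))\<^sup>2 * gsq u (x + t *\<^sub>R (y - x))) * indicator {0..1} t \<partial>lborel)"
      using seg K(3) by (intro line_bound[OF S]) auto
    also have "\<dots> \<le> (\<integral>\<^sup>+t. ennreal (d\<^sup>2) * (G (x + t *\<^sub>R (y - x)) * indicator {0..1} t) \<partial>lborel)"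
    proof (intro nn_integral_mono)
      fix t :: real
      have "(norm (y - x))\<^sup>2 \<le> d\<^sup>2"
        using d[of y x] True by (intro power_mono) (auto simp: dist_norm)
      then have "(norm (y - x))\<^sup>2 * gsq u (x + t *\<^sub>R (y - x)) \<le> d\<^sup>2 * gsq u (x + t *\<^sub>R (y - x))"
        by (intro mult_right_mono gsq_nonneg)
      then show "ennreal ((norm (y - x))\<^sup>2 * gsq u (x + t *\<^sub>R (y - x))) * indicator {0..1} t \<le>
          ennreal (d\<^sup>2) * (G (x + t *\<^sub>R (y - x)) * indicator {0..1} t)"
        using seg[of t] by (auto simp: G_def indicator_def ennreal_mult'[symmetric] intro!: ennreal_leI)
    qed
    finally show ?thesis using True by simp
  qed auto
  let ?F = "\<lambda>t x y. G (x + t *\<^sub>R (y - x)) * indicator {0..1} t * indicator K y * indicator K x :: ennreal"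
  have "(\<integral>\<^sup>+x. (\<integral>\<^sup>+y. ennreal ((cmod (u y - u x))\<^sup>2) * indicator K y \<partial>lborel) * indicator K x \<partial>lborel)
      \<le> (\<integral>\<^sup>+x. (\<integral>\<^sup>+y. (\<integral>\<^sup>+t. ennreal (d\<^sup>2) * ?F t x y \<partial>lborel) \<partial>lborel) \<partial>lborel)"
  proof (intro nn_integral_mono)
    fix x
    show "(\<integral>\<^sup>+y. ennreal ((cmod (u y - u x))\<^sup>2) * indicator K y \<partial>lborel) * indicator K x
        \<le> (\<integral>\<^sup>+y. (\<integral>\<^sup>+t. ennreal (d\<^sup>2) * ?F t x y \<partial>lborel) \<partial>lborel)"
    proof (cases "x \<in> K")
      case True
      then show ?thesis using pt[of _ x] by (auto intro!: nn_integral_mono)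
    qed simp
  qed
  \<comment> \<open>Two exchanges bring \<open>t\<close> outermost, where the estimate for a fixed
    position on the segments applies.\<close>
  also have "\<dots> = (\<integral>\<^sup>+x. (\<integral>\<^sup>+t. (\<integral>\<^sup>+y. ennreal (d\<^sup>2) * ?F t x y \<partial>lborel) \<partial>lborel) \<partial>lborel)"
    by (intro nn_integral_cong lborel_pair.Fubini') measurable
  also have "\<dots> = (\<integral>\<^sup>+t. (\<integral>\<^sup>+x. (\<integral>\<^sup>+y. ennreal (d\<^sup>2) * ?F t x y \<partial>lborel) \<partial>lborel) \<partial>lborel)"
    by (rule lborel_pair.Fubini') measurable
  also have "\<dots> \<le> (\<integral>\<^sup>+(t::real). ennreal (d\<^sup>2) * (2 ^ DIM(real ^ 'n) * emeasure lborel K * (\<integral>\<^sup>+y. G y \<partial>lborel)) * indicator {0..1} t \<partial>lborel)"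
  proof (intro nn_integral_mono)
    fix t :: real
    have "(\<integral>\<^sup>+x. (\<integral>\<^sup>+y. ennreal (d\<^sup>2) * ?F t x y \<partial>lborel) \<partial>lborel) =
        ennreal (d\<^sup>2) * (\<integral>\<^sup>+x. (\<integral>\<^sup>+y. G (x + t *\<^sub>R (y - x)) * indicator K y \<partial>lborel) * indicator K x \<partial>lborel)"
      if "t \<in> {0..1}"
    proof -
      have "(\<integral>\<^sup>+y. ennreal (d\<^sup>2) * ?F t x y \<partial>lborel) =
          ennreal (d\<^sup>2) * ((\<integral>\<^sup>+y. G (x + t *\<^sub>R (y - x)) * indicator K y \<partial>lborel) * indicator K x)" for x
        using that by (subst nn_integral_cmult, measurable) (simp add: nn_integral_multc)
      then show ?thesis by (simp add: nn_integral_cmult)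
    qed
    then show "(\<integral>\<^sup>+x. (\<integral>\<^sup>+y. ennreal (d\<^sup>2) * ?F t x y \<partial>lborel) \<partial>lborel) \<le>
        ennreal (d\<^sup>2) * (2 ^ DIM(real ^ 'n) * emeasure lborel K * (\<integral>\<^sup>+y. G y \<partial>lborel)) * indicator {0..1} t"
      using nn_integral_segments_le[of G K t] by (cases "t \<in> {0..1}") (auto intro!: mult_left_mono)
  qed
  also have "\<dots> = ennreal (d\<^sup>2) * (2 ^ DIM(real ^ 'n) * emeasure lborel K * (\<integral>\<^sup>+y. G y \<partial>lborel))"
    by (subst nn_integral_cmult_indicator) auto
  also have "(\<integral>\<^sup>+y. G y \<partial>lborel) = (\<integral>\<^sup>+y. ennreal (gsq u y) * indicator K y \<partial>lborel)"
    unfolding G_def by (intro nn_integral_cong) (auto simp: indicator_def)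
  finally show ?thesis by (simp add: mult.assoc)
qed

lemma finite_measure_compact:
  "compact (K :: 'e::euclidean_space set) \<Longrightarrow> finite_measure (restrict_space lborel K)"
  using emeasure_compact_finite[of K]
  by (intro finite_measureI) (subst emeasure_restrict_space, auto simp: space_restrict_space borel_compact)

lemma borel_measurable_compact:
  fixes f :: "'e::euclidean_space \<Rightarrow> 'b::topological_space"
  assumes "continuous_on K f"
  shows "f \<in> borel_measurable (restrict_space lborel K)"
  using borel_measurable_continuous_on_restrict[OF assms]
  by (subst measurable_cong_sets[OF sets_restrict_space_cong[OF sets_lborel] refl])

lemma continuous_L2:
  fixes f :: "'e::euclidean_space \<Rightarrow> complex"
  assumes "compact K" "continuous_on K f"
  shows "f \<in> L2 (restrict_space lborel K)"
proof -
  interpret finite_measure "restrict_space lborel K" by (rule finite_measure_compact[OF assms(1)])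
  note [measurable] = borel_measurable_compact[OF assms(2)]
  obtain B where B: "\<And>t. t \<in> K \<Longrightarrow> cmod (f t) \<le> B"
    using compact_imp_bounded[OF compact_continuous_image[OF assms(2,1)]] unfolding bounded_iff by blast
  have "integrable (restrict_space lborel K) (\<lambda>x. (cmod (f x))\<^sup>2)"
  proof (rule integrable_const_bound[where B="B\<^sup>2"])
    show "AE t in restrict_space lborel K. norm ((cmod (f t))\<^sup>2) \<le> B\<^sup>2"
      using B by (intro AE_I2) (auto simp: space_restrict_space intro!: power_mono)
  qed measurable
  then show ?thesis by (simp add: L2_def borel_measurable_compact[OF assms(2)])
qed

lemma integral_restrict_eq:
  fixes f :: "'e::euclidean_space \<Rightarrow> 'b::euclidean_space"
  assumes "compact K" "continuous_on K f"
  shows "(LINT x|restrict_space lborel K. f x) = integral K f" "f integrable_on K"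
proof -
  have *: "set_integrable lborel K f"
    unfolding set_integrable_def by (rule borel_integrable_compact[OF assms])
  show "(LINT x|restrict_space lborel K. f x) = integral K f"
    using set_borel_integral_eq_integral(2)[OF *] borel_compact[OF assms(1)]
    by (subst integral_restrict_space) (auto simp: set_lebesgue_integral_def)
  show "f integrable_on K" by (rule set_borel_integral_eq_integral(1)[OF *])
qed

lemma continuous_on_gsq:
  assumes "open S" "Ck_on 1 S u" "K \<subseteq> S"
  shows "continuous_on K (gsq u)"
  unfolding gsq_def using continuous_on_subset[OF C1_onD(3)[OF assms(1,2)] assms(3)]
  by (intro continuous_intros)

lemma L2_norm_sq_eq_integral:
  fixes f :: "'e::euclidean_space \<Rightarrow> complex"
  assumes "compact K" "continuous_on K f"
  shows "(L2_norm (restrict_space lborel K) f)\<^sup>2 = integral K (\<lambda>x. (cmod (f x))\<^sup>2)"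
proof -
  have "(L2_norm (restrict_space lborel K) f)\<^sup>2 = (LINT x|restrict_space lborel K. (cmod (f x))\<^sup>2)"
    unfolding L2_inner_self[symmetric] using L2.nrm_sq[OF continuous_L2[OF assms]] by (simp add: L2_nrm)
  also have "\<dots> = integral K (\<lambda>x. (cmod (f x))\<^sup>2)"
    using assms by (intro integral_restrict_eq continuous_intros)
  finally show ?thesis .
qed

text \<open>A variance identity: the double integral of \<open>(cmod (u y - u x))^2\<close> over
  \<open>K\<close> equals \<open>2 * (k * N - (cmod I)^2)\<close> with volume \<open>k\<close>,
  squared norm \<open>N\<close> and integral \<open>I\<close>. Bounding it by the gradient controls
  \<open>N\<close> by the average.\<close>

lemma poincare_convex:
  fixes u :: "real ^ 'n \<Rightarrow> complex"
  assumes S: "open S" "Ck_on 1 S u" and K: "compact K" "convex K" "K \<subseteq> S"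
    and d: "\<And>x y. x \<in> K \<Longrightarrow> y \<in> K \<Longrightarrow> dist x y \<le> d" and pos: "0 < measure lborel K"
  shows "integral K (\<lambda>x. (cmod (u x))\<^sup>2) \<le>
    (cmod (integral K u))\<^sup>2 / measure lborel K + d\<^sup>2 * 2 ^ CARD('n) * integral K (gsq u)"
proof -
  define \<nu> where "\<nu> = restrict_space lborel K"
  interpret \<nu>: finite_measure \<nu> unfolding \<nu>_def by (rule finite_measure_compact[OF K(1)])
  have [measurable, simp]: "K \<in> sets borel" using K(1) by (rule borel_compact)
  define k where "k = measure lborel K"
  have \<nu>_space: "measure \<nu> (space \<nu>) = k"
    unfolding \<nu>_def k_def by (subst measure_restrict_space) (auto simp: space_restrict_space)
  have em: "emeasure lborel K = ennreal k"
    unfolding k_def using emeasure_compact_finite[OF K(1)]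
    by (intro emeasure_eq_ennreal_measure) (simp add: top.not_eq_extremum)
  have cont: "continuous_on K u" using C1_onD(2)[OF S] K(3) by (rule continuous_on_subset)
  have uL: "u \<in> L2 \<nu>" unfolding \<nu>_def by (rule continuous_L2[OF K(1) cont])
  have cL: "(\<lambda>_. c) \<in> L2 \<nu>" for c by (simp add: L2_def)
  define I where "I = (LINT x|\<nu>. u x)"
  have uint: "integrable \<nu> u" by (rule \<nu>.L2_integrable[OF uL])
  define N where "N = (L2_norm \<nu> u)\<^sup>2"
  have N_eq: "N = (LINT x|\<nu>. (cmod (u x))\<^sup>2)"
    unfolding N_def L2_inner_self[symmetric] using L2.nrm_sq[OF uL] by (simp add: L2_nrm)
  \<comment> \<open>The inner integral of the squared difference, expanded for fixed
    \<open>x\<close>, with \<open>u x\<close> regarded as a constant function.\<close>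
  define q where "q x = N + k * (cmod (u x))\<^sup>2 - 2 * Re (I * cnj (u x))" for x
  have q: "(L2_norm \<nu> (\<lambda>y. u y - u x))\<^sup>2 = q x" for x
  proof -
    have "(L2_norm \<nu> (\<lambda>y. u y - u x))\<^sup>2 = Re (L2_inner \<nu> u u) + Re (L2_inner \<nu> (\<lambda>_. u x) (\<lambda>_. u x))
        - 2 * Re (L2_inner \<nu> u (\<lambda>_. u x))"
      using L2.nrm_sq[OF L2.diff_closed[OF uL cL]] L2.Re_diff[OF uL cL] by (simp add: L2_nrm)
    also have "Re (L2_inner \<nu> (\<lambda>_. u x) (\<lambda>_. u x)) = k * (cmod (u x))\<^sup>2"
      unfolding L2_inner_self by (simp add: \<nu>_space)
    also have "L2_inner \<nu> u (\<lambda>_. u x) = I * cnj (u x)" unfolding L2_inner_def I_def by simp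
    also have "Re (L2_inner \<nu> u u) = N" by (simp add: L2_inner_self N_eq)
    finally show ?thesis by (simp add: q_def)
  qed
  have "0 \<le> q x" for x unfolding q[symmetric] by simp
  have usq: "integrable \<nu> (\<lambda>x. (cmod (u x))\<^sup>2)" using uL by (simp add: L2_def)
  have cint: "integrable \<nu> (\<lambda>x. I * cnj (u x))" using uint by simp
  have qint: "integrable \<nu> q" unfolding q_def
    by (intro Bochner_Integration.integrable_diff Bochner_Integration.integrable_add integrable_mult_right integrable_Re cint usq) simp
  have qval: "(LINT x|\<nu>. q x) = 2 * (k * N - (cmod I)\<^sup>2)"
  proof -
    have "(LINT x|\<nu>. q x) = (LINT x|\<nu>. N) + (LINT x|\<nu>. k * (cmod (u x))\<^sup>2) - (LINT x|\<nu>. 2 * Re (I * cnj (u x)))"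
    proof -
      have "integrable \<nu> (\<lambda>x. 2 * Re (I * cnj (u x)))" by (intro integrable_mult_right integrable_Re cint)
      moreover have "integrable \<nu> (\<lambda>x. N)" "integrable \<nu> (\<lambda>x. k * (cmod (u x))\<^sup>2)" using usq by simp_all
      ultimately show ?thesis
        unfolding q_def by (simp only: Bochner_Integration.integral_diff Bochner_Integration.integral_add
            Bochner_Integration.integrable_add)
    qed
    also have "(LINT x|\<nu>. 2 * Re (I * cnj (u x))) = 2 * Re (LINT x|\<nu>. I * cnj (u x))"
      using cint by (simp only: integral_mult_right_zero integral_Re)
    also have "(LINT x|\<nu>. I * cnj (u x)) = I * cnj I"
      unfolding I_def by simp
    also have "Re (I * cnj I) = (cmod I)\<^sup>2"
      by (metis complex_norm_square Re_complex_of_real)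
    finally show ?thesis by (simp add: N_eq[symmetric] \<nu>_space algebra_simps)
  qed
  have "ennreal (2 * (k * N - (cmod I)\<^sup>2)) = (\<integral>\<^sup>+x. ennreal (q x) \<partial>\<nu>)"
    using qint \<open>\<And>x. 0 \<le> q x\<close> by (subst nn_integral_eq_integral) (auto simp: qval)
  also have "\<dots> = (\<integral>\<^sup>+x. (\<integral>\<^sup>+y. ennreal ((cmod (u y - u x))\<^sup>2) \<partial>\<nu>) \<partial>\<nu>)"
    unfolding L2_nn_integral[OF L2.diff_closed[OF uL cL]] q ..
  also have "\<dots> = (\<integral>\<^sup>+x. (\<integral>\<^sup>+y. ennreal ((cmod (u y - u x))\<^sup>2) * indicator K y \<partial>lborel) * indicator K x \<partial>lborel)"
    unfolding \<nu>_def by (simp add: nn_integral_restrict_space)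
  also have "\<dots> \<le> ennreal (d\<^sup>2) * 2 ^ CARD('n) * emeasure lborel K * (\<integral>\<^sup>+y. ennreal (gsq u y) * indicator K y \<partial>lborel)"
    by (rule nn_integral_difference_le[OF S K d])
  also have "(\<integral>\<^sup>+y. ennreal (gsq u y) * indicator K y \<partial>lborel) = (\<integral>\<^sup>+y. ennreal (gsq u y) \<partial>\<nu>)"
    unfolding \<nu>_def by (simp add: nn_integral_restrict_space)
  also have "\<dots> = ennreal (integral K (gsq u))"
  proof -
    have gc: "continuous_on K (gsq u)" by (rule continuous_on_gsq[OF S K(3)])
    have "integrable \<nu> (gsq u)"
      unfolding \<nu>_def using borel_integrable_compact[OF K(1) gc]
      by (subst integrable_restrict_space) auto
    then show ?thesis
      using integral_restrict_eq(1)[OF K(1) gc]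
      by (subst nn_integral_eq_integral) (auto simp: gsq_nonneg \<nu>_def)
  qed
  also have "ennreal (d\<^sup>2) * 2 ^ CARD('n) * emeasure lborel K * ennreal (integral K (gsq u)) =
      ennreal (d\<^sup>2 * 2 ^ CARD('n) * k * integral K (gsq u))"
  proof -
    have "2 ^ CARD('n) = ennreal (2 ^ CARD('n))" by (simp add: ennreal_power[symmetric])
    moreover have "0 \<le> k" by (simp add: k_def)
    ultimately show ?thesis
      unfolding em by (simp add: ennreal_mult' ennreal_mult'' zero_le_mult_iff)
  qed
  finally have "2 * (k * N - (cmod I)\<^sup>2) \<le> d\<^sup>2 * 2 ^ CARD('n) * k * integral K (gsq u)"
  proof (subst (asm) ennreal_le_iff)
    have "0 \<le> integral K (gsq u)"
      by (intro integral_nonneg integral_restrict_eq(2) continuous_on_gsq[OF S] K gsq_nonneg)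
    then show "0 \<le> d\<^sup>2 * 2 ^ CARD('n) * k * integral K (gsq u)" by (simp add: k_def)
  qed
  moreover have "0 \<le> d\<^sup>2 * 2 ^ CARD('n) * k * integral K (gsq u)"
    by (auto simp: k_def intro!: mult_nonneg_nonneg integral_nonneg integral_restrict_eq(2) continuous_on_gsq[OF S] K gsq_nonneg)
  ultimately have "k * N \<le> (cmod I)\<^sup>2 + k * (d\<^sup>2 * 2 ^ CARD('n) * integral K (gsq u))"
    by (simp add: mult_ac)
  then have "N \<le> (cmod I)\<^sup>2 / k + d\<^sup>2 * 2 ^ CARD('n) * integral K (gsq u)"
    using pos by (simp add: field_simps k_def)
  moreover have "N = integral K (\<lambda>x. (cmod (u x))\<^sup>2)"
    unfolding N_def \<nu>_def by (rule L2_norm_sq_eq_integral[OF K(1) cont])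
  moreover have "I = integral K u"
    unfolding I_def \<nu>_def by (rule integral_restrict_eq(1)[OF K(1) cont])
  ultimately show ?thesis by (simp add: k_def)
qed

text \<open>The cells depend on \<open>\<epsilon>\<close> and the box but not on \<open>u\<close>.
  This uniformity makes the averages a fixed finite family of functionals.\<close>

lemma box_compactness:
  fixes a b :: "real ^ 'n"
  assumes S: "open S" "cbox a b \<subseteq> S" and "0 < \<epsilon>"
  obtains P :: "((real ^ 'n) \<times> (real ^ 'n) set) set" where "finite P"
    "\<And>x K. (x, K) \<in> P \<Longrightarrow> compact K \<and> K \<subseteq> cbox a b \<and> 0 < measure lborel K"
    "\<And>u. Ck_on 1 S u \<Longrightarrow> integral (cbox a b) (\<lambda>x. (cmod (u x))\<^sup>2) \<le>
        (\<Sum>(x, K)\<in>P. (cmod (integral K u))\<^sup>2 / measure lborel K) + \<epsilon> * integral (cbox a b) (gsq u)"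
proof -
  \<comment> \<open>The cell diameter for which the constant of \<open>poincare_convex\<close>
    becomes exactly \<open>\<epsilon>\<close>.\<close>
  define d where "d = sqrt (\<epsilon> / 2 ^ CARD('n))"
  have d: "0 < d" "d\<^sup>2 * 2 ^ CARD('n) = \<epsilon>" using \<open>0 < \<epsilon>\<close> by (auto simp: d_def)
  \<comment> \<open>A constant gauge serves as a mesh: a cell inside a ball of radius
    \<open>d / 2\<close> has diameter at most \<open>d\<close>.\<close>
  obtain p where p: "p tagged_division_of (cbox a b)" "(\<lambda>x. ball x (d / 2)) fine p"
    using fine_division_exists[of "\<lambda>x. ball x (d / 2)" a b] d(1) by (auto simp: gauge_def)
  note pD = tagged_division_ofD[OF p(1)]
  \<comment> \<open>A division may contain degenerate boxes; they have no average, and their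
    integrals vanish.\<close>
  define P where "P = {(x, K) \<in> p. 0 < measure lborel K}"
  have cell: "compact K" "convex K" "K \<subseteq> cbox a b" "\<exists>u v. K = cbox u v"
    if "(x, K) \<in> p" for x K using pD(3,4)[OF that] by auto
  show thesis
  proof
    show "finite P" unfolding P_def by (rule finite_subset[OF _ pD(1)]) auto
    show "compact K \<and> K \<subseteq> cbox a b \<and> 0 < measure lborel K" if "(x, K) \<in> P" for x K
      using cell(1,3)[of x K] that unfolding P_def by blast
    fix u :: "real ^ 'n \<Rightarrow> complex" assume u: "Ck_on 1 S u"
    have uc: "continuous_on (cbox a b) (\<lambda>x. (cmod (u x))\<^sup>2)"
      using continuous_on_subset[OF C1_onD(2)[OF S(1) u] S(2)] by (intro continuous_intros)
    have gc: "continuous_on (cbox a b) (gsq u)" by (rule continuous_on_gsq[OF S(1) u S(2)])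
    have g_le: "0 \<le> integral K (gsq u)" if "(x, K) \<in> p" for x K
      using cell[OF that] gsq_nonneg
      by (intro integral_nonneg integral_restrict_eq(2) continuous_on_subset[OF gc]) auto
    have "integral (cbox a b) (\<lambda>x. (cmod (u x))\<^sup>2) = (\<Sum>(x, K)\<in>p. integral K (\<lambda>x. (cmod (u x))\<^sup>2))"
      by (intro integral_combine_tagged_division_topdown integrable_continuous uc p)
    also have "\<dots> \<le> (\<Sum>(x, K)\<in>p. (if 0 < measure lborel K then (cmod (integral K u))\<^sup>2 / measure lborel K else 0) + \<epsilon> * integral K (gsq u))"
    proof (intro sum_mono, clarify)
      fix x K assume xK: "(x, K) \<in> p"
      show "integral K (\<lambda>x. (cmod (u x))\<^sup>2) \<le>
          (if 0 < measure lborel K then (cmod (integral K u))\<^sup>2 / measure lborel K else 0) + \<epsilon> * integral K (gsq u)"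
      proof (cases "0 < measure lborel K")
        case True
        have "dist y z \<le> d" if "y \<in> K" "z \<in> K" for y z
        proof -
          have "K \<subseteq> ball x (d / 2)" using p(2) xK by (auto simp: fine_def)
          then have "dist x y < d / 2" "dist x z < d / 2" using that by auto
          then show ?thesis using dist_triangle[of y z x] by (simp add: dist_commute)
        qed
        from poincare_convex[OF S(1) u cell(1,2)[OF xK] subset_trans[OF cell(3)[OF xK] S(2)] this True]
        show ?thesis using True by (simp add: d(2))
      next
        case False
        obtain v w where K: "K = cbox v w" using cell(4)[OF xK] by blast
        have "measure lborel (cbox v w) = 0" using False measure_nonneg[of lborel K] unfolding K by linarith
        then have "integral K (\<lambda>x. (cmod (u x))\<^sup>2) = 0" unfolding K by (rule integral_null)
        then show ?thesis using False g_le[OF xK] \<open>0 < \<epsilon>\<close> by simp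
      qed
    qed
    also have "\<dots> = (\<Sum>(x, K)\<in>p. if 0 < measure lborel K then (cmod (integral K u))\<^sup>2 / measure lborel K else 0)
        + \<epsilon> * (\<Sum>(x, K)\<in>p. integral K (gsq u))"
      by (simp add: sum.distrib sum_distrib_left case_prod_unfold)
    also have "(\<Sum>(x, K)\<in>p. integral K (gsq u)) = integral (cbox a b) (gsq u)"
      by (rule integral_combine_tagged_division_topdown[symmetric]) (intro integrable_continuous gc p)+
    also have "(\<Sum>(x, K)\<in>p. if 0 < measure lborel K then (cmod (integral K u))\<^sup>2 / measure lborel K else 0)
        = (\<Sum>(x, K)\<in>P. (cmod (integral K u))\<^sup>2 / measure lborel K)"
      unfolding P_def using pD(1) by (intro sum.mono_neutral_cong_right) (auto split: if_split_asm)
    finally show "integral (cbox a b) (\<lambda>x. (cmod (u x))\<^sup>2) \<le>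
        (\<Sum>(x, K)\<in>P. (cmod (integral K u))\<^sup>2 / measure lborel K) + \<epsilon> * integral (cbox a b) (gsq u)" .
  qed
qed

section \<open>Integration by parts for compactly supported functions\<close>

lemma integral_translate:
  fixes f :: "'e::euclidean_space \<Rightarrow> 'b::{banach, second_countable_topology}"
  assumes [measurable]: "f \<in> borel_measurable borel"
  shows "(\<integral>x. f (c + x) \<partial>lborel) = (\<integral>x. f x \<partial>lborel)"
    and "integrable lborel (\<lambda>x. f (c + x)) \<longleftrightarrow> integrable lborel f"
  by (subst (2) lborel_distr_plus[of c, symmetric], simp add: integral_distr integrable_distr_eq)+

text \<open>Average the directional derivative over the shifts \<open>t *\<^sub>R v\<close> with
  \<open>0 \<le> t \<le> 1\<close>, which does not change its integral. Integrated first in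
  \<open>t\<close> it becomes \<open>h (v + x) - h x\<close>, whose integral is zero by translation
  invariance.\<close>

theorem integral_derivative_eq_0:
  fixes h :: "real ^ 'n \<Rightarrow> complex"
  assumes h: "Ck_on 1 UNIV h" and K: "compact K" "\<And>x. x \<notin> K \<Longrightarrow> h x = 0"
  shows "(\<integral>x. frechet_derivative h (at x) v \<partial>lborel) = 0"
proof -
  define D where "D x = frechet_derivative h (at x) v" for x
  note C = C1_onD[OF open_UNIV h]
  have Dc: "continuous_on UNIV D" using h by (simp add: D_def[abs_def])
  have D0: "D x = 0" if "x \<notin> K" for x
  proof -
    have "frechet_derivative h (at x) = frechet_derivative (\<lambda>_. 0) (at x)"
      by (rule frechet_derivative_cong_open(1)[of "- K"]) (use K that compact_imp_closed in auto)
    then show ?thesis by (simp add: D_def)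
  qed
  have hint: "integrable lborel h"
  proof -
    have "(\<lambda>x. indicator K x *\<^sub>R h x) = h" using K(2) by (auto simp: indicator_def fun_eq_iff)
    then show ?thesis using borel_integrable_compact[OF K(1) continuous_on_subset[OF C(2)]] by simp
  qed
  have [measurable]: "h \<in> borel_measurable borel" "D \<in> borel_measurable borel"
    using C(2) Dc by (auto intro: borel_measurable_continuous_onI)
  \<comment> \<open>The starting points whose segment in direction \<open>v\<close> meets
    \<open>K\<close>. It is compact, and cutting off to it makes the integrand of the double
    integral integrable without changing its values.\<close>
  define K' where "K' = (\<lambda>(z, t). z - t *\<^sub>R v) ` (K \<times> {0..1::real})"
  have K': "compact K'" unfolding K'_def
    by (intro compact_continuous_image compact_Times K compact_Icc)
       (auto intro!: continuous_intros simp: case_prod_unfold)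
  have out: "x + t *\<^sub>R v \<notin> K" if "x \<notin> K'" "t \<in> {0..1}" for x t
    using that unfolding K'_def by (force simp: image_iff)
  define F where "F x t = indicator (K' \<times> {0..1::real}) (x, t) *\<^sub>R D (x + t *\<^sub>R v)" for x t
  have "integrable lborel (\<lambda>z. indicator (K' \<times> {0..1::real}) z *\<^sub>R D (fst z + snd z *\<^sub>R v))"
    by (intro borel_integrable_compact compact_Times K' compact_Icc continuous_on_compose2[OF Dc] continuous_intros) auto
  then have Fint: "integrable (lborel \<Otimes>\<^sub>M lborel) (case_prod F)"
    unfolding lborel_prod by (simp add: F_def case_prod_unfold)
  have 1: "(\<integral>x. F x t \<partial>lborel) = indicator {0..1} t *\<^sub>R (\<integral>x. D x \<partial>lborel)" for t
  proof -
    have "F x t = indicator {0..1} t *\<^sub>R D (t *\<^sub>R v + x)" for x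
      using out[of x t] D0[of "x + t *\<^sub>R v"] by (auto simp: F_def indicator_def add.commute)
    then show ?thesis by (simp add: integral_translate(1))
  qed
  have 2: "(\<integral>t. F x t \<partial>lborel) = h (v + x) - h x" for x
  proof (cases "x \<in> K'")
    case True
    have d: "((\<lambda>t. h (x + t *\<^sub>R v)) has_vector_derivative D (x + t *\<^sub>R v)) (at t within {0..1})" for t :: real
      unfolding has_vector_derivative_def
    proof (rule has_derivative_eq_rhs)
      show "((\<lambda>t. h (x + t *\<^sub>R v)) has_derivative
          (\<lambda>s. frechet_derivative h (at (x + t *\<^sub>R v)) (s *\<^sub>R v))) (at t within {0..1})"
        by (rule has_derivative_compose[where f="\<lambda>t. x + t *\<^sub>R v" and g=h and g'="frechet_derivative h (at (x + t *\<^sub>R v))" and f'="\<lambda>s. s *\<^sub>R v"])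
           (use C(4) in \<open>auto intro!: derivative_eq_intros\<close>)
      show "(\<lambda>s. frechet_derivative h (at (x + t *\<^sub>R v)) (s *\<^sub>R v)) = (\<lambda>s. s *\<^sub>R D (x + t *\<^sub>R v))"
        using C(1) by (simp add: D_def linear_cmul[OF linear_frechet_derivative])
    qed
    have "(\<integral>t. indicator {0..1} t *\<^sub>R D (x + t *\<^sub>R v) \<partial>lborel) = h (x + 1 *\<^sub>R v) - h (x + 0 *\<^sub>R v)"
      by (rule integral_FTC_Icc[OF _ d]) (auto intro!: continuous_on_compose2[OF Dc] continuous_intros)
    moreover have "F x t = indicator {0..1} t *\<^sub>R D (x + t *\<^sub>R v)" for t
      using True by (auto simp: F_def indicator_def)
    ultimately show ?thesis by (simp add: add.commute)
  next
    case False
    then have "F x t = 0" for t by (simp add: F_def)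
    moreover have "h (v + x) = 0" "h x = 0"
      using out[OF False, of 1] out[OF False, of 0] K(2) by (auto simp: add.commute)
    ultimately show ?thesis by simp
  qed
  have "(\<integral>x. D x \<partial>lborel) = (\<integral>t. (\<integral>x. F x t \<partial>lborel) \<partial>lborel)"
    unfolding 1 by simp
  also have "\<dots> = (\<integral>x. (\<integral>t. F x t \<partial>lborel) \<partial>lborel)"
    by (rule lborel_pair.Fubini_integral[OF Fint])
  also have "\<dots> = (\<integral>x. h (v + x) \<partial>lborel) - (\<integral>x. h x \<partial>lborel)"
    unfolding 2 using hint by (intro Bochner_Integration.integral_diff) (simp_all add: integral_translate(2))
  also have "\<dots> = 0" by (simp add: integral_translate(1))
  finally show ?thesis by (simp add: D_def[abs_def])
qed

subsection \<open>Closability of the gradient on balls\<close>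

lemma Ck1_mult:
  fixes f h :: "real ^ 'n \<Rightarrow> complex"
  assumes S: "open S" and f: "Ck_on 1 S f" and h: "Ck_on 1 S h"
  shows "Ck_on 1 S (\<lambda>x. f x * h x)"
    and "x \<in> S \<Longrightarrow> pd (\<lambda>x. f x * h x) i x = f x * pd h i x + pd f i x * h x"
proof -
  have d: "((\<lambda>x. f x * h x) has_derivative
      (\<lambda>v. f x * frechet_derivative h (at x) v + frechet_derivative f (at x) v * h x)) (at x)" if "x \<in> S" for x
    by (intro has_derivative_mult C1_onD(4)[OF S] f h that)
  have eq: "frechet_derivative (\<lambda>x. f x * h x) (at x) v =
      f x * frechet_derivative h (at x) v + frechet_derivative f (at x) v * h x" if "x \<in> S" for x v
    using frechet_derivative_at[OF d[OF that]] by (simp add: fun_eq_iff)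
  have "continuous_on S (\<lambda>x. frechet_derivative (\<lambda>x. f x * h x) (at x) v)" for v
  proof -
    have "continuous_on S (\<lambda>x. f x * frechet_derivative h (at x) v + frechet_derivative f (at x) v * h x)"
      using f h C1_onD(2)[OF S f] C1_onD(2)[OF S h] by (intro continuous_intros) simp_all
    then show ?thesis using eq by (simp cong: continuous_on_cong)
  qed
  moreover have "(\<lambda>x. f x * h x) differentiable at x" if "x \<in> S" for x
    using d[OF that] by (rule differentiableI)
  ultimately show "Ck_on 1 S (\<lambda>x. f x * h x)" by simp
  show "pd (\<lambda>x. f x * h x) i x = f x * pd h i x + pd f i x * h x" if "x \<in> S"
    unfolding pd_def eq[OF that] ..
qed

lemma pd_bounded_linear:
  fixes f :: "real ^ 'n \<Rightarrow> complex"
  assumes L: "bounded_linear L" and f: "f differentiable at x"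
  shows "pd (\<lambda>x. L (f x)) i x = L (pd f i x)"
proof -
  have "((\<lambda>x. L (f x)) has_derivative (\<lambda>v. L (frechet_derivative f (at x) v))) (at x)"
    by (rule bounded_linear.has_derivative[OF L]) (use f in \<open>simp add: frechet_derivative_works[symmetric]\<close>)
  from frechet_derivative_at[OF this] show ?thesis unfolding pd_def by metis
qed

lemma pd_add:
  fixes f h :: "real ^ 'n \<Rightarrow> complex"
  assumes "f differentiable at x" "h differentiable at x"
  shows "pd (\<lambda>x. f x + h x) i x = pd f i x + pd h i x"
proof -
  have "((\<lambda>x. f x + h x) has_derivative
      (\<lambda>v. frechet_derivative f (at x) v + frechet_derivative h (at x) v)) (at x)"
    by (intro has_derivative_add) (use assms in \<open>simp_all add: frechet_derivative_works[symmetric]\<close>)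
  from frechet_derivative_at[OF this] show ?thesis unfolding pd_def by metis
qed

text \<open>A polynomial cut-off supported in the closed ball; squaring the positive part makes it
  \<open>C^1\<close> across the sphere.\<close>

definition bump :: "'e::real_inner \<Rightarrow> real \<Rightarrow> 'e \<Rightarrow> real" where
  "bump x0 r x = (max 0 (r\<^sup>2 - (norm (x - x0))\<^sup>2))\<^sup>2"

lemma max_sq_derivative: "((\<lambda>s. (max 0 s)\<^sup>2) has_real_derivative 2 * max 0 s) (at s)"
proof -
  consider "s > 0" | "s < 0" | "s = 0" by linarith
  then show ?thesis
  proof cases
    case 1
    have "((\<lambda>s. s\<^sup>2) has_real_derivative 2 * max 0 s) (at s)"
      using 1 by (auto intro!: derivative_eq_intros)
    then show ?thesis
      by (rule has_field_derivative_transform_within_open[of _ _ _ "{0<..}"]) (use 1 in auto)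
  next
    case 2
    have "((\<lambda>s. 0) has_real_derivative 2 * max 0 s) (at s)"
      using 2 by (auto intro!: derivative_eq_intros)
    then show ?thesis
      by (rule has_field_derivative_transform_within_open[of _ _ _ "{..<0}"]) (use 2 in auto)
  next
    case 3
    \<comment> \<open>At the kink the difference quotient is bounded by
      \<open>\<bar>h\<bar>\<close>.\<close>
    have "((\<lambda>h. ((max 0 (0 + h))\<^sup>2 - (max 0 0)\<^sup>2) / h) \<longlongrightarrow> 0) (at (0::real))"
    proof (rule Lim_null_comparison[OF always_eventually])
      show "((\<lambda>h. \<bar>h\<bar>) \<longlongrightarrow> 0) (at (0::real))" by (auto intro!: tendsto_eq_intros)
      show "\<forall>h::real. norm (((max 0 (0 + h))\<^sup>2 - (max 0 0)\<^sup>2) / h) \<le> \<bar>h\<bar>"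
        by (auto simp: max_def power2_eq_square)
    qed
    then show ?thesis using 3 by (simp add: DERIV_def)
  qed
qed

lemma bump_C1: "Ck_on 1 UNIV (\<lambda>x :: real ^ 'n. complex_of_real (bump x0 r x))"
proof -
  define D where "D x v = complex_of_real (2 * max 0 (r\<^sup>2 - (norm (x - x0))\<^sup>2) * - (2 * ((x - x0) \<bullet> v)))"
    for x v :: "real ^ 'n"
  have d: "((\<lambda>x. complex_of_real (bump x0 r x)) has_derivative D x) (at x)" for x :: "real ^ 'n"
  proof -
    have 1: "((\<lambda>x. r\<^sup>2 - (norm (x - x0))\<^sup>2) has_derivative (\<lambda>v. - (2 * ((x - x0) \<bullet> v)))) (at x)"
      unfolding power2_norm_eq_inner by (auto intro!: derivative_eq_intros simp: inner_commute)
    have "((\<lambda>x. bump x0 r x) has_derivative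
        (\<lambda>v. - (2 * ((x - x0) \<bullet> v)) * (2 * max 0 (r\<^sup>2 - (norm (x - x0))\<^sup>2)))) (at x)"
      unfolding bump_def
      using has_derivative_compose[OF 1 max_sq_derivative[of "r\<^sup>2 - (norm (x - x0))\<^sup>2", unfolded has_field_derivative_def]]
      by (simp add: mult_ac)
    from bounded_linear.has_derivative[OF bounded_linear_of_real this] show ?thesis
      unfolding D_def by (simp add: mult_ac)
  qed
  have "continuous_on UNIV (\<lambda>x. D x v)" for v unfolding D_def by (intro continuous_intros)
  moreover have "frechet_derivative (\<lambda>x. complex_of_real (bump x0 r x)) (at x) v = D x v" for x v
    using frechet_derivative_at[OF d] by metis
  moreover have "(\<lambda>x. complex_of_real (bump x0 r x)) differentiable at x" for x :: "real ^ 'n"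
    using d by (rule differentiableI)
  ultimately show ?thesis by simp
qed

lemma bump_bounds:
  shows "0 \<le> bump x0 r x" "bump x0 r x \<le> (r\<^sup>2)\<^sup>2" and "0 \<le> r \<Longrightarrow> x \<notin> ball x0 r \<Longrightarrow> bump x0 r x = 0"
    and "0 \<le> r \<Longrightarrow> x \<in> cball x0 (r / 2) \<Longrightarrow> (r\<^sup>2 / 2)\<^sup>2 \<le> bump x0 r x"
proof -
  show "0 \<le> bump x0 r x" by (simp add: bump_def)
  show "bump x0 r x \<le> (r\<^sup>2)\<^sup>2" unfolding bump_def by (intro power_mono) auto
  show "bump x0 r x = 0" if "0 \<le> r" "x \<notin> ball x0 r"
  proof -
    have "r \<le> norm (x - x0)" using that by (simp add: dist_norm norm_minus_commute)
    then have "r\<^sup>2 \<le> (norm (x - x0))\<^sup>2" using that by (intro power_mono) auto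
    then show ?thesis by (simp add: bump_def)
  qed
  show "(r\<^sup>2 / 2)\<^sup>2 \<le> bump x0 r x" if "0 \<le> r" "x \<in> cball x0 (r / 2)"
  proof -
    have "norm (x - x0) \<le> r / 2" using that by (simp add: dist_norm norm_minus_commute)
    then have "(norm (x - x0))\<^sup>2 \<le> (r / 2)\<^sup>2" by (intro power_mono) auto
    also have "(r / 2)\<^sup>2 \<le> r\<^sup>2 / 2" by (simp add: power_divide)
    finally have "(norm (x - x0))\<^sup>2 \<le> r\<^sup>2 / 2" .
    then have "r\<^sup>2 / 2 \<le> max 0 (r\<^sup>2 - (norm (x - x0))\<^sup>2)" by linarith
    then show ?thesis unfolding bump_def by (intro power_mono) auto
  qed
qed

text \<open>With the weight \<open>\<rho>\<close>, the pairing of \<open>\<partial>_i u_n\<close>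
  with a fixed \<open>\<partial>_i u_N\<close> becomes, by parts, a pairing of \<open>u_n\<close>
  with a fixed function and tends to zero; a weakly null Cauchy sequence is null. The
  \<open>C^2\<close> hypothesis lets \<open>\<partial>_i u_N\<close> be differentiated once more,
  and the radius is halved because the cut-off degenerates at the sphere.\<close>

theorem gradient_closable_ball:
  fixes u :: "nat \<Rightarrow> real ^ 'n \<Rightarrow> complex"
  assumes S: "open S" "cball x0 r \<subseteq> S" and r: "0 < r" and u: "\<And>n. Ck_on 2 S (u n)"
    and cauchy: "L2.nCauchy (restrict_space lborel (cball x0 r)) (\<lambda>n. pd (u n) i)"
    and lim: "(\<lambda>n. L2_norm (restrict_space lborel (cball x0 r)) (u n)) \<longlonglongrightarrow> 0"
  shows "(\<lambda>n. L2_norm (restrict_space lborel (cball x0 (r / 2))) (pd (u n) i)) \<longlonglongrightarrow> 0"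
proof -
  define B where "B = restrict_space lborel (cball x0 r)"
  define \<rho> where "\<rho> = (bump x0 r :: real ^ 'n \<Rightarrow> real)"
  \<comment> \<open>Putting the cut-off into the measure keeps the weighted pairing an
    \<open>L2\<close> inner product, so the abstract lemma on weakly null sequences applies to
    it.\<close>
  define \<nu> where "\<nu> = density B (\<lambda>x. ennreal (\<rho> x))"
  define w where "w n = pd (u n) i" for n
  interpret B: finite_measure B unfolding B_def by (rule finite_measure_compact) simp
  have u1: "Ck_on 1 S (u n)" for n using Ck_on_le[OF _ S(1) u, of 1] by simp
  have w1: "Ck_on 1 S (w n)" for n unfolding w_def by (rule C2_onD[OF u])
  have \<rho>C: "Ck_on 1 UNIV (\<lambda>x. complex_of_real (\<rho> x))" unfolding \<rho>_def by (rule bump_C1)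
  have \<rho>c: "continuous_on UNIV \<rho>" unfolding \<rho>_def bump_def by (intro continuous_intros)
  have \<rho>m: "\<rho> \<in> borel_measurable B" unfolding B_def
    by (rule borel_measurable_compact) (rule continuous_on_subset[OF \<rho>c], simp)
  note [measurable] = \<rho>m
  have \<rho>0: "0 \<le> \<rho> x" for x unfolding \<rho>_def by (rule bump_bounds)
  have cB: "f \<in> L2 B" if "continuous_on S f" for f :: "real ^ 'n \<Rightarrow> complex"
    unfolding B_def by (intro continuous_L2 continuous_on_subset[OF that S(2)]) simp
  have \<nu>_int: "(LINT x|\<nu>. f x) = (LINT x|B. \<rho> x *\<^sub>R f x)" if [measurable]: "f \<in> borel_measurable B"
    for f :: "real ^ 'n \<Rightarrow> 'b::{banach, second_countable_topology}"
    unfolding \<nu>_def by (subst integral_density) (auto simp: \<rho>0)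
  have \<nu>L: "f \<in> L2 \<nu>" and \<nu>le: "L2_norm \<nu> f \<le> r\<^sup>2 * L2_norm B f" if f: "f \<in> L2 B" for f
  proof -
    have fm[measurable]: "f \<in> borel_measurable B" using f by (simp add: L2_def)
    have int: "integrable B (\<lambda>x. (cmod (f x))\<^sup>2)" using f by (simp add: L2_def)
    have bd: "\<rho> x * (cmod (f x))\<^sup>2 \<le> (r\<^sup>2)\<^sup>2 * (cmod (f x))\<^sup>2" for x
      unfolding \<rho>_def by (intro mult_right_mono bump_bounds) simp
    have int2: "integrable B (\<lambda>x. \<rho> x * (cmod (f x))\<^sup>2)"
    proof (rule Bochner_Integration.integrable_bound)
      show "integrable B (\<lambda>x. (r\<^sup>2)\<^sup>2 * (cmod (f x))\<^sup>2)" using int by simp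
      show "AE x in B. norm (\<rho> x * (cmod (f x))\<^sup>2) \<le> norm ((r\<^sup>2)\<^sup>2 * (cmod (f x))\<^sup>2)"
        using bd by (intro AE_I2) (simp add: abs_mult \<rho>0)
    qed measurable
    show L: "f \<in> L2 \<nu>"
      unfolding L2_def \<nu>_def using int2 by (simp add: integrable_density \<rho>0)
    have "(L2_norm \<nu> f)\<^sup>2 = (LINT x|B. \<rho> x * (cmod (f x))\<^sup>2)"
      using L2.nrm_sq[OF L] \<nu>_int[of "\<lambda>x. (cmod (f x))\<^sup>2"] by (simp add: L2_nrm L2_inner_self)
    also have "\<dots> \<le> (LINT x|B. (r\<^sup>2)\<^sup>2 * (cmod (f x))\<^sup>2)"
      using int by (intro integral_mono int2 bd) simp
    also have "\<dots> = (r\<^sup>2 * L2_norm B f)\<^sup>2"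
      using L2.nrm_sq[OF f] by (simp add: L2_nrm L2_inner_self power_mult_distrib)
    finally show "L2_norm \<nu> f \<le> r\<^sup>2 * L2_norm B f"
      by (rule power2_le_imp_le) (use L2.nrm_nonneg[OF f] in \<open>simp add: L2_nrm\<close>)
  qed
  have wB: "w n \<in> L2 B" for n by (intro cB C1_onD(2)[OF S(1) w1])
  have uB: "u n \<in> L2 B" for n by (intro cB C1_onD(2)[OF S(1) u1])
  have \<nu>C: "L2.nCauchy \<nu> w"
    unfolding L2.nCauchy_def
  proof (intro allI impI)
    fix e :: real assume e: "0 < e"
    then have "0 < e / r\<^sup>2" using r by simp
    then obtain N where N: "\<forall>m\<ge>N. \<forall>n\<ge>N. L2.nrm B (\<lambda>p. w m p - w n p) < e / r\<^sup>2"
      using cauchy unfolding L2.nCauchy_def B_def[symmetric] w_def[symmetric] by blast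
    have "L2.nrm \<nu> (\<lambda>p. w m p - w n p) < e" if "m \<ge> N" "n \<ge> N" for m n
    proof -
      have "L2_norm \<nu> (\<lambda>p. w m p - w n p) \<le> r\<^sup>2 * L2_norm B (\<lambda>p. w m p - w n p)"
        by (intro \<nu>le L2.diff_closed wB)
      also have "\<dots> < r\<^sup>2 * (e / r\<^sup>2)"
        using N that r by (intro mult_strict_left_mono) (auto simp: L2_nrm)
      finally show ?thesis using r by (simp add: L2_nrm)
    qed
    then show "\<exists>N. \<forall>m\<ge>N. \<forall>n\<ge>N. L2.nrm \<nu> (\<lambda>p. w m p - w n p) < e" by blast
  qed
  have weak: "(\<lambda>n. L2_inner \<nu> (w n) (w N)) \<longlonglongrightarrow> 0" for N
  proof -
    define z where "z x = cnj (w N x)" for x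
    have zC: "Ck_on 1 S z" unfolding z_def by (rule Ck_on_bounded_linear[OF bounded_linear_cnj S(1) w1])
    \<comment> \<open>The partial derivative of \<open>\<rho>\<close> times the conjugate of
      \<open>w N\<close>; it is independent of \<open>n\<close>.\<close>
    define k where "k x = pd (\<lambda>x. complex_of_real (\<rho> x)) i x * z x + \<rho> x * pd z i x" for x
    have kc: "continuous_on S k"
      unfolding k_def using continuous_on_subset[OF C1_onD(3)[OF open_UNIV \<rho>C]] continuous_on_subset[OF \<rho>c]
      by (intro continuous_intros C1_onD(2,3)[OF S(1) zC]) auto
    have kB: "(\<lambda>x. cnj (k x)) \<in> L2 B" using kc by (intro cB continuous_intros)
    have "L2_inner \<nu> (w n) (w N) = - L2_inner B (u n) (\<lambda>x. cnj (k x))" for n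
    proof -
      \<comment> \<open>The product to integrate by parts. Since \<open>\<rho>\<close> vanishes off
        the ball, the extension by zero beyond \<open>S\<close> is \<open>C^1\<close> on the whole
        space and no boundary term occurs.\<close>
      define h where "h x = (if x \<in> S then of_real (\<rho> x) * (u n x * z x) else 0)" for x
      have uz: "Ck_on 1 S (\<lambda>x. u n x * z x)" by (rule Ck1_mult(1)[OF S(1) u1 zC])
      have \<rho>S: "Ck_on 1 S (\<lambda>x. complex_of_real (\<rho> x))" by (rule Ck_on_subset[OF \<rho>C]) simp
      have h0: "h x = 0" if "x \<notin> cball x0 r" for x
        using bump_bounds(3)[of r x x0] that r by (simp add: h_def \<rho>_def)
      have hS: "Ck_on 1 S h"
        by (rule Ck_on_cong[OF S(1) _ Ck1_mult(1)[OF S(1) \<rho>S uz]]) (simp add: h_def)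
      have h1: "Ck_on 1 UNIV h"
      proof (rule Ck_on_local)
        fix x :: "real ^ 'n"
        show "\<exists>T. open T \<and> x \<in> T \<and> Ck_on 1 T h"
        proof (cases "x \<in> S")
          case True then show ?thesis using S(1) hS by blast
        next
          case False
          have "Ck_on 1 (- cball x0 r) h"
            by (rule Ck_on_cong[OF _ _ Ck_on_const[of _ _ 0]]) (use h0 in auto)
          then show ?thesis using False S(2) by (intro exI[of _ "- cball x0 r"]) auto
        qed
      qed
      have pdS: "pd h i x = \<rho> x * (w n x * z x) + u n x * k x" if "x \<in> S" for x
      proof -
        have "pd h i x = pd (\<lambda>x. of_real (\<rho> x) * (u n x * z x)) i x"
          unfolding pd_def using that
          by (subst frechet_derivative_cong_open(1)[OF S(1) that, of h "\<lambda>x. of_real (\<rho> x) * (u n x * z x)"])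
             (auto simp: h_def)
        also have "\<dots> = \<rho> x * (u n x * pd z i x + w n x * z x) + pd (\<lambda>x. complex_of_real (\<rho> x)) i x * (u n x * z x)"
          using Ck1_mult(2)[OF S(1) \<rho>S uz that] Ck1_mult(2)[OF S(1) u1 zC that] by (simp add: w_def)
        finally show ?thesis by (simp add: k_def algebra_simps)
      qed
      have pd0: "pd h i x = 0" if "x \<notin> cball x0 r" for x
      proof -
        have "frechet_derivative h (at x) = frechet_derivative (\<lambda>_. 0) (at x)"
          by (rule frechet_derivative_cong_open(1)[of "- cball x0 r"]) (use h0 that in auto)
        then show ?thesis by (simp add: pd_def)
      qed
      have "0 = (\<integral>x. pd h i x \<partial>lborel)"
        unfolding pd_def using integral_derivative_eq_0[OF h1 compact_cball h0] by simp
      also have "\<dots> = (LINT x|B. pd h i x)"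
        unfolding B_def by (subst integral_restrict_space, simp, rule Bochner_Integration.integral_cong)
          (use pd0 in \<open>auto simp: indicator_def\<close>)
      also have "\<dots> = (LINT x|B. \<rho> x *\<^sub>R (w n x * cnj (w N x)) + u n x * cnj (cnj (k x)))"
        using S(2) by (intro Bochner_Integration.integral_cong refl)
          (auto simp: B_def space_restrict_space pdS z_def scaleR_conv_of_real)
      also have "\<dots> = (LINT x|B. \<rho> x *\<^sub>R (w n x * cnj (w N x))) + (LINT x|B. u n x * cnj (cnj (k x)))"
      proof (rule Bochner_Integration.integral_add)
        have "continuous_on (cball x0 r) (\<lambda>x. \<rho> x *\<^sub>R (w n x * cnj (w N x)))"
          using continuous_on_subset[OF \<rho>c] continuous_on_subset[OF C1_onD(2)[OF S(1) w1] S(2)]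
          by (intro continuous_intros) auto
        from borel_integrable_compact[OF compact_cball this]
        show "integrable B (\<lambda>x. \<rho> x *\<^sub>R (w n x * cnj (w N x)))"
          unfolding B_def by (subst integrable_restrict_space) auto
        show "integrable B (\<lambda>x. u n x * cnj (cnj (k x)))" by (rule L2_mult_integrable[OF uB kB])
      qed
      also have "(LINT x|B. \<rho> x *\<^sub>R (w n x * cnj (w N x))) = L2_inner \<nu> (w n) (w N)"
        unfolding L2_inner_def
        by (rule \<nu>_int[symmetric]) (rule borel_measurable_integrable[OF L2_mult_integrable[OF wB wB]])
      finally show ?thesis by (simp add: L2_inner_def eq_neg_iff_add_eq_0)
    qed
    then have "norm (L2_inner \<nu> (w n) (w N)) \<le> L2_norm B (u n) * L2_norm B (\<lambda>x. cnj (k x))" for n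
      using L2.cauchy_schwarz[OF uB[of n] kB] by (simp add: L2_nrm)
    then show ?thesis
      by (intro Lim_null_comparison[OF always_eventually tendsto_mult_left_zero[OF lim[folded B_def]]]) auto
  qed
  have z: "(\<lambda>n. L2_norm \<nu> (w n)) \<longlonglongrightarrow> 0"
    using L2.nrm_tendsto_zero_of_weak[OF \<nu>L[OF wB] \<nu>C weak] by (simp add: L2_nrm)
  \<comment> \<open>On the half ball the weight is at least \<open>c^2\<close>, so the unweighted
    norm there is at most the weighted norm divided by \<open>c\<close>.\<close>
  define c where "c = r\<^sup>2 / 2"
  have c: "0 < c" using r by (simp add: c_def)
  have "L2_norm (restrict_space lborel (cball x0 (r / 2))) (w n) \<le> L2_norm \<nu> (w n) / c" for n
  proof -
    have wc: "continuous_on (cball x0 r) (w n)" by (rule continuous_on_subset[OF C1_onD(2)[OF S(1) w1] S(2)])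
    have sub: "cball x0 (r / 2) \<subseteq> cball x0 r" using r by auto
    have c1: "continuous_on (cball x0 r) (\<lambda>x. \<rho> x * (cmod (w n x))\<^sup>2)"
      using continuous_on_subset[OF \<rho>c] wc by (intro continuous_intros) auto
    have c2: "continuous_on (cball x0 (r/2)) (\<lambda>x. (cmod (w n x))\<^sup>2)"
      using continuous_on_subset[OF wc sub] by (intro continuous_intros)
    have "(c * L2_norm (restrict_space lborel (cball x0 (r / 2))) (w n))\<^sup>2
        = integral (cball x0 (r/2)) (\<lambda>x. c\<^sup>2 * (cmod (w n x))\<^sup>2)"
      using L2_norm_sq_eq_integral[OF compact_cball continuous_on_subset[OF wc sub]] by (simp add: power_mult_distrib)
    also have "\<dots> \<le> integral (cball x0 (r/2)) (\<lambda>x. \<rho> x * (cmod (w n x))\<^sup>2)"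
    proof (rule integral_le)
      show "(\<lambda>x. c\<^sup>2 * (cmod (w n x))\<^sup>2) integrable_on cball x0 (r/2)"
        by (intro integral_restrict_eq(2) continuous_intros c2) simp
      show "(\<lambda>x. \<rho> x * (cmod (w n x))\<^sup>2) integrable_on cball x0 (r/2)"
        by (intro integral_restrict_eq(2) continuous_on_subset[OF c1 sub]) simp
      show "c\<^sup>2 * (cmod (w n x))\<^sup>2 \<le> \<rho> x * (cmod (w n x))\<^sup>2" if "x \<in> cball x0 (r/2)" for x
        using bump_bounds(4)[of r x x0] r that unfolding \<rho>_def c_def by (intro mult_right_mono) auto
    qed
    also have "\<dots> \<le> integral (cball x0 r) (\<lambda>x. \<rho> x * (cmod (w n x))\<^sup>2)"
      by (intro integral_subset_le sub integral_restrict_eq(2) continuous_on_subset[OF c1 sub] c1 compact_cball)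
         (simp add: \<rho>0)
    also have "\<dots> = (LINT x|B. \<rho> x * (cmod (w n x))\<^sup>2)"
      unfolding B_def by (rule integral_restrict_eq(1)[symmetric, OF compact_cball c1])
    also have "\<dots> = (L2_norm \<nu> (w n))\<^sup>2"
    proof -
      have [measurable]: "w n \<in> borel_measurable B" using wB by (simp add: L2_def)
      show ?thesis
        using L2.nrm_sq[OF \<nu>L[OF wB]] \<nu>_int[of "\<lambda>x. (cmod (w n x))\<^sup>2"] by (simp add: L2_nrm L2_inner_self)
    qed
    finally have "c * L2_norm (restrict_space lborel (cball x0 (r / 2))) (w n) \<le> L2_norm \<nu> (w n)"
      by (rule power2_le_imp_le) (use L2.nrm_nonneg[OF \<nu>L[OF wB]] in \<open>simp add: L2_nrm\<close>)
    then show ?thesis using c by (simp add: field_simps)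
  qed
  moreover have "0 \<le> L2_norm (restrict_space lborel (cball x0 (r / 2))) (w n)" for n
    by (simp add: L2_norm_def L2_inner_self)
  moreover have "(\<lambda>n. L2_norm \<nu> (w n) / c) \<longlonglongrightarrow> 0" using tendsto_divide[OF z tendsto_const[of c]] c by simp
  ultimately show ?thesis unfolding w_def[symmetric]
    using Lim_null_comparison[OF always_eventually, of "\<lambda>n. L2_norm (restrict_space lborel (cball x0 (r / 2))) (w n)"
        "\<lambda>n. L2_norm \<nu> (w n) / c" sequentially] by simp
qed

subsection \<open>Symmetric positive definite matrices and \<open>C\<^sup>1\<close> domains\<close>

text \<open>A right inverse of a square matrix is two-sided, hence equals whatever inverse
  \<open>matrix_inv\<close> chooses.\<close>

lemma matrix_inv_eq:
  fixes A :: "real ^ 'n ^ 'n"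
  assumes "A ** B = mat 1"
  shows "matrix_inv A = B"
proof -
  have BA: "B ** A = mat 1" using assms matrix_left_right_inverse by blast
  have inv: "A ** matrix_inv A = mat 1 \<and> matrix_inv A ** A = mat 1"
    unfolding matrix_inv_def by (rule someI[of _ B]) (use assms BA in simp)
  have "matrix_inv A = (B ** A) ** matrix_inv A" by (simp add: BA)
  also have "\<dots> = B ** (A ** matrix_inv A)" by (rule matrix_mul_assoc[symmetric])
  also have "\<dots> = B" using inv by simp
  finally show ?thesis .
qed

definition spd :: "real ^ 'n ^ 'n \<Rightarrow> bool" where
  "spd G \<longleftrightarrow> transpose G = G \<and> (\<forall>v. v \<noteq> 0 \<longrightarrow> 0 < v \<bullet> (G *v v))"

lemma spd_nonneg: "spd G \<Longrightarrow> 0 \<le> v \<bullet> (G *v v)"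
  by (cases "v = 0") (auto simp: spd_def less_imp_le)

lemma spd_invertible: "spd G \<Longrightarrow> invertible G"
  unfolding invertible_left_inverse matrix_left_invertible_ker spd_def by force

lemma spd_inv: 
  assumes "spd G"
  shows "G ** matrix_inv G = mat 1" "matrix_inv G ** G = mat 1"
proof -
  obtain B where "G ** B = mat 1" "B ** G = mat 1" using spd_invertible[OF assms] by (auto simp: invertible_def)
  then show "G ** matrix_inv G = mat 1" "matrix_inv G ** G = mat 1" using matrix_inv_eq by metis+
qed

lemma spd_inv_sym:
  assumes "spd G"
  shows "transpose (matrix_inv G) = matrix_inv G"
proof -
  have "G ** transpose (matrix_inv G) = transpose (matrix_inv G ** G)"
    using assms by (simp add: matrix_transpose_mul spd_def)
  also have "\<dots> = mat 1" by (simp add: spd_inv[OF assms] transpose_mat)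
  finally show ?thesis using matrix_inv_eq by metis
qed

lemma continuous_on_det:
  fixes A :: "'x::topological_space \<Rightarrow> real ^ 'n ^ 'n"
  assumes "\<And>i j. continuous_on S (\<lambda>x. A x $ i $ j)"
  shows "continuous_on S (\<lambda>x. det (A x))"
  unfolding det_def by (intro continuous_intros assms)

text \<open>Along the straight path from the identity to \<open>G\<close> all matrices stay positive
  definite, hence invertible; by the intermediate value theorem the determinant keeps the sign it
  has at the identity.\<close>

lemma spd_det_pos:
  assumes "spd G"
  shows "0 < det G"
proof (rule ccontr)
  assume neg: "\<not> 0 < det G"
  define P where "P t = (1 - t) *\<^sub>R mat 1 + t *\<^sub>R G" for t :: real
  have c: "continuous_on {0..1} (\<lambda>t. det (P t))"
    unfolding P_def by (intro continuous_on_det) (auto intro!: continuous_intros)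
  have "spd (P t)" if "t \<in> {0..1}" for t
    unfolding spd_def
  proof (intro conjI allI impI)
    show "transpose (P t) = P t"
      using assms by (simp add: P_def spd_def transpose_def vec_eq_iff mat_def) 
    fix v :: "real ^ 'a" assume v: "v \<noteq> 0"
    have "v \<bullet> (P t *v v) = (1 - t) * (v \<bullet> v) + t * (v \<bullet> (G *v v))"
      by (simp add: P_def matrix_vector_mult_add_rdistrib scaleR_matrix_vector_assoc[symmetric] inner_add_right)
    moreover have "0 < v \<bullet> v" "0 < v \<bullet> (G *v v)" using v assms by (auto simp: spd_def)
    ultimately show "0 < v \<bullet> (P t *v v)"
      using that by (cases "t = 0") (auto intro: add_nonneg_pos)
  qed
  then have nz: "det (P t) \<noteq> 0" if "t \<in> {0..1}" for t
    using spd_invertible invertible_det_nz that by blast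
  have "det (P 1) \<le> 0" "0 \<le> det (P 0)" using neg by (simp_all add: P_def)
  then obtain t where "0 \<le> t" "t \<le> 1" "det (P t) = 0"
    using IVT2'[of "\<lambda>t. det (P t)" 1 0 0] c by auto
  then show False using nz by auto
qed

text \<open>Cramer's rule writes the entries of the inverse as quotients of determinants, from which
  their continuity in a parameter can be read off.\<close>

lemma matrix_inv_entry:
  fixes A :: "real ^ 'n ^ 'n"
  assumes "invertible A"
  shows "matrix_inv A $ k $ l = det (\<chi> i j. if j = k then axis l 1 $ i else A $ i $ j) / det A"
proof -
  obtain B where B: "A ** B = mat 1" using assms by (auto simp: invertible_def)
  have "A *v (\<chi> k. B $ k $ l) = axis l 1"
    using B by (simp add: vec_eq_iff matrix_vector_mult_def matrix_matrix_mult_def mat_def axis_def)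
  then have "(\<chi> k. B $ k $ l) = (\<chi> k. det (\<chi> i j. if j = k then axis l 1 $ i else A $ i $ j) / det A)"
    using assms cramer[of A] by (simp add: invertible_det_nz)
  then show ?thesis unfolding matrix_inv_eq[OF B] by (simp add: vec_eq_iff)
qed

lemma continuous_on_matrix_inv:
  fixes A :: "'x::topological_space \<Rightarrow> real ^ 'n ^ 'n"
  assumes A: "\<And>i j. continuous_on S (\<lambda>x. A x $ i $ j)" and inv: "\<And>x. x \<in> S \<Longrightarrow> invertible (A x)"
  shows "continuous_on S (\<lambda>x. matrix_inv (A x) $ k $ l)"
proof -
  have "continuous_on S (\<lambda>x. det (\<chi> i j. if j = k then axis l 1 $ i else A x $ i $ j) / det (A x))"
  proof (intro continuous_on_divide continuous_on_det)
    show "continuous_on S (\<lambda>x. (\<chi> i j. if j = k then axis l 1 $ i else A x $ i $ j) $ i $ j)" for i j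
      by (cases "j = k") (use A in simp_all)
  qed (use A inv in \<open>auto simp: invertible_det_nz\<close>)
  then show ?thesis using inv by (simp add: matrix_inv_entry cong: continuous_on_cong)
qed

text \<open>Ellipticity of the inverse without eigenvalues: with \<open>y = G^(-1) v\<close> the
  form of \<open>G\<close> is nonnegative at \<open>y - v / B\<close>, and expanding it bounds
  \<open>y \<bullet> v\<close> below by \<open>(v \<bullet> v) / B\<close>.\<close>

lemma spd_inv_lower:
  fixes G :: "real ^ 'n ^ 'n"
  assumes G: "spd G" and b: "\<And>i j. \<bar>G $ i $ j\<bar> \<le> b" "0 < b"
  shows "v \<bullet> v \<le> real (CARD('n)) * real (CARD('n)) * b * (v \<bullet> (matrix_inv G *v v))"
proof -
  \<comment> \<open>Dominates the operator norm of a matrix whose entries are bounded by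
    \<open>b\<close>.\<close>
  define B where "B = real (CARD('n)) * real (CARD('n)) * b"
  have B: "0 < B" using b by (simp add: B_def)
  define y where "y = matrix_inv G *v v"
  have Gy: "G *v y = v" unfolding y_def by (simp add: matrix_vector_mul_assoc spd_inv[OF G])
  have "v \<bullet> (G *v v) \<le> norm v * norm (G *v v)" by (rule norm_cauchy_schwarz)
  also have "\<dots> \<le> norm v * (onorm ((*v) G) * norm v)"
    by (intro mult_left_mono onorm) auto
  also have "\<dots> \<le> norm v * (B * norm v)"
    unfolding B_def by (intro mult_left_mono mult_right_mono onorm_le_matrix_component b) auto
  finally have 1: "v \<bullet> (G *v v) \<le> B * (v \<bullet> v)"
    by (simp add: power2_norm_eq_inner[symmetric] power2_eq_square mult_ac)
  have sym: "y \<bullet> (G *v v) = v \<bullet> v"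
    using G by (metis Gy dot_lmul_matrix inner_commute spd_def transpose_matrix_vector)
  have "0 \<le> (y - (1 / B) *\<^sub>R v) \<bullet> (G *v (y - (1 / B) *\<^sub>R v))" by (rule spd_nonneg[OF G])
  also have "\<dots> = y \<bullet> v - (1 / B) * (y \<bullet> (G *v v)) - (1 / B) * (v \<bullet> v) + (1 / B) * ((1 / B) * (v \<bullet> (G *v v)))"
    by (simp add: matrix_vector_mult_diff_distrib matrix_vector_mult_scaleR Gy inner_diff_left inner_diff_right diff_divide_distrib)
  also have "\<dots> \<le> y \<bullet> v - (1 / B) * (v \<bullet> v) - (1 / B) * (v \<bullet> v) + (1 / B) * ((1 / B) * (B * (v \<bullet> v)))"
    unfolding sym using 1 B by (intro add_left_mono mult_left_mono) auto
  also have "\<dots> = y \<bullet> v - (1 / B) * (v \<bullet> v)" using B by simp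
  finally have "v \<bullet> v \<le> B * (y \<bullet> v)" using B by (simp add: field_simps)
  then show ?thesis by (simp add: B_def y_def inner_commute)
qed

lemma Re_quadratic_form:
  fixes H :: "real ^ 'n ^ 'n" and z :: "'n \<Rightarrow> complex"
  shows "Re (\<Sum>i\<in>UNIV. \<Sum>j\<in>UNIV. of_real (H $ i $ j) * z i * cnj (z j)) =
    (\<chi> i. Re (z i)) \<bullet> (H *v (\<chi> i. Re (z i))) + (\<chi> i. Im (z i)) \<bullet> (H *v (\<chi> i. Im (z i)))"
proof -
  have "Re (\<Sum>i\<in>UNIV. \<Sum>j\<in>UNIV. of_real (H $ i $ j) * z i * cnj (z j)) =
      (\<Sum>i\<in>UNIV. \<Sum>j\<in>UNIV. Re (z i) * (H $ i $ j * Re (z j)) + Im (z i) * (H $ i $ j * Im (z j)))"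
    unfolding Re_sum by (intro sum.cong refl) (simp add: algebra_simps)
  then show ?thesis
    by (simp only: inner_vec_def matrix_vector_mult_def vec_lambda_beta inner_real_def sum_distrib_left sum.distrib)
qed

lemma spd_quadratic_lower:
  fixes G :: "real ^ 'n ^ 'n" and z :: "'n \<Rightarrow> complex"
  assumes G: "spd G" and b: "\<And>i j. \<bar>G $ i $ j\<bar> \<le> b" "0 < b"
  shows "(\<Sum>i\<in>UNIV. (cmod (z i))\<^sup>2) \<le> real (CARD('n)) * real (CARD('n)) * b *
    Re (\<Sum>i\<in>UNIV. \<Sum>j\<in>UNIV. of_real (matrix_inv G $ i $ j) * z i * cnj (z j))"
proof -
  have "(\<Sum>i\<in>UNIV. (cmod (z i))\<^sup>2) = (\<chi> i. Re (z i)) \<bullet> (\<chi> i. Re (z i)) + (\<chi> i. Im (z i)) \<bullet> (\<chi> i. Im (z i))"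
    by (simp add: inner_vec_def cmod_power2 sum.distrib flip: power2_eq_square)
  also have "\<dots> \<le> real (CARD('n)) * real (CARD('n)) * b *
    Re (\<Sum>i\<in>UNIV. \<Sum>j\<in>UNIV. of_real (matrix_inv G $ i $ j) * z i * cnj (z j))"
    unfolding Re_quadratic_form distrib_left by (intro add_mono spd_inv_lower G b)
  finally show ?thesis .
qed

lemma quadratic_form_upper:
  fixes H :: "real ^ 'n ^ 'n" and z :: "'n \<Rightarrow> complex"
  assumes b: "\<And>i j. \<bar>H $ i $ j\<bar> \<le> b"
  shows "Re (\<Sum>i\<in>UNIV. \<Sum>j\<in>UNIV. of_real (H $ i $ j) * z i * cnj (z j)) \<le>
    b * real (CARD('n)) * (\<Sum>i\<in>UNIV. (cmod (z i))\<^sup>2)"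
proof -
  have "0 \<le> b" using b[of undefined undefined] by linarith
  have "Re (\<Sum>i\<in>UNIV. \<Sum>j\<in>UNIV. of_real (H $ i $ j) * z i * cnj (z j)) \<le>
      cmod (\<Sum>i\<in>UNIV. \<Sum>j\<in>UNIV. of_real (H $ i $ j) * z i * cnj (z j))" by (rule complex_Re_le_cmod)
  also have "\<dots> \<le> (\<Sum>i\<in>UNIV. \<Sum>j\<in>UNIV. b * (cmod (z i) * cmod (z j)))"
    by (intro sum_norm_le) (auto simp: norm_mult mult.assoc intro!: mult_right_mono b)
  also have "\<dots> = b * (\<Sum>i\<in>UNIV. cmod (z i))\<^sup>2"
    by (simp only: power2_eq_square sum_product) (simp only: sum_distrib_left)
  also have "(\<Sum>i\<in>UNIV. cmod (z i))\<^sup>2 \<le> real (CARD('n)) * (\<Sum>i\<in>UNIV. (cmod (z i))\<^sup>2)"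
    using sum_squared_le_sum_of_squares[of "\<lambda>i. cmod (z i)" UNIV] by (simp add: mult.commute)
  finally show ?thesis using \<open>0 \<le> b\<close> by (simp add: mult_left_mono mult.assoc)
qed

section \<open>Local structure of \<open>C^1\<close> domains\<close>

text \<open>In each ball of the definition the complement of \<open>S\<close> is an open strict
  subgraph, so \<open>S\<close> is relatively closed in the union of the balls. On such a
  neighbourhood functions can be extended by zero.\<close>

lemma C1_domain_locally_closed:
  assumes "C1_domain S"
  obtains U where "open U" "S \<subseteq> U" "open (U - S)"
proof -
  define \<B> where "\<B> = {ball x r | x r. 0 < r \<and> open (ball x r - S)}"
  have "\<exists>B\<in>\<B>. x \<in> B" if x: "x \<in> S" for x
  proof -
    obtain r e \<gamma> where *: "0 < r" "Ck_on 1 UNIV \<gamma>"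
        "S \<inter> ball x r = {y \<in> ball x r. \<gamma> (y - (y \<bullet> e) *\<^sub>R e) \<le> y \<bullet> e}"
      using assms x unfolding C1_domain_def by blast
    have c: "continuous_on UNIV \<gamma>" using Ck_on_Suc_imp[of UNIV 0 \<gamma>] *(2) by simp
    have "ball x r - S = ball x r \<inter> {y. y \<bullet> e < \<gamma> (y - (y \<bullet> e) *\<^sub>R e)}"
      using *(3) by (auto simp: set_eq_iff not_le[symmetric])
    also have "open \<dots>"
      by (intro open_Int open_ball open_Collect_less continuous_intros continuous_on_compose2[OF c]) auto
    finally show ?thesis using *(1) unfolding \<B>_def by (intro bexI[of _ "ball x r"]) auto
  qed
  then have "S \<subseteq> \<Union>\<B>" by blast
  moreover have "open (\<Union>\<B>)" unfolding \<B>_def by (intro open_Union) auto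
  moreover have "open (\<Union>\<B> - S)"
  proof -
    have "\<Union>\<B> - S = (\<Union>B\<in>\<B>. B - S)" by blast
    also have "open \<dots>" unfolding \<B>_def by (intro open_UN) auto
    finally show ?thesis .
  qed
  ultimately show thesis using that by blast
qed

lemma derivative_vanishes_along_ray:
  fixes f :: "'e::euclidean_space \<Rightarrow> 'b::real_normed_vector"
  assumes L: "((\<lambda>_. 0) has_derivative (L :: 'e \<Rightarrow> 'b)) (at x within S)" and d: "0 < d"
    and ray: "\<And>t. 0 \<le> t \<Longrightarrow> t < d \<Longrightarrow> x + t *\<^sub>R v \<in> S"
  shows "L v = 0"
proof -
  let ?T = "{0..d / 2}"
  have "((\<lambda>t. x + t *\<^sub>R v) has_derivative (\<lambda>s. s *\<^sub>R v)) (at 0 within ?T)"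
    by (auto intro!: derivative_eq_intros)
  moreover have "((\<lambda>_. 0) has_derivative L) (at (x + 0 *\<^sub>R v) within (\<lambda>t. x + t *\<^sub>R v) ` ?T)"
    using L ray d by (auto intro!: has_derivative_subset[OF L])
  ultimately have "((\<lambda>t. 0) has_derivative (\<lambda>s. L (s *\<^sub>R v))) (at 0 within ?T)"
    by (rule has_derivative_in_compose)
  moreover have "(\<lambda>s. L (s *\<^sub>R v)) = (\<lambda>s. s *\<^sub>R L v)"
    using has_derivative_linear[OF L] by (simp add: linear_cmul)
  ultimately have 1: "((\<lambda>t::real. 0) has_vector_derivative L v) (at 0 within ?T)"
    by (simp add: has_vector_derivative_def)
  have 2: "((\<lambda>t::real. 0) has_vector_derivative (0::'b)) (at 0 within ?T)" by (auto intro!: derivative_eq_intros)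
  have "at 0 within ?T \<noteq> bot"
    using d by (simp add: at_within_Icc_at_right trivial_limit_at_right_real)
  from vector_derivative_unique_within[OF this 1 2] show ?thesis .
qed

text \<open>At a boundary point only directions pointing into the domain can be tested, but these
  fill an open half-space and therefore determine a linear map. The lemma gives meaning to
  \<open>partial_in\<close>, whose derivative is taken within the chart image.\<close>

lemma C1_domain_derivative_unique:
  fixes f :: "'e::euclidean_space \<Rightarrow> 'b::real_normed_vector"
  assumes S: "C1_domain S" "x \<in> S"
    and D: "(f has_derivative D) (at x within S)" "(f has_derivative D') (at x within S)"
  shows "D = D'"
proof -
  define L where "L v = D v - D' v" for v
  have L: "((\<lambda>_. 0) has_derivative L) (at x within S)"
    using has_derivative_diff[OF D] by (simp add: L_def[abs_def])
  have lin: "linear L" by (rule has_derivative_linear[OF L])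
  obtain r e \<gamma> where r: "0 < r" and e: "norm e = 1" and \<gamma>: "Ck_on 1 UNIV \<gamma>"
    and eq: "S \<inter> ball x r = {y \<in> ball x r. \<gamma> (y - (y \<bullet> e) *\<^sub>R e) \<le> y \<bullet> e}"
    using S unfolding C1_domain_def by blast
  have ee: "e \<bullet> e = 1" using e by (simp add: norm_eq_1)
  define pr where "pr y = y - (y \<bullet> e) *\<^sub>R e" for y
  have "linear pr" unfolding pr_def by (intro linearI) (simp_all add: inner_add_left scaleR_add_left scaleR_diff_right)
  then have pr_line: "pr (y + t *\<^sub>R v) = pr y + t *\<^sub>R pr v" for y v t
    by (simp add: linear_add linear_cmul)
  define \<Gamma> where "\<Gamma> = frechet_derivative \<gamma> (at (pr x))"
  have \<Gamma>: "(\<gamma> has_derivative \<Gamma>) (at (pr x))"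
    using \<gamma> by (simp add: \<Gamma>_def frechet_derivative_works[symmetric])
  have x0: "\<gamma> (pr x) \<le> x \<bullet> e"
  proof -
    have "x \<in> S \<inter> ball x r" using S(2) r by simp
    then show ?thesis unfolding eq pr_def by simp
  qed
  have ray: "L v = 0" if v: "\<Gamma> (pr v) < v \<bullet> e" for v
  proof -
    \<comment> \<open>The height above the graph along the ray: nonnegative at 0 and with positive
      slope, so the ray starts inside \<open>S\<close>.\<close>
    define \<theta> where "\<theta> t = (x + t *\<^sub>R v) \<bullet> e - \<gamma> (pr (x + t *\<^sub>R v))" for t :: real
    have "((\<lambda>t. pr (x + t *\<^sub>R v)) has_derivative (\<lambda>s. s *\<^sub>R pr v)) (at 0)"
      unfolding pr_line by (auto intro!: derivative_eq_intros)
    from has_derivative_compose[OF this, of \<gamma> \<Gamma>] \<Gamma>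
    have "((\<lambda>t. \<gamma> (pr (x + t *\<^sub>R v))) has_derivative (\<lambda>s. \<Gamma> (s *\<^sub>R pr v))) (at 0)" by simp
    moreover have "\<Gamma> (s *\<^sub>R pr v) = s * \<Gamma> (pr v)" for s
      using has_derivative_linear[OF \<Gamma>] by (simp add: linear_cmul)
    ultimately have "((\<lambda>t. \<gamma> (pr (x + t *\<^sub>R v))) has_real_derivative \<Gamma> (pr v)) (at 0)"
      by (simp only: has_field_derivative_def mult_commute_abs)
    then have der: "(\<theta> has_real_derivative v \<bullet> e - \<Gamma> (pr v)) (at 0)"
      unfolding \<theta>_def by (auto intro!: derivative_eq_intros simp: inner_add_left)
    have "0 < v \<bullet> e - \<Gamma> (pr v)" using v by simp
    from DERIV_pos_inc_right[OF der this] obtain d where d: "0 < d" "\<And>h. 0 < h \<Longrightarrow> h < d \<Longrightarrow> \<theta> 0 < \<theta> h"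
      by (auto simp only: add_0)
    have \<theta>0: "0 \<le> \<theta> 0" using x0 by (simp add: \<theta>_def)
    define d' where "d' = min d (r / (norm v + 1))"
    have d': "0 < d'" using d r by (simp add: d'_def add_nonneg_pos)
    have "x + t *\<^sub>R v \<in> S" if t: "0 \<le> t" "t < d'" for t
    proof -
      have "0 \<le> \<theta> t" using \<theta>0 d(2)[of t] t by (cases "t = 0") (auto simp: d'_def)
      moreover have "x + t *\<^sub>R v \<in> ball x r"
      proof -
        have "t * norm v \<le> t * (norm v + 1)" using t by (intro mult_left_mono) auto
        also have "\<dots> < r" using t unfolding d'_def by (simp add: pos_less_divide_eq add_nonneg_pos)
        finally show ?thesis using t by (simp add: dist_norm)
      qed
      ultimately have "x + t *\<^sub>R v \<in> S \<inter> ball x r"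
        unfolding eq by (simp add: \<theta>_def pr_def)
      then show ?thesis by simp
    qed
    then show ?thesis by (rule derivative_vanishes_along_ray[OF L d'])
  qed
  have pe: "pr e = 0" by (simp add: pr_def ee)
  have \<Gamma>0: "\<Gamma> 0 = 0" using has_derivative_linear[OF \<Gamma>] by (rule linear_0)
  have Le: "L e = 0" by (rule ray) (simp add: pe \<Gamma>0 ee)
  have "L w = 0" for w
  proof -
    \<comment> \<open>Lifts \<open>w\<close> by a multiple of \<open>e\<close> until its height
      exceeds the tangent hyperplane by 1. The projection does not change, and
      \<open>L e = 0\<close> removes the lift again.\<close>
    define s where "s = 1 + \<Gamma> (pr w) - w \<bullet> e"
    have "pr (w + s *\<^sub>R e) = pr w" by (simp add: pr_line pe)
    then have "L (w + s *\<^sub>R e) = 0"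
      by (intro ray) (simp add: inner_add_left ee s_def)
    then show ?thesis using Le lin by (simp add: linear_add linear_cmul)
  qed
  then show ?thesis by (auto simp: L_def fun_eq_iff)
qed

subsection \<open>Compactness from finite-rank estimates\<close>

text \<open>Up to \<open>\<epsilon>\<close> times the energy, the mass on \<open>W\<close> is
  controlled by finitely many \<open>L2\<close>-bounded functionals. The estimate is localized to
  \<open>W\<close> so that chart pieces can be united, while functionals and energy refer to the
  whole space. Compatibility with differences is the form of linearity in which Cauchy estimates use
  a functional.\<close>

definition rank_estimate :: "'a measure \<Rightarrow> ('a \<Rightarrow> complex) set \<Rightarrow>
    (('a \<Rightarrow> complex) \<Rightarrow> ('a \<Rightarrow> complex) \<Rightarrow> complex) \<Rightarrow> 'a set \<Rightarrow> real \<Rightarrow>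
    (('a \<Rightarrow> complex) \<Rightarrow> complex) set \<Rightarrow> real \<Rightarrow> bool" where
  "rank_estimate M V E W \<epsilon> \<Phi> c \<longleftrightarrow> finite \<Phi> \<and> 0 \<le> c \<and>
     (\<forall>L\<in>\<Phi>. (\<forall>u\<in>V. \<forall>v\<in>V. L (\<lambda>p. u p - v p) = L u - L v) \<and>
        (\<exists>B. \<forall>u\<in>V. cmod (L u) \<le> B * L2_norm M u)) \<and>
     (\<forall>u\<in>V. (\<integral>\<^sup>+p. ennreal ((cmod (u p))\<^sup>2) * indicator W p \<partial>M) \<le>
        ennreal (c * (\<Sum>L\<in>\<Phi>. (cmod (L u))\<^sup>2) + \<epsilon> * Re (E u u)))"

definition finite_rank_on :: "'a measure \<Rightarrow> ('a \<Rightarrow> complex) set \<Rightarrow>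
    (('a \<Rightarrow> complex) \<Rightarrow> ('a \<Rightarrow> complex) \<Rightarrow> complex) \<Rightarrow> 'a set \<Rightarrow> bool" where
  "finite_rank_on M V E W \<longleftrightarrow> (\<forall>\<epsilon>>0. \<exists>\<Phi> c. rank_estimate M V E W \<epsilon> \<Phi> c)"

lemma finite_rank_on_empty: "(\<And>u. u \<in> V \<Longrightarrow> 0 \<le> Re (E u u)) \<Longrightarrow> finite_rank_on M V E {}"
  unfolding finite_rank_on_def rank_estimate_def by (auto intro!: exI[of _ "{}"])

lemma finite_rank_on_Un:
  assumes V: "V \<subseteq> L2 M" and E: "\<And>u. u \<in> V \<Longrightarrow> 0 \<le> Re (E u u)"
    and W: "finite_rank_on M V E W" "finite_rank_on M V E W'" and sets: "W \<in> sets M" "W' \<in> sets M"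
  shows "finite_rank_on M V E (W \<union> W')"
  unfolding finite_rank_on_def
proof (intro allI impI)
  fix \<epsilon> :: real assume e: "0 < \<epsilon>"
  have e2: "0 < \<epsilon> / 2" using e by simp
  obtain \<Phi> c where 1: "rank_estimate M V E W (\<epsilon> / 2) \<Phi> c"
    using W(1) e2 unfolding finite_rank_on_def by blast
  obtain \<Phi>' c' where 2: "rank_estimate M V E W' (\<epsilon> / 2) \<Phi>' c'"
    using W(2) e2 unfolding finite_rank_on_def by blast
  note 1 = 1[unfolded rank_estimate_def] and 2 = 2[unfolded rank_estimate_def]
  have cc: "0 \<le> c" "0 \<le> c'" and fin: "finite \<Phi>" "finite \<Phi>'" using 1 2 by blast+
  show "\<exists>\<Phi> c. rank_estimate M V E (W \<union> W') \<epsilon> \<Phi> c"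
    unfolding rank_estimate_def
  proof (rule exI[of _ "\<Phi> \<union> \<Phi>'"], rule exI[of _ "c + c'"], intro conjI ballI)
    fix u assume u: "u \<in> V"
    have [measurable]: "u \<in> borel_measurable M" "W \<in> sets M" "W' \<in> sets M"
      using u V sets by (auto simp: L2_def)
    define s where "s = (\<Sum>L\<in>\<Phi> \<union> \<Phi>'. (cmod (L u))\<^sup>2)"
    have s: "(\<Sum>L\<in>\<Phi>. (cmod (L u))\<^sup>2) \<le> s" "(\<Sum>L\<in>\<Phi>'. (cmod (L u))\<^sup>2) \<le> s"
      unfolding s_def using fin by (auto intro!: sum_mono2)
    have "(\<integral>\<^sup>+p. ennreal ((cmod (u p))\<^sup>2) * indicator (W \<union> W') p \<partial>M) \<le>
        (\<integral>\<^sup>+p. ennreal ((cmod (u p))\<^sup>2) * indicator W p + ennreal ((cmod (u p))\<^sup>2) * indicator W' p \<partial>M)"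
      by (intro nn_integral_mono) (auto simp: indicator_def)
    also have "\<dots> = (\<integral>\<^sup>+p. ennreal ((cmod (u p))\<^sup>2) * indicator W p \<partial>M) + (\<integral>\<^sup>+p. ennreal ((cmod (u p))\<^sup>2) * indicator W' p \<partial>M)"
      by (rule nn_integral_add) measurable
    also have "\<dots> \<le> ennreal (c * (\<Sum>L\<in>\<Phi>. (cmod (L u))\<^sup>2) + (\<epsilon> / 2) * Re (E u u)) +
        ennreal (c' * (\<Sum>L\<in>\<Phi>'. (cmod (L u))\<^sup>2) + (\<epsilon> / 2) * Re (E u u))"
      using 1 2 u by (intro add_mono) blast+
    also have "\<dots> \<le> ennreal (c * s + (\<epsilon> / 2) * Re (E u u)) + ennreal (c' * s + (\<epsilon> / 2) * Re (E u u))"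
      using s cc by (intro add_mono ennreal_leI add_right_mono mult_left_mono)
    also have "\<dots> = ennreal ((c * s + (\<epsilon> / 2) * Re (E u u)) + (c' * s + (\<epsilon> / 2) * Re (E u u)))"
    proof (rule ennreal_plus[symmetric])
      have "0 \<le> s" by (simp add: s_def sum_nonneg)
      then show "0 \<le> c * s + (\<epsilon> / 2) * Re (E u u)" "0 \<le> c' * s + (\<epsilon> / 2) * Re (E u u)"
        using cc e E[OF u] by simp_all
    qed
    also have "(c * s + (\<epsilon> / 2) * Re (E u u)) + (c' * s + (\<epsilon> / 2) * Re (E u u)) = (c + c') * s + \<epsilon> * Re (E u u)"
      by (simp add: field_simps)
    finally show "(\<integral>\<^sup>+p. ennreal ((cmod (u p))\<^sup>2) * indicator (W \<union> W') p \<partial>M) \<le>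
        ennreal ((c + c') * (\<Sum>L\<in>\<Phi> \<union> \<Phi>'. (cmod (L u))\<^sup>2) + \<epsilon> * Re (E u u))" by (simp add: s_def)
  next
    show "finite (\<Phi> \<union> \<Phi>')" using fin by simp
    show "0 \<le> c + c'" using cc by simp
  next
    fix L assume "L \<in> \<Phi> \<union> \<Phi>'"
    then have L: "(\<forall>u\<in>V. \<forall>v\<in>V. L (\<lambda>p. u p - v p) = L u - L v) \<and>
        (\<exists>B. \<forall>u\<in>V. cmod (L u) \<le> B * L2_norm M u)" using 1 2 by blast
    then show "\<exists>B. \<forall>u\<in>V. cmod (L u) \<le> B * L2_norm M u" by blast
    show "L (\<lambda>p. u p - v p) = L u - L v" if "u \<in> V" "v \<in> V" for u v
      using L that by blast
  qed
qed

lemma finite_family_convergent_subsequence: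
  fixes X :: "'i \<Rightarrow> nat \<Rightarrow> complex"
  assumes "finite I" "\<And>i. i \<in> I \<Longrightarrow> bounded (range (X i))"
  shows "\<exists>r::nat \<Rightarrow> nat. strict_mono r \<and> (\<forall>i\<in>I. convergent (X i \<circ> r))"
  using assms
proof (induction I rule: finite_induct)
  case empty
  then show ?case using strict_mono_id by auto
next
  case (insert i I)
  then obtain r :: "nat \<Rightarrow> nat" where r: "strict_mono r" "\<forall>i\<in>I. convergent (X i \<circ> r)" by blast
  have "bounded (range (X i \<circ> r))"
    using insert.prems[of i] by (auto intro: bounded_subset)
  then obtain l s where s: "strict_mono (s :: nat \<Rightarrow> nat)" "((X i \<circ> r) \<circ> s) \<longlonglongrightarrow> l"
    using bounded_imp_convergent_subsequence by blast
  have "convergent (X j \<circ> (r \<circ> s))" if "j \<in> insert i I" for j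
  proof (cases "j = i")
    case True then show ?thesis using s(2) by (auto simp: convergent_def comp_assoc)
  next
    case False
    then have "convergent ((X j \<circ> r) \<circ> s)" using r(2) that convergent_subseq_convergent[OF _ s(1)] by auto
    then show ?thesis by (simp add: comp_assoc)
  qed
  then show ?case using strict_mono_o[OF r(1) s(1)] by blast
qed

text \<open>Along a diagonal subsequence all functionals for all precisions \<open>1 / Suc k\<close>
  converge. The estimate applied to differences then has a small functional part, and the bounded
  energy is suppressed by the factor \<open>1 / Suc k\<close>.\<close>

theorem finite_rank_compact:
  assumes E: "semi_inner V E" and V: "V \<subseteq> L2 M" and fr: "finite_rank_on M V E (space M)"
    and \<phi>: "\<And>n. \<phi> n \<in> V" "\<And>n. L2_norm M (\<phi> n) \<le> K" "\<And>n. semi_inner.nrm E (\<phi> n) \<le> K"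
  shows "\<exists>r::nat \<Rightarrow> nat. strict_mono r \<and> L2.nCauchy M (\<phi> \<circ> r)"
proof -
  interpret E: semi_inner V E by (rule E)
  have "\<exists>\<Phi> c. rank_estimate M V E (space M) (1 / Suc k) \<Phi> c" for k
    using fr unfolding finite_rank_on_def by simp
  then obtain \<Phi> c where re: "\<And>k. rank_estimate M V E (space M) (1 / Suc k) (\<Phi> k) (c k)"
    by metis
  note re = re[unfolded rank_estimate_def]
  have fin: "finite (\<Phi> k)" and c: "0 \<le> c k" for k using re[of k] by blast+
  have L: "(\<forall>u\<in>V. \<forall>v\<in>V. L (\<lambda>p. u p - v p) = L u - L v) \<and>
        (\<exists>B. \<forall>u\<in>V. cmod (L u) \<le> B * L2_norm M u)" if "L \<in> \<Phi> k" for k L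
    using re[of k] that by blast
  have est: "(\<integral>\<^sup>+p. ennreal ((cmod (u p))\<^sup>2) * indicator (space M) p \<partial>M) \<le>
        ennreal (c k * (\<Sum>L\<in>\<Phi> k. (cmod (L u))\<^sup>2) + (1 / Suc k) * Re (E u u))" if "u \<in> V" for k u
    using re[of k] that by blast
  have est': "(L2_norm M u)\<^sup>2 \<le> c k * (\<Sum>L\<in>\<Phi> k. (cmod (L u))\<^sup>2) + (1 / Suc k) * Re (E u u)" if "u \<in> V" for k u
  proof -
    have "(\<integral>\<^sup>+p. ennreal ((cmod (u p))\<^sup>2) * indicator (space M) p \<partial>M) = (\<integral>\<^sup>+p. ennreal ((cmod (u p))\<^sup>2) \<partial>M)"
      by (intro nn_integral_cong) simp
    also have "\<dots> = ennreal ((L2_norm M u)\<^sup>2)" using that V by (intro L2_nn_integral) auto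
    finally have "ennreal ((L2_norm M u)\<^sup>2) \<le> ennreal (c k * (\<Sum>L\<in>\<Phi> k. (cmod (L u))\<^sup>2) + (1 / Suc k) * Re (E u u))"
      using est[OF that, of k] by simp
    moreover have "0 \<le> c k * (\<Sum>L\<in>\<Phi> k. (cmod (L u))\<^sup>2) + (1 / Suc k) * Re (E u u)"
      using c E.nonneg[OF that] by (intro add_nonneg_nonneg mult_nonneg_nonneg sum_nonneg) auto
    ultimately show ?thesis by (simp add: ennreal_le_iff)
  qed
  have bdd: "bounded (range (\<lambda>n. L (\<phi> n)))" if "L \<in> \<Phi> k" for L k
  proof -
    obtain B where B: "\<forall>u\<in>V. cmod (L u) \<le> B * L2_norm M u" using L[OF \<open>L \<in> \<Phi> k\<close>] by blast
    have "cmod (L (\<phi> n)) \<le> \<bar>B\<bar> * K" for n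
    proof -
      have "0 \<le> L2_norm M (\<phi> n)" by (simp add: L2_norm_def L2_inner_self)
      then have "B * L2_norm M (\<phi> n) \<le> \<bar>B\<bar> * K" using \<phi>(2)[of n] by (intro mult_mono) auto
      then show ?thesis using B \<phi>(1)[of n] by force
    qed
    then show ?thesis unfolding bounded_iff by blast
  qed
  \<comment> \<open>The property to be secured at stage \<open>k\<close> of the diagonal
    extraction.\<close>
  define P where "P k s \<longleftrightarrow> (\<forall>L\<in>\<Phi> k. convergent (\<lambda>n. L (\<phi> (s n))))" for k and s :: "nat \<Rightarrow> nat"
  interpret subseqs P
  proof
    fix k and s :: "nat \<Rightarrow> nat"
    have "bounded (range (\<lambda>n. L (\<phi> (s n))))" if "L \<in> \<Phi> k" for L
      using bdd[OF that] by (rule bounded_subset) auto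
    then have "\<exists>r::nat \<Rightarrow> nat. strict_mono r \<and> (\<forall>L\<in>\<Phi> k. convergent ((\<lambda>n. L (\<phi> (s n))) \<circ> r))"
      by (intro finite_family_convergent_subsequence[OF fin])
    then show "\<exists>r'. strict_mono r' \<and> P k (s \<circ> r')" by (simp add: P_def o_def)
  qed
  have conv: "convergent (\<lambda>n. L (\<phi> (diagseq n)))" if "L \<in> \<Phi> k" for L k
  proof -
    \<comment> \<open>Only from index \<open>Suc k\<close> on is the diagonal sequence guaranteed to
      be a subsequence of the one chosen at stage \<open>k\<close>; convergence ignores the initial
      segment.\<close>
    have "P k (diagseq \<circ> ((+) (Suc k)))"
    proof (rule diagseq_holds)
      fix r s :: "nat \<Rightarrow> nat" and n assume "strict_mono r" "P n s"
      then show "P n (s \<circ> r)"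
        unfolding P_def using convergent_subseq_convergent[of _ r] by (fastforce simp: o_def)
    qed
    then have "convergent (\<lambda>n. L (\<phi> (diagseq (n + Suc k))))"
      using that by (auto simp: P_def add.commute)
    then show ?thesis by (subst (asm) convergent_ignore_initial_segment)
  qed
  have K: "0 \<le> K" using \<phi>(3)[of 0] E.nrm_nonneg[OF \<phi>(1)[of 0]] by linarith
  have "L2.nCauchy M (\<phi> \<circ> diagseq)"
  proof (rule L2.nCauchyI_sq)
    fix e :: real assume e: "0 < e"
    \<comment> \<open>The energy of a difference is at most \<open>(2 * K)^2\<close>, so this
      \<open>k\<close> leaves less than \<open>e / 2\<close> for the energy term.\<close>
    obtain k where k: "4 * K\<^sup>2 / e * 2 < real (Suc k)" using reals_Archimedean2 less_Suc_eq by (metis of_nat_less_iff order_less_trans lessI)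
    have tail: "(1 / Suc k) * (4 * K\<^sup>2) < e / 2" using k e by (simp add: field_simps)
    define S where "S m n = (\<Sum>L\<in>\<Phi> k. (cmod (L (\<phi> (diagseq m)) - L (\<phi> (diagseq n))))\<^sup>2)" for m n
    have "\<exists>N. \<forall>m\<ge>N. \<forall>n\<ge>N. c k * S m n < e / 2"
    proof -
      \<comment> \<open>Chosen such that
        \<open>(c k + 1) * (card (\<Phi> k) + 1) * \<delta>^2 = e / 2\<close>; the added ones cover
        \<open>c k = 0\<close> and an empty family.\<close>
      define \<delta> where "\<delta> = sqrt (e / (2 * (c k + 1) * (real (card (\<Phi> k)) + 1)))"
      have pos: "0 < 2 * (c k + 1) * (real (card (\<Phi> k)) + 1)" using c[of k] by (intro mult_pos_pos) auto
      have \<delta>: "0 < \<delta>" unfolding \<delta>_def using e pos by simp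
      have "\<exists>N. \<forall>m\<ge>N. \<forall>n\<ge>N. cmod (L (\<phi> (diagseq m)) - L (\<phi> (diagseq n))) < \<delta>" if "L \<in> \<Phi> k" for L
        using convergent_Cauchy[OF conv[OF that]] \<delta> unfolding Cauchy_def dist_norm by blast
      then obtain N where N: "\<And>L m n. L \<in> \<Phi> k \<Longrightarrow> N L \<le> m \<Longrightarrow> N L \<le> n \<Longrightarrow> cmod (L (\<phi> (diagseq m)) - L (\<phi> (diagseq n))) < \<delta>"
        by metis
      have "c k * S m n < e / 2" if mn: "m \<ge> (\<Sum>L\<in>\<Phi> k. N L)" "n \<ge> (\<Sum>L\<in>\<Phi> k. N L)" for m n
      proof -
        have "S m n \<le> (\<Sum>L\<in>\<Phi> k. \<delta>\<^sup>2)"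
          unfolding S_def
        proof (intro sum_mono power_mono)
          fix L assume L: "L \<in> \<Phi> k"
          then have "N L \<le> (\<Sum>L\<in>\<Phi> k. N L)" using fin by (intro member_le_sum) auto
          then show "cmod (L (\<phi> (diagseq m)) - L (\<phi> (diagseq n))) \<le> \<delta>" using N[OF L, of m n] mn by linarith
        qed simp
        also have "\<dots> = real (card (\<Phi> k)) * \<delta>\<^sup>2" by simp
        also have "\<dots> \<le> (real (card (\<Phi> k)) + 1) * \<delta>\<^sup>2" by (intro mult_right_mono) auto
        finally have "c k * S m n \<le> c k * ((real (card (\<Phi> k)) + 1) * \<delta>\<^sup>2)" using c by (intro mult_left_mono)
        also have "\<dots> < (c k + 1) * ((real (card (\<Phi> k)) + 1) * \<delta>\<^sup>2)"
          using \<delta> by (intro mult_strict_right_mono) auto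
        also have "\<delta>\<^sup>2 = e / (2 * (c k + 1) * (real (card (\<Phi> k)) + 1))"
          unfolding \<delta>_def using e pos by simp
        also have "(c k + 1) * ((real (card (\<Phi> k)) + 1) * (e / (2 * (c k + 1) * (real (card (\<Phi> k)) + 1)))) = e / 2"
        proof -
          have "c k + 1 \<noteq> 0" "real (card (\<Phi> k)) + 1 \<noteq> 0" using c[of k] by linarith+
          moreover have "a * (b * (e / (2 * a * b))) = e / 2" if "a \<noteq> 0" "b \<noteq> 0" for a b :: real
            using that by (simp add: field_simps)
          ultimately show ?thesis by blast
        qed
        finally show ?thesis .
      qed
      then show ?thesis by blast
    qed
    then obtain N where N: "\<forall>m\<ge>N. \<forall>n\<ge>N. c k * S m n < e / 2" by blast
    have "Re (L2_inner M (\<lambda>p. (\<phi> \<circ> diagseq) m p - (\<phi> \<circ> diagseq) n p) (\<lambda>p. (\<phi> \<circ> diagseq) m p - (\<phi> \<circ> diagseq) n p)) < e"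
      if mn: "m \<ge> N" "n \<ge> N" for m n
    proof -
      let ?d = "\<lambda>p. \<phi> (diagseq m) p - \<phi> (diagseq n) p"
      have d: "?d \<in> V" by (intro E.diff_closed \<phi>)
      have "E.nrm ?d \<le> 2 * K" using E.nrm_diff[OF \<phi>(1)[of "diagseq m"] \<phi>(1)[of "diagseq n"]] \<phi>(3)[of "diagseq m"] \<phi>(3)[of "diagseq n"] by linarith
      then have "Re (E ?d ?d) \<le> (2 * K)\<^sup>2"
        unfolding E.nrm_sq[OF d, symmetric] by (intro power_mono E.nrm_nonneg d)
      then have "(1 / Suc k) * Re (E ?d ?d) \<le> (1 / Suc k) * (4 * K\<^sup>2)" by (intro mult_left_mono) (auto simp: power_mult_distrib)
      moreover have sumS: "(\<Sum>L\<in>\<Phi> k. (cmod (L ?d))\<^sup>2) = S m n"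
        unfolding S_def using L \<phi>(1) by (intro sum.cong refl) auto
      ultimately have "(L2_norm M ?d)\<^sup>2 < e"
        using est'[OF d, of k, unfolded sumS] N[rule_format, OF mn] tail by linarith
      moreover have "(L2_norm M ?d)\<^sup>2 = Re (L2_inner M ?d ?d)"
        using L2.nrm_sq[OF subsetD[OF V d]] by (simp add: L2_nrm)
      ultimately show ?thesis unfolding o_def by linarith
    qed
    then show "\<exists>N. \<forall>m\<ge>N. \<forall>n\<ge>N. Re (L2_inner M (\<lambda>p. (\<phi> \<circ> diagseq) m p - (\<phi> \<circ> diagseq) n p) (\<lambda>p. (\<phi> \<circ> diagseq) m p - (\<phi> \<circ> diagseq) n p)) < e"
      by blast
  qed
  then show ?thesis using subseq_diagseq by blast
qed

subsection \<open>Test functions on a compact Riemannian manifold\<close>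

lemma smooth_on_open_iff:
  assumes "open S"
  shows "smooth_on S f \<longleftrightarrow> (\<forall>k. Ck_on k S f)"
proof
  assume f: "smooth_on S f"
  show "\<forall>k. Ck_on k S f"
  proof (intro allI Ck_on_local)
    fix k x assume "x \<in> S"
    then obtain V h where V: "open V" "x \<in> V" "\<forall>k. Ck_on k V h" "\<forall>y\<in>S \<inter> V. h y = f y"
      using f unfolding smooth_on_def by blast
    have "Ck_on k (S \<inter> V) f"
      by (rule Ck_on_cong[of _ h]) (use V assms in \<open>auto intro: Ck_on_subset\<close>)
    then show "\<exists>T. open T \<and> x \<in> T \<and> Ck_on k T f"
      using V assms \<open>x \<in> S\<close> by (intro exI[of _ "S \<inter> V"]) auto
  qed
next
  assume "\<forall>k. Ck_on k S f"
  then show "smooth_on S f" unfolding smooth_on_def using assms by blast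
qed

lemma smooth_on_continuous_on:
  assumes "smooth_on S f"
  shows "continuous_on S f"
  unfolding continuous_on_eq_continuous_within
proof
  fix x assume x: "x \<in> S"
  then obtain V h where V: "open V" "x \<in> V" "\<forall>k. Ck_on k V h" "\<forall>y\<in>S \<inter> V. h y = f y"
    using assms unfolding smooth_on_def by blast
  have "continuous_on V h" using V(3)[rule_format, of 0] by simp
  then have "continuous_on (S \<inter> V) f"
    using V(4) by (subst continuous_on_cong[OF refl, of _ f h]) (auto intro: continuous_on_subset)
  then have "continuous (at x within S \<inter> V) f" using x V(2) by (simp add: continuous_on_eq_continuous_within)
  moreover have "at x within S \<inter> V = at x within S"
    by (rule at_within_nhd[OF V(2,1)]) auto
  ultimately show "continuous (at x within S) f" by simp
qed

lemma continuous_on_openin_local: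
  fixes f :: "'a::t2_space \<Rightarrow> 'b::topological_space"
  assumes "\<And>p. p \<in> M \<Longrightarrow> \<exists>U. openin (top_of_set M) U \<and> p \<in> U \<and> continuous_on U f"
  shows "continuous_on M f"
  unfolding continuous_on_eq_continuous_within
proof
  fix p assume "p \<in> M"
  with assms obtain U where U: "openin (top_of_set M) U" "p \<in> U" "continuous_on U f" by blast
  then obtain T where T: "open T" "U = M \<inter> T" by (auto simp: openin_open)
  have "continuous (at p within U) f" using U by (simp add: continuous_on_eq_continuous_within)
  moreover have "at p within U = at p within M"
    by (rule at_within_nhd[of p T]) (use U T in auto)
  ultimately show "continuous (at p within M) f" by simp
qed

lemma differentiable_bounded_linear:
  "bounded_linear L \<Longrightarrow> f differentiable at x \<Longrightarrow> (\<lambda>x. L (f x)) differentiable at x"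
  unfolding differentiable_def using bounded_linear.has_derivative by blast

locale compact_riemannian =
  fixes M :: "'a::t2_space set" and A :: "('a, 'n::finite) chart set"
    and g :: "('a, 'n) chart \<Rightarrow> 'a \<Rightarrow> real ^ 'n ^ 'n" and \<mu> :: "'a measure"
  assumes manifold: "smooth_manifold_C1_boundary M A" and compact_M: "compact M"
    and metric: "riemannian_metric A g" and volume: "riemannian_volume M A g \<mu>"
begin

abbreviation img :: "('a, 'n) chart \<Rightarrow> (real ^ 'n) set" where
  "img c \<equiv> snd c ` fst c"

abbreviation ichart :: "('a, 'n) chart \<Rightarrow> real ^ 'n \<Rightarrow> 'a" where
  "ichart c \<equiv> inv_into (fst c) (snd c)"

abbreviation Int_M :: "'a set" where
  "Int_M \<equiv> manifold_interior A"

abbreviation V :: "('a \<Rightarrow> complex) set" where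
  "V \<equiv> test_functions M A"

lemma chartD:
  assumes "c \<in> A"
  shows "openin (top_of_set M) (fst c)" "homeomorphism (fst c) (img c) (snd c) (ichart c)" "C1_domain (img c)"
    "fst c \<subseteq> M"
proof -
  obtain U \<psi> where c: "c = (U, \<psi>)" by (cases c)
  show 1: "openin (top_of_set M) (fst c)" and "homeomorphism (fst c) (img c) (snd c) (ichart c)" "C1_domain (img c)"
    using manifold assms unfolding smooth_manifold_C1_boundary_def c by auto
  show "fst c \<subseteq> M" using openin_imp_subset[OF 1] .
qed

lemma chart_cover: "p \<in> M \<Longrightarrow> \<exists>c\<in>A. p \<in> fst c"
  using manifold unfolding smooth_manifold_C1_boundary_def by blast

lemma ichart_chart: "c \<in> A \<Longrightarrow> p \<in> fst c \<Longrightarrow> ichart c (snd c p) = p"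
  using chartD(2) homeomorphism_apply1 by metis

lemma chart_ichart: "c \<in> A \<Longrightarrow> x \<in> img c \<Longrightarrow> snd c (ichart c x) = x"
  using chartD(2) homeomorphism_apply2 by metis

lemma ichart_in: "x \<in> img c \<Longrightarrow> ichart c x \<in> fst c"
  by (rule inv_into_into)

lemma chart_cont: "c \<in> A \<Longrightarrow> continuous_on (fst c) (snd c)"
  using chartD(2) homeomorphism_cont1 by blast

lemma ichart_cont: "c \<in> A \<Longrightarrow> continuous_on (img c) (ichart c)"
  using chartD(2) homeomorphism_cont2 by blast

lemma chart_openin_image:
  assumes "c \<in> A" "openin (top_of_set M) W" "W \<subseteq> fst c"
  obtains T where "open T" "snd c ` W = img c \<inter> T"
proof -
  have "openin (top_of_set (fst c)) W"
    using openin_subset_trans[OF assms(2,3)] chartD(4)[OF assms(1)] by blast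
  then have "openin (top_of_set (img c)) (snd c ` W)"
    by (rule homeomorphism_imp_open_map[OF chartD(2)[OF assms(1)]])
  then show thesis using that by (auto simp: openin_open)
qed

text \<open>\<open>manifold_interior\<close> asks for one chart in which the point is interior.
  Invariance of domain carries an open neighbourhood from that chart into the chart
  \<open>c\<close>.\<close>

lemma open_interior_image:
  assumes c: "c \<in> A"
  shows "open (snd c ` (fst c \<inter> Int_M))"
  unfolding open_subopen[of "snd c ` (fst c \<inter> Int_M)"]
proof
  fix x assume "x \<in> snd c ` (fst c \<inter> Int_M)"
  then obtain p where p: "x = snd c p" "p \<in> fst c" "p \<in> Int_M" by blast
  then obtain c' where c': "c' \<in> A" "p \<in> fst c'" "snd c' p \<in> interior (img c')"
    unfolding manifold_interior_def by fastforce
  define W where "W = fst c \<inter> fst c'"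
  have W: "openin (top_of_set M) W" unfolding W_def by (intro openin_Int chartD(1) c c'(1))
  obtain T where T: "open T" "snd c' ` W = img c' \<inter> T"
    using chart_openin_image[OF c'(1) W] unfolding W_def by blast
  define Y where "Y = T \<inter> interior (img c')"
  have Yo: "open Y" unfolding Y_def using T(1) by auto
  have Ysub: "Y \<subseteq> snd c' ` W" unfolding T(2) Y_def using interior_subset by blast
  have Yimg: "Y \<subseteq> img c'" using Ysub unfolding W_def by blast
  have Yin: "ichart c' y \<in> W" "snd c' (ichart c' y) = y" if y: "y \<in> Y" for y
  proof -
    show "snd c' (ichart c' y) = y" using chart_ichart[OF c'(1)] Yimg y by blast
    obtain q where "q \<in> W" "y = snd c' q" using Ysub y by blast
    then show "ichart c' y \<in> W" using ichart_chart[OF c'(1), of q] by (simp add: W_def)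
  qed
  define \<sigma> where "\<sigma> = snd c \<circ> ichart c'"
  have "continuous_on Y \<sigma>"
    unfolding \<sigma>_def
  proof (rule continuous_on_compose)
    show "continuous_on Y (ichart c')" using ichart_cont[OF c'(1)] Yimg by (rule continuous_on_subset)
    show "continuous_on (ichart c' ` Y) (snd c)"
      using chart_cont[OF c] by (rule continuous_on_subset) (use Yin(1) in \<open>auto simp: W_def\<close>)
  qed
  moreover have "inj_on \<sigma> Y"
  proof (rule inj_onI)
    fix y z assume y: "y \<in> Y" and z: "z \<in> Y" and "\<sigma> y = \<sigma> z"
    then have "ichart c (snd c (ichart c' y)) = ichart c (snd c (ichart c' z))" by (simp add: \<sigma>_def)
    then have "ichart c' y = ichart c' z"
      using ichart_chart[OF c] Yin(1)[OF y] Yin(1)[OF z] by (simp add: W_def)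
    then show "y = z" using Yin(2)[OF y] Yin(2)[OF z] by metis
  qed
  ultimately have "open (\<sigma> ` Y)" using Yo by (intro invariance_of_domain)
  moreover have "x \<in> \<sigma> ` Y"
  proof (rule image_eqI[of _ _ "snd c' p"])
    show "x = \<sigma> (snd c' p)" using ichart_chart[OF c'(1,2)] p(1) by (simp add: \<sigma>_def)
    have "snd c' p \<in> snd c' ` W" using p(2) c'(2) by (simp add: W_def)
    then show "snd c' p \<in> Y" unfolding Y_def using T(2) c'(3) by blast
  qed
  moreover have "\<sigma> ` Y \<subseteq> snd c ` (fst c \<inter> Int_M)"
  proof
    fix z assume "z \<in> \<sigma> ` Y"
    then obtain y where y: "y \<in> Y" "z = snd c (ichart c' y)" by (auto simp: \<sigma>_def)
    have "ichart c' y \<in> Int_M"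
      unfolding manifold_interior_def using c'(1) Yin[OF y(1)] y(1)
      by (auto simp: W_def Y_def intro!: bexI[of _ c'] split: prod.split)
    then show "z \<in> snd c ` (fst c \<inter> Int_M)" using y Yin(1)[OF y(1)] by (auto simp: W_def)
  qed
  ultimately show "\<exists>T. open T \<and> x \<in> T \<and> T \<subseteq> snd c ` (fst c \<inter> Int_M)" by blast
qed

lemma test_functionsD:
  assumes "\<phi> \<in> V"
  shows "c \<in> A \<Longrightarrow> Ck_on k (snd c ` (fst c \<inter> Int_M)) (\<phi> \<circ> ichart c)"
    and "\<exists>K. compact K \<and> K \<subseteq> Int_M \<and> (\<forall>p\<in>M - K. \<phi> p = 0)"
proof -
  show "Ck_on k (snd c ` (fst c \<inter> Int_M)) (\<phi> \<circ> ichart c)" if c: "c \<in> A"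
  proof -
    obtain U \<psi> where e: "c = (U, \<psi>)" by (cases c)
    have "smooth_on (snd c ` (fst c \<inter> Int_M)) (\<phi> \<circ> ichart c)"
      using assms c unfolding test_functions_def e by auto
    then show ?thesis using smooth_on_open_iff[OF open_interior_image[OF c]] by blast
  qed
  show "\<exists>K. compact K \<and> K \<subseteq> Int_M \<and> (\<forall>p\<in>M - K. \<phi> p = 0)"
    using assms unfolding test_functions_def by blast
qed

lemma test_functionsI:
  assumes "\<And>c k. c \<in> A \<Longrightarrow> Ck_on k (snd c ` (fst c \<inter> Int_M)) (\<phi> \<circ> ichart c)"
    and "compact K" "K \<subseteq> Int_M" "\<And>p. p \<in> M - K \<Longrightarrow> \<phi> p = 0"
  shows "\<phi> \<in> V"
proof -
  have "smooth_on (snd c ` (fst c \<inter> Int_M)) (\<phi> \<circ> ichart c)" if "c \<in> A" for c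
    using assms(1)[OF that] smooth_on_open_iff[OF open_interior_image[OF that]] by blast
  then have "\<forall>(U, \<psi>)\<in>A. smooth_on (\<psi> ` (U \<inter> Int_M)) (\<phi> \<circ> inv_into U \<psi>)" by fastforce
  then show ?thesis using assms(2-) unfolding test_functions_def by blast
qed

lemma test_functions_lincomb:
  assumes u: "u \<in> V" and v: "v \<in> V"
  shows "(\<lambda>p. a * u p + b * v p) \<in> V"
proof -
  obtain K where K: "compact K" "K \<subseteq> Int_M" "\<forall>p\<in>M - K. u p = 0" using test_functionsD(2)[OF u] by blast
  obtain K' where K': "compact K'" "K' \<subseteq> Int_M" "\<forall>p\<in>M - K'. v p = 0" using test_functionsD(2)[OF v] by blast
  show ?thesis
  proof (rule test_functionsI[of _ "K \<union> K'"])
    fix c k assume c: "c \<in> A"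
    note o = open_interior_image[OF c]
    have "Ck_on k (snd c ` (fst c \<inter> Int_M)) (\<lambda>x. a * (u \<circ> ichart c) x + b * (v \<circ> ichart c) x)"
      by (intro Ck_on_add Ck_on_bounded_linear[OF bounded_linear_mult_right] o test_functionsD(1) u v c)
    then show "Ck_on k (snd c ` (fst c \<inter> Int_M)) ((\<lambda>p. a * u p + b * v p) \<circ> ichart c)" by (simp add: o_def)
  qed (use K K' in auto)
qed

lemma test_functions_cnj:
  assumes u: "u \<in> V"
  shows "(\<lambda>p. cnj (u p)) \<in> V"
proof -
  obtain K where K: "compact K" "K \<subseteq> Int_M" "\<forall>p\<in>M - K. u p = 0" using test_functionsD(2)[OF u] by blast
  show ?thesis
  proof (rule test_functionsI[of _ K])
    fix c k assume c: "c \<in> A"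
    have "Ck_on k (snd c ` (fst c \<inter> Int_M)) (\<lambda>x. cnj ((u \<circ> ichart c) x))"
      by (intro Ck_on_bounded_linear[OF bounded_linear_cnj] open_interior_image test_functionsD(1) u c)
    then show "Ck_on k (snd c ` (fst c \<inter> Int_M)) ((\<lambda>p. cnj (u p)) \<circ> ichart c)" by (simp add: o_def)
  qed (use K in auto)
qed

text \<open>A test function vanishes near the boundary, so its coordinate expression stays smooth when it is
  extended by zero to a neighbourhood of the chart image.\<close>

definition lift :: "('a, 'n) chart \<Rightarrow> ('a \<Rightarrow> complex) \<Rightarrow> real ^ 'n \<Rightarrow> complex" where
  "lift c \<phi> x = (if x \<in> img c then \<phi> (ichart c x) else 0)"

text \<open>An open set in which the chart image is relatively closed; on it the extension by zero
  lives.\<close>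

definition nbhd :: "('a, 'n) chart \<Rightarrow> (real ^ 'n) set" where
  "nbhd c = (SOME U. open U \<and> img c \<subseteq> U \<and> open (U - img c))"

lemma nbhd:
  assumes "c \<in> A"
  shows "open (nbhd c)" "img c \<subseteq> nbhd c" "open (nbhd c - img c)"
proof -
  have "\<exists>U. open U \<and> img c \<subseteq> U \<and> open (U - img c)"
    using C1_domain_locally_closed[OF chartD(3)[OF assms]] by metis
  then have "open (nbhd c) \<and> img c \<subseteq> nbhd c \<and> open (nbhd c - img c)"
    unfolding nbhd_def by (rule someI_ex)
  then show "open (nbhd c)" "img c \<subseteq> nbhd c" "open (nbhd c - img c)" by blast+
qed

text \<open>Off the chart image the relative complement is open. A point of the image that is not
  interior lies outside the compact support, whose complement is open in \<open>M\<close>, and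
  beyond the image the lift is zero anyway.\<close>

lemma lift_zero_nbhd:
  assumes c: "c \<in> A" and \<phi>: "\<phi> \<in> V" and x: "x \<in> nbhd c" "x \<notin> snd c ` (fst c \<inter> Int_M)"
  obtains T where "open T" "x \<in> T" "\<And>y. y \<in> T \<Longrightarrow> lift c \<phi> y = 0"
proof (cases "x \<in> img c")
  case False
  then show thesis using that[of "nbhd c - img c"] nbhd(3)[OF c] x by (auto simp: lift_def)
next
  case True
  obtain K where K: "compact K" "K \<subseteq> Int_M" "\<forall>p\<in>M - K. \<phi> p = 0" using test_functionsD(2)[OF \<phi>] by blast
  have "openin (top_of_set M) (fst c \<inter> - K)"
  proof (rule openin_Int_open)
    show "openin (top_of_set M) (fst c)" by (rule chartD(1)[OF c])
    show "open (- K)" using compact_imp_closed[OF K(1)] by (simp add: open_Compl)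
  qed
  then obtain T where T: "open T" "snd c ` (fst c \<inter> - K) = img c \<inter> T"
    using chart_openin_image[OF c] by blast
  have "x \<in> T"
  proof -
    obtain p where p: "p \<in> fst c" "x = snd c p" using True by blast
    then have "p \<notin> K" using x(2) K(2) by blast
    then show ?thesis using p T(2) by blast
  qed
  moreover have "lift c \<phi> y = 0" if y: "y \<in> T" for y
  proof (cases "y \<in> img c")
    case True
    then obtain q where q: "q \<in> fst c" "q \<notin> K" "y = snd c q" using y T(2) by blast
    then show ?thesis using K(3) chartD(4)[OF c] ichart_chart[OF c, of q] by (auto simp: lift_def)
  qed (simp add: lift_def)
  ultimately show thesis using that T(1) by blast
qed

lemma lift_Ck:
  assumes c: "c \<in> A" and \<phi>: "\<phi> \<in> V"
  shows "Ck_on k (nbhd c) (lift c \<phi>)"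
proof (rule Ck_on_local)
  fix x assume x: "x \<in> nbhd c"
  show "\<exists>T. open T \<and> x \<in> T \<and> Ck_on k T (lift c \<phi>)"
  proof (cases "x \<in> snd c ` (fst c \<inter> Int_M)")
    case True
    have "Ck_on k (snd c ` (fst c \<inter> Int_M)) (lift c \<phi>)"
      by (rule Ck_on_cong[OF open_interior_image[OF c] _ test_functionsD(1)[OF \<phi> c]]) (auto simp: lift_def)
    then show ?thesis using True open_interior_image[OF c] by blast
  next
    case False
    obtain T where T: "open T" "x \<in> T" "\<And>y. y \<in> T \<Longrightarrow> lift c \<phi> y = 0"
      using lift_zero_nbhd[OF c \<phi> x False] by blast
    have "Ck_on k T (lift c \<phi>)" by (rule Ck_on_cong[OF T(1) _ Ck_on_const[of _ _ 0]]) (simp add: T(3))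
    then show ?thesis using T by blast
  qed
qed

lemma lift_C1: "c \<in> A \<Longrightarrow> \<phi> \<in> V \<Longrightarrow> Ck_on 1 (nbhd c) (lift c \<phi>)"
  by (rule lift_Ck)

lemma lift_diff: "lift c (\<lambda>p. u p - v p) = (\<lambda>x. lift c u x - lift c v x)"
  by (auto simp: lift_def)

lemma pd_lift_lincomb:
  assumes c: "c \<in> A" and u: "u \<in> V" and v: "v \<in> V" and x: "x \<in> nbhd c"
  shows "pd (lift c (\<lambda>p. a * u p + b * v p)) i x = a * pd (lift c u) i x + b * pd (lift c v) i x"
proof -
  have "lift c (\<lambda>p. a * u p + b * v p) = (\<lambda>x. a * lift c u x + b * lift c v x)" by (auto simp: lift_def)
  moreover have d: "lift c u differentiable at x" "lift c v differentiable at x"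
    using C1_onD(1)[OF nbhd(1)[OF c] lift_C1[OF c]] u v x by blast+
  ultimately show ?thesis
    by (simp add: pd_add pd_bounded_linear[OF bounded_linear_mult_right] differentiable_bounded_linear[OF bounded_linear_mult_right])
qed

lemma pd_lift_diff:
  assumes c: "c \<in> A" and u: "u \<in> V" and v: "v \<in> V" and x: "x \<in> nbhd c"
  shows "pd (lift c (\<lambda>p. u p - v p)) i x = pd (lift c u) i x - pd (lift c v) i x"
  using pd_lift_lincomb[OF assms, of 1 "-1" i] by simp

lemma pd_lift_cnj:
  assumes c: "c \<in> A" and u: "u \<in> V" and x: "x \<in> nbhd c"
  shows "pd (lift c (\<lambda>p. cnj (u p))) i x = cnj (pd (lift c u) i x)"
proof -
  have "lift c (\<lambda>p. cnj (u p)) = (\<lambda>x. cnj (lift c u x))" by (auto simp: lift_def)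
  then show ?thesis
    using pd_bounded_linear[OF bounded_linear_cnj C1_onD(1)[OF nbhd(1)[OF c] lift_C1[OF c u] x]] by simp
qed

lemma pd_lift_zero:
  assumes c: "c \<in> A" and \<phi>: "\<phi> \<in> V" and x: "x \<in> nbhd c" "x \<notin> snd c ` (fst c \<inter> Int_M)"
  shows "pd (lift c \<phi>) i x = 0"
proof -
  obtain T where T: "open T" "x \<in> T" "\<And>y. y \<in> T \<Longrightarrow> lift c \<phi> y = 0"
    using lift_zero_nbhd[OF assms] by blast
  have "frechet_derivative (lift c \<phi>) (at x) = frechet_derivative (\<lambda>_. 0) (at x)"
    by (rule frechet_derivative_cong_open(1)[OF T(1,2)]) (simp add: T(3))
  then show ?thesis by (simp add: pd_def)
qed

text \<open>The derivative of the lift, restricted to the chart image, is a derivative of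
  \<open>\<phi> \<circ> ichart c\<close> within it, and on a \<open>C^1\<close> domain there is only
  one. From here on all partial derivatives are those of functions on open sets.\<close>

lemma partial_in_eq:
  assumes c: "c \<in> A" and \<phi>: "\<phi> \<in> V" and p: "p \<in> fst c"
  shows "partial_in c \<phi> p i = pd (lift c \<phi>) i (snd c p)"
proof -
  let ?x = "snd c p"
  have x: "?x \<in> img c" "?x \<in> nbhd c" using p nbhd(2)[OF c] by auto
  have "(lift c \<phi> has_derivative frechet_derivative (lift c \<phi>) (at ?x)) (at ?x within img c)"
    by (rule has_derivative_at_withinI) (rule C1_onD(4)[OF nbhd(1)[OF c] lift_C1[OF c \<phi>] x(2)])
  then have D: "(\<phi> \<circ> ichart c has_derivative frechet_derivative (lift c \<phi>) (at ?x)) (at ?x within img c)"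
    by (rule has_derivative_transform[OF x(1), rotated]) (simp add: lift_def)
  have "(\<phi> \<circ> ichart c has_derivative frechet_derivative (\<phi> \<circ> ichart c) (at ?x within img c)) (at ?x within img c)"
    using differentiableI[OF D] by (simp add: frechet_derivative_works[symmetric])
  from C1_domain_derivative_unique[OF chartD(3)[OF c] x(1) this D]
  show ?thesis unfolding partial_in_def pd_def by simp
qed

section \<open>The gradient product in coordinates\<close>

lemma metric_spd: "c \<in> A \<Longrightarrow> p \<in> fst c \<Longrightarrow> spd (g c p)"
  using metric unfolding riemannian_metric_def spd_def by blast

text \<open>The metric on covectors applied to the differentials, in which the metric enters only
  through its inverse.\<close>

definition dual_product :: "('a, 'n) chart \<Rightarrow> ('a \<Rightarrow> complex) \<Rightarrow> ('a \<Rightarrow> complex) \<Rightarrow> 'a \<Rightarrow> complex" where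
  "dual_product c \<phi> \<eta> p = (\<Sum>i\<in>UNIV. \<Sum>j\<in>UNIV. of_real (matrix_inv (g c p) $ i $ j) *
     pd (lift c \<phi>) i (snd c p) * pd (lift c \<eta>) j (snd c p))"

end

lemma sum_swap_pairs:
  fixes f :: "'n::finite \<Rightarrow> 'n \<Rightarrow> 'n \<Rightarrow> 'n \<Rightarrow> complex"
  shows "(\<Sum>k\<in>UNIV. \<Sum>l\<in>UNIV. \<Sum>i\<in>UNIV. \<Sum>j\<in>UNIV. f i j k l) = (\<Sum>i\<in>UNIV. \<Sum>j\<in>UNIV. \<Sum>k\<in>UNIV. \<Sum>l\<in>UNIV. f i j k l)"
proof -
  have "(\<Sum>k\<in>UNIV. \<Sum>l\<in>UNIV. \<Sum>i\<in>UNIV. \<Sum>j\<in>UNIV. f i j k l) = (\<Sum>k\<in>UNIV. \<Sum>i\<in>UNIV. \<Sum>l\<in>UNIV. \<Sum>j\<in>UNIV. f i j k l)"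
    by (rule sum.cong[OF refl], rule sum.swap)
  also have "\<dots> = (\<Sum>i\<in>UNIV. \<Sum>k\<in>UNIV. \<Sum>l\<in>UNIV. \<Sum>j\<in>UNIV. f i j k l)" by (rule sum.swap)
  also have "\<dots> = (\<Sum>i\<in>UNIV. \<Sum>k\<in>UNIV. \<Sum>j\<in>UNIV. \<Sum>l\<in>UNIV. f i j k l)"
    by (rule sum.cong[OF refl], rule sum.cong[OF refl], rule sum.swap)
  also have "\<dots> = (\<Sum>i\<in>UNIV. \<Sum>j\<in>UNIV. \<Sum>k\<in>UNIV. \<Sum>l\<in>UNIV. f i j k l)"
    by (rule sum.cong[OF refl], rule sum.swap)
  finally show ?thesis .
qed

context compact_riemannian
begin

lemma metric_in_gradient:
  assumes c: "c \<in> A" and u: "u \<in> V" and v: "v \<in> V" and p: "p \<in> fst c"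
  shows "metric_in g c p (gradient_in g c u p) (gradient_in g c v p) = dual_product c u v p"
proof -
  define G where "G = g c p"
  define H where "H = matrix_inv G"
  have G: "spd G" unfolding G_def by (rule metric_spd[OF c p])
  define a where "a i = pd (lift c u) i (snd c p)" for i
  define b where "b i = pd (lift c v) i (snd c p)" for i
  \<comment> \<open>Lowering the index of a gradient returns the differential.\<close>
  have lower: "(\<Sum>i\<in>UNIV. of_real (G $ i $ j) * (\<Sum>k\<in>UNIV. of_real (H $ i $ k) * a k)) = a j" for j
  proof -
    have e: "(\<Sum>i\<in>UNIV. G $ i $ j * H $ i $ k) = (if j = k then 1 else 0)" for k
    proof -
      have "G $ i $ j = G $ j $ i" for i
      proof -
        have "G $ i $ j = transpose G $ j $ i" by (simp add: transpose_def)
        then show ?thesis using G by (simp add: spd_def)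
      qed
      then have "(\<Sum>i\<in>UNIV. G $ i $ j * H $ i $ k) = (G ** H) $ j $ k" by (simp add: matrix_matrix_mult_def)
      then show ?thesis by (simp add: H_def spd_inv(1)[OF G] mat_def)
    qed
    have "(\<Sum>i\<in>UNIV. of_real (G $ i $ j) * (\<Sum>k\<in>UNIV. of_real (H $ i $ k) * a k)) =
        (\<Sum>i\<in>UNIV. \<Sum>k\<in>UNIV. of_real (G $ i $ j * H $ i $ k) * a k)"
      by (simp add: sum_distrib_left mult.assoc)
    also have "\<dots> = (\<Sum>k\<in>UNIV. \<Sum>i\<in>UNIV. of_real (G $ i $ j * H $ i $ k) * a k)" by (rule sum.swap)
    also have "\<dots> = (\<Sum>k\<in>UNIV. of_real (\<Sum>i\<in>UNIV. G $ i $ j * H $ i $ k) * a k)"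
      by (simp only: of_real_sum sum_distrib_right)
    also have "\<dots> = (\<Sum>k\<in>UNIV. (if j = k then a k else 0))"
      unfolding e by (intro sum.cong refl) simp
    finally show ?thesis by simp
  qed
  have "metric_in g c p (gradient_in g c u p) (gradient_in g c v p) =
      (\<Sum>i\<in>UNIV. \<Sum>j\<in>UNIV. of_real (G $ i $ j) * (\<Sum>k\<in>UNIV. of_real (H $ i $ k) * a k) * (\<Sum>l\<in>UNIV. of_real (H $ j $ l) * b l))"
    unfolding metric_in_def gradient_in_def a_def b_def H_def G_def
    by (simp add: partial_in_eq[OF c u p] partial_in_eq[OF c v p])
  also have "\<dots> = (\<Sum>j\<in>UNIV. \<Sum>i\<in>UNIV. of_real (G $ i $ j) * (\<Sum>k\<in>UNIV. of_real (H $ i $ k) * a k) * (\<Sum>l\<in>UNIV. of_real (H $ j $ l) * b l))"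
    by (rule sum.swap)
  also have "\<dots> = (\<Sum>j\<in>UNIV. a j * (\<Sum>l\<in>UNIV. of_real (H $ j $ l) * b l))"
    by (simp only: sum_distrib_right[symmetric] lower)
  also have "\<dots> = dual_product c u v p"
    unfolding dual_product_def a_def b_def H_def G_def by (simp add: sum_distrib_left mult_ac)
  finally show ?thesis .
qed

lemma dual_product_zero:
  assumes c: "c \<in> A" and u: "u \<in> V" and p: "p \<in> fst c" "p \<notin> Int_M"
  shows "dual_product c u v p = 0"
proof -
  have "snd c p \<notin> snd c ` (fst c \<inter> Int_M)"
  proof
    assume "snd c p \<in> snd c ` (fst c \<inter> Int_M)"
    then obtain q where "q \<in> fst c" "q \<in> Int_M" "snd c p = snd c q" by blast
    then show False using ichart_chart[OF c] p by metis
  qed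
  then have "pd (lift c u) i (snd c p) = 0" for i
    using pd_lift_zero[OF c u] nbhd(2)[OF c] p(1) by blast
  then show ?thesis by (simp add: dual_product_def)
qed

text \<open>One matrix \<open>D\<close> has to serve both the transformation law of the metric and
  the chain rule. At an interior point the local extension of the transition map agrees with it on
  an open set, so the derivative within the overlap is an ordinary one.\<close>

lemma transition_derivative:
  assumes c: "c \<in> A" "c' \<in> A" and p: "p \<in> fst c" "p \<in> fst c'" "p \<in> Int_M"
  obtains D where "g c p = transpose (matrix D) ** g c' p ** matrix D"
    "\<And>u i. u \<in> V \<Longrightarrow> pd (lift c u) i (snd c p) = (\<Sum>k\<in>UNIV. of_real (matrix D $ k $ i) * pd (lift c' u) k (snd c' p))"
proof -
  let ?x = "snd c p" and ?\<tau> = "transition c c'"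
  define Z where "Z = snd c ` (fst c \<inter> fst c')"
  have xZ: "?x \<in> Z" using p by (simp add: Z_def)
  have "smooth_on Z ?\<tau>" using manifold c unfolding smooth_manifold_C1_boundary_def Z_def by blast
  then obtain X h where X: "open X" "?x \<in> X" "\<forall>k. Ck_on k X h" "\<forall>y\<in>Z \<inter> X. h y = ?\<tau> y"
    using xZ unfolding smooth_on_def by blast
  have "openin (top_of_set M) (fst c \<inter> fst c')" by (intro openin_Int chartD(1) c)
  then obtain T where T: "open T" "Z = img c \<inter> T"
    using chart_openin_image[OF c(1)] unfolding Z_def by blast
  define W where "W = snd c ` (fst c \<inter> Int_M) \<inter> T \<inter> X"
  have W: "open W" unfolding W_def using open_interior_image[OF c(1)] T(1) X(1) by auto
  have WZ: "W \<subseteq> Z \<inter> X" unfolding W_def T(2) by blast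
  have xW: "?x \<in> W" unfolding W_def using p xZ T(2) X(2) by blast
  define D where "D = frechet_derivative h (at ?x)"
  have "(h has_derivative D) (at ?x)"
    unfolding D_def frechet_derivative_works[symmetric] using X(2) X(3)[rule_format, of 1] by simp
  then have \<tau>D: "(?\<tau> has_derivative D) (at ?x)"
    by (rule has_derivative_transform_within_open[OF _ W xW]) (use X(4) WZ in blast)
  have "(?\<tau> has_derivative D) (at ?x within Z)" by (rule has_derivative_at_withinI[OF \<tau>D])
  then have G: "g c p = transpose (matrix D) ** g c' p ** matrix D"
    using metric c p unfolding riemannian_metric_def Z_def by blast
  have \<tau>x: "?\<tau> ?x = snd c' p" by (simp add: transition_def ichart_chart[OF c(1) p(1)])
  have "pd (lift c u) i ?x = (\<Sum>k\<in>UNIV. of_real (matrix D $ k $ i) * pd (lift c' u) k (snd c' p))"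
    if u: "u \<in> V" for u i
  proof -
    let ?L = "frechet_derivative (lift c' u) (at (snd c' p))"
    have x': "snd c' p \<in> nbhd c'" using nbhd(2)[OF c(2)] p(2) by blast
    have "(lift c' u has_derivative ?L) (at (?\<tau> ?x))"
      unfolding \<tau>x by (rule C1_onD(4)[OF nbhd(1)[OF c(2)] lift_C1[OF c(2) u] x'])
    from has_derivative_compose[OF \<tau>D this]
    have "((\<lambda>y. lift c' u (?\<tau> y)) has_derivative (\<lambda>v. ?L (D v))) (at ?x)" .
    then have "(lift c u has_derivative (\<lambda>v. ?L (D v))) (at ?x)"
    proof (rule has_derivative_transform_within_open[OF _ W xW])
      fix y assume "y \<in> W"
      then obtain q where q: "q \<in> fst c" "q \<in> fst c'" "y = snd c q" using WZ unfolding Z_def by blast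
      then show "lift c' u (?\<tau> y) = lift c u y"
        using ichart_chart[OF c(1) q(1)] ichart_chart[OF c(2) q(2)] by (simp add: transition_def lift_def)
    qed
    from frechet_derivative_at[OF this] have "pd (lift c u) i ?x = ?L (D (axis i 1))"
      unfolding pd_def by metis
    also have "\<dots> = (\<Sum>k\<in>UNIV. of_real (D (axis i 1) $ k) * ?L (axis k 1))"
      by (rule linear_axis_expansion)
         (rule linear_frechet_derivative[OF C1_onD(1)[OF nbhd(1)[OF c(2)] lift_C1[OF c(2) u] x']])
    finally show ?thesis by (simp add: pd_def matrix_def)
  qed
  then show thesis using that G by blast
qed

text \<open>Off the interior both sides vanish. Inside, covectors transform by the transpose of the
  Jacobian \<open>P\<close> and the inverse metric by \<open>P\<close> on both sides, and these
  factors cancel.\<close>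

lemma dual_product_chart_invariant:
  assumes c: "c \<in> A" "c' \<in> A" and u: "u \<in> V" and v: "v \<in> V" and p: "p \<in> fst c" "p \<in> fst c'"
  shows "dual_product c u v p = dual_product c' u v p"
proof (cases "p \<in> Int_M")
  case False
  then show ?thesis using dual_product_zero c u p by simp
next
  case True
  obtain D where D: "g c p = transpose (matrix D) ** g c' p ** matrix D"
    "\<And>u i. u \<in> V \<Longrightarrow> pd (lift c u) i (snd c p) = (\<Sum>k\<in>UNIV. of_real (matrix D $ k $ i) * pd (lift c' u) k (snd c' p))"
    using transition_derivative[OF c p True] by blast
  define P where "P = matrix D"
  define H where "H = matrix_inv (g c p)"
  define a where "a k = pd (lift c' u) k (snd c' p)" for k
  define b where "b k = pd (lift c' v) k (snd c' p)" for k
  \<comment> \<open>Inverting the transformation law: cyclic rearrangement exhibits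
    \<open>P ** H ** transpose P\<close> as the inverse of the other metric matrix.\<close>
  have "transpose P ** (g c' p ** P ** H) = g c p ** H"
    unfolding D(1) P_def by (simp add: matrix_mul_assoc)
  also have "\<dots> = mat 1" unfolding H_def by (rule spd_inv(1)[OF metric_spd[OF c(1) p(1)]])
  finally have "(g c' p ** P ** H) ** transpose P = mat 1" using matrix_left_right_inverse by blast
  then have "g c' p ** (P ** H ** transpose P) = mat 1" by (simp add: matrix_mul_assoc)
  then have H': "matrix_inv (g c' p) = P ** H ** transpose P" by (rule matrix_inv_eq)
  have H'_entry: "matrix_inv (g c' p) $ k $ l = (\<Sum>i\<in>UNIV. \<Sum>j\<in>UNIV. P $ k $ i * H $ i $ j * P $ l $ j)" for k l
  proof -
    have "matrix_inv (g c' p) $ k $ l = (\<Sum>j\<in>UNIV. (\<Sum>i\<in>UNIV. P $ k $ i * H $ i $ j) * P $ l $ j)"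
      unfolding H' by (simp add: matrix_matrix_mult_def transpose_def)
    also have "\<dots> = (\<Sum>j\<in>UNIV. \<Sum>i\<in>UNIV. P $ k $ i * H $ i $ j * P $ l $ j)" by (simp add: sum_distrib_right)
    also have "\<dots> = (\<Sum>i\<in>UNIV. \<Sum>j\<in>UNIV. P $ k $ i * H $ i $ j * P $ l $ j)" by (rule sum.swap)
    finally show ?thesis .
  qed
  let ?f = "\<lambda>i j k l. of_real (P $ k $ i * H $ i $ j * P $ l $ j) * a k * b l"
  have "dual_product c' u v p = (\<Sum>k\<in>UNIV. \<Sum>l\<in>UNIV. of_real (\<Sum>i\<in>UNIV. \<Sum>j\<in>UNIV. P $ k $ i * H $ i $ j * P $ l $ j) * a k * b l)"
    unfolding dual_product_def H'_entry a_def b_def ..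
  also have "\<dots> = (\<Sum>k\<in>UNIV. \<Sum>l\<in>UNIV. \<Sum>i\<in>UNIV. \<Sum>j\<in>UNIV. ?f i j k l)"
    by (simp only: of_real_sum sum_distrib_right)
  also have "\<dots> = (\<Sum>i\<in>UNIV. \<Sum>j\<in>UNIV. \<Sum>k\<in>UNIV. \<Sum>l\<in>UNIV. ?f i j k l)" by (rule sum_swap_pairs)
  also have "\<dots> = (\<Sum>i\<in>UNIV. \<Sum>j\<in>UNIV. of_real (H $ i $ j) * (\<Sum>k\<in>UNIV. of_real (P $ k $ i) * a k) * (\<Sum>l\<in>UNIV. of_real (P $ l $ j) * b l))"
  proof (intro sum.cong refl)
    fix i j
    have "of_real (H $ i $ j) * (\<Sum>k\<in>UNIV. of_real (P $ k $ i) * a k) * (\<Sum>l\<in>UNIV. of_real (P $ l $ j) * b l) =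
        (\<Sum>k\<in>UNIV. \<Sum>l\<in>UNIV. of_real (H $ i $ j) * (of_real (P $ k $ i) * a k * (of_real (P $ l $ j) * b l)))"
      by (subst mult.assoc, subst sum_product) (simp only: sum_distrib_left)
    also have "\<dots> = (\<Sum>k\<in>UNIV. \<Sum>l\<in>UNIV. ?f i j k l)"
      by (intro sum.cong refl) (simp add: mult_ac)
    finally show "(\<Sum>k\<in>UNIV. \<Sum>l\<in>UNIV. ?f i j k l) = of_real (H $ i $ j) * (\<Sum>k\<in>UNIV. of_real (P $ k $ i) * a k) * (\<Sum>l\<in>UNIV. of_real (P $ l $ j) * b l)" ..
  qed
  also have "\<dots> = dual_product c u v p"
    unfolding dual_product_def D(2)[OF u] D(2)[OF v] P_def a_def b_def H_def ..
  finally show ?thesis ..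
qed

lemma grad_product_eq:
  assumes c: "c \<in> A" and u: "u \<in> V" and v: "v \<in> V" and p: "p \<in> fst c"
  shows "grad_product A g u v p = dual_product c u v p"
proof -
  define d where "d = (SOME c. c \<in> A \<and> p \<in> fst c)"
  have "d \<in> A \<and> p \<in> fst d" unfolding d_def by (rule someI[of _ c]) (use c p in blast)
  then have d: "d \<in> A" "p \<in> fst d" by blast+
  have "grad_product A g u v p = metric_in g d p (gradient_in g d u p) (gradient_in g d v p)"
    by (simp add: grad_product_def d_def Let_def)
  also have "\<dots> = dual_product d u v p" by (rule metric_in_gradient[OF d(1) u v d(2)])
  also have "\<dots> = dual_product c u v p" by (rule dual_product_chart_invariant[OF d(1) c u v d(2) p])
  finally show ?thesis .
qed

lemma metric_entry_continuous:
  assumes c: "c \<in> A"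
  shows "continuous_on (img c) (\<lambda>x. g c (ichart c x) $ i $ j)"
proof -
  have "smooth_on (img c) (g c \<circ> ichart c)" using metric c unfolding riemannian_metric_def by blast
  from smooth_on_continuous_on[OF this] show ?thesis by (auto simp: o_def intro!: continuous_intros)
qed

lemma inverse_metric_entry_continuous:
  assumes c: "c \<in> A"
  shows "continuous_on (img c) (\<lambda>x. matrix_inv (g c (ichart c x)) $ i $ j)"
  by (intro continuous_on_matrix_inv metric_entry_continuous c spd_invertible metric_spd ichart_in)

lemma lift_pd_continuous: "c \<in> A \<Longrightarrow> u \<in> V \<Longrightarrow> continuous_on (img c) (pd (lift c u) i)"
  by (rule continuous_on_subset[OF C1_onD(3)[OF nbhd(1) lift_C1] nbhd(2)])

lemma continuous_on_chart_pullback: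
  assumes c: "c \<in> A" and f: "continuous_on (img c) (\<lambda>x. f (ichart c x))"
  shows "continuous_on (fst c) f"
proof -
  have "continuous_on (fst c) (\<lambda>p. f (ichart c (snd c p)))"
    by (rule continuous_on_compose2[OF f chart_cont[OF c]]) auto
  then show ?thesis using ichart_chart[OF c] by (subst continuous_on_cong[OF refl, of _ _ "\<lambda>p. f (ichart c (snd c p))"]) auto
qed

lemma dual_product_ichart:
  assumes c: "c \<in> A" and x: "x \<in> img c"
  shows "dual_product c u v (ichart c x) = (\<Sum>i\<in>UNIV. \<Sum>j\<in>UNIV. of_real (matrix_inv (g c (ichart c x)) $ i $ j) *
     pd (lift c u) i x * pd (lift c v) j x)"
  unfolding dual_product_def chart_ichart[OF c x] ..

lemma dual_product_continuous:
  assumes c: "c \<in> A" and u: "u \<in> V" and v: "v \<in> V"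
  shows "continuous_on (fst c) (dual_product c u v)"
proof (rule continuous_on_chart_pullback[OF c])
  have "continuous_on (img c) (\<lambda>x. \<Sum>i\<in>UNIV. \<Sum>j\<in>UNIV. of_real (matrix_inv (g c (ichart c x)) $ i $ j) *
     pd (lift c u) i x * pd (lift c v) j x)"
    by (intro continuous_intros lift_pd_continuous inverse_metric_entry_continuous c u v)
  then show "continuous_on (img c) (\<lambda>x. dual_product c u v (ichart c x))"
    by (subst continuous_on_cong[OF refl dual_product_ichart[OF c]])
qed

lemma grad_product_continuous:
  assumes u: "u \<in> V" and v: "v \<in> V"
  shows "continuous_on M (grad_product A g u v)"
proof (rule continuous_on_openin_local)
  fix p assume "p \<in> M"
  then obtain c where c: "c \<in> A" "p \<in> fst c" using chart_cover by blast
  have "continuous_on (fst c) (grad_product A g u v)"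
    using dual_product_continuous[OF c(1) u v]
    by (subst continuous_on_cong[OF refl grad_product_eq[OF c(1) u v]])
  then show "\<exists>U. openin (top_of_set M) U \<and> p \<in> U \<and> continuous_on U (grad_product A g u v)"
    using chartD(1)[OF c(1)] c(2) by blast
qed

lemma test_function_continuous:
  assumes u: "u \<in> V"
  shows "continuous_on M u"
proof (rule continuous_on_openin_local)
  fix p assume "p \<in> M"
  then obtain c where c: "c \<in> A" "p \<in> fst c" using chart_cover by blast
  have "continuous_on (img c) (lift c u)"
    by (rule continuous_on_subset[OF C1_onD(2)[OF nbhd(1)[OF c(1)] lift_C1[OF c(1) u]] nbhd(2)[OF c(1)]])
  then have "continuous_on (img c) (\<lambda>x. u (ichart c x))"
    by (subst continuous_on_cong[OF refl, of _ _ "lift c u"]) (simp_all add: lift_def)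
  then have "continuous_on (fst c) u" by (rule continuous_on_chart_pullback[OF c(1)])
  then show "\<exists>U. openin (top_of_set M) U \<and> p \<in> U \<and> continuous_on U u"
    using chartD(1)[OF c(1)] c(2) by blast
qed

section \<open>The volume measure in charts\<close>

lemma space_\<mu>: "space \<mu> = M" and sets_\<mu>: "sets \<mu> = sets (restrict_space borel M)"
  using volume unfolding riemannian_volume_def by blast+

lemma M_borel: "M \<in> sets borel"
  using compact_imp_closed[OF compact_M] by (rule borel_closed)

lemma measurable_continuous_\<mu>: "continuous_on M f \<Longrightarrow> f \<in> borel_measurable \<mu>"
  by (subst measurable_cong_sets[OF sets_\<mu> refl]) (rule borel_measurable_continuous_on_restrict)

lemma compact_sets_\<mu>: "compact K \<Longrightarrow> K \<subseteq> M \<Longrightarrow> K \<in> sets \<mu>"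
  unfolding sets_\<mu> by (subst sets_restrict_space_iff) (simp_all add: M_borel borel_closed compact_imp_closed)

definition wt :: "('a, 'n) chart \<Rightarrow> real ^ 'n \<Rightarrow> real" where
  "wt c x = sqrt (det (g c (ichart c x)))"

lemma wt_pos: "c \<in> A \<Longrightarrow> x \<in> img c \<Longrightarrow> 0 < wt c x"
  unfolding wt_def by (intro real_sqrt_gt_zero spd_det_pos metric_spd ichart_in)

lemma wt_continuous: "c \<in> A \<Longrightarrow> continuous_on (img c) (wt c)"
  unfolding wt_def by (intro continuous_intros continuous_on_det metric_entry_continuous)

text \<open>\<open>riemannian_volume\<close> prescribes only the measures of sets inside a chart.
  Read as an equality of the pushed-forward density with \<open>\<mu>\<close> cut to the piece, it
  yields the change of variables for all nonnegative functions. Compactness of \<open>P\<close>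
  provides the measurability of the piece.\<close>

theorem nn_integral_chart:
  assumes c: "c \<in> A" and P: "compact P" "P \<subseteq> img c" and q[measurable]: "q \<in> borel_measurable \<mu>"
  shows "(\<integral>\<^sup>+p. q p * indicator (ichart c ` P) p \<partial>\<mu>) =
    (\<integral>\<^sup>+x. q (ichart c x) * ennreal (wt c x) * indicator P x \<partial>lborel)"
proof -
  define N where "N = ichart c ` P"
  have ic: "continuous_on P (ichart c)" using ichart_cont[OF c] P(2) by (rule continuous_on_subset)
  have NU: "N \<subseteq> fst c" unfolding N_def using ichart_in P(2) by blast
  have NM: "N \<subseteq> M" using NU chartD(4)[OF c] by blast
  have N[measurable]: "N \<in> sets \<mu>"
    by (rule compact_sets_\<mu>) (use NM in \<open>auto simp: N_def intro!: compact_continuous_image ic P\<close>)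
  have Pb[measurable, simp]: "P \<in> sets borel" by (rule borel_compact[OF P(1)])
  define R where "R = restrict_space lborel P"
  have spR: "space R = P" by (simp add: R_def space_restrict_space)
  have im[measurable]: "ichart c \<in> measurable R \<mu>"
  proof -
    have "ichart c \<in> measurable R (restrict_space borel M)"
    proof (rule measurable_restrict_space2)
      show "ichart c \<in> space R \<rightarrow> M" using NM by (auto simp: spR N_def)
      show "ichart c \<in> borel_measurable R" unfolding R_def by (rule borel_measurable_compact[OF ic])
    qed
    then show ?thesis using measurable_cong_sets[OF refl sets_\<mu>] by blast
  qed
  have wm[measurable]: "wt c \<in> borel_measurable R"
    unfolding R_def by (rule borel_measurable_compact[OF continuous_on_subset[OF wt_continuous[OF c] P(2)]])
  have img_eq: "snd c ` (N \<inter> B) = {x \<in> P. ichart c x \<in> B}" for B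
  proof -
    have "snd c (ichart c x) = x" if "x \<in> P" for x using chart_ichart[OF c] P(2) that by blast
    then show ?thesis unfolding N_def by force
  qed
  have "distr (density R (\<lambda>x. ennreal (wt c x))) \<mu> (ichart c) = density \<mu> (indicator N)"
  proof (rule measure_eqI)
    fix B assume "B \<in> sets (distr (density R (\<lambda>x. ennreal (wt c x))) \<mu> (ichart c))"
    then have B[measurable]: "B \<in> sets \<mu>" by simp
    have "emeasure (distr (density R (\<lambda>x. ennreal (wt c x))) \<mu> (ichart c)) B =
        (\<integral>\<^sup>+x. ennreal (wt c x) * indicator (ichart c -` B \<inter> space R) x \<partial>R)"
      by (subst emeasure_distr) (simp_all add: emeasure_density measurable_sets[OF im B])
    also have "\<dots> = (\<integral>\<^sup>+x. ennreal (wt c x) * indicator (ichart c -` B \<inter> P) x * indicator P x \<partial>lborel)"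
      unfolding spR unfolding R_def by (subst nn_integral_restrict_space) simp_all
    also have "\<dots> = (\<integral>\<^sup>+x. ennreal (wt c x) * indicator (snd c ` (N \<inter> B)) x \<partial>lborel)"
      unfolding img_eq by (intro nn_integral_cong) (auto simp: indicator_def)
    also have "\<dots> = emeasure \<mu> (N \<inter> B)"
    proof -
      have "N \<inter> B \<in> sets \<mu>" "N \<inter> B \<subseteq> fst c" using NU by auto
      then show ?thesis using volume c unfolding riemannian_volume_def wt_def by (simp only:)
    qed
    also have "\<dots> = emeasure (density \<mu> (indicator N)) B"
      by (subst emeasure_density) (auto simp: indicator_inter_arith[symmetric])
    finally show "emeasure (distr (density R (\<lambda>x. ennreal (wt c x))) \<mu> (ichart c)) B = emeasure (density \<mu> (indicator N)) B" .
  qed simp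
  then have "(\<integral>\<^sup>+p. q p \<partial>density \<mu> (indicator N)) = (\<integral>\<^sup>+p. q p \<partial>distr (density R (\<lambda>x. ennreal (wt c x))) \<mu> (ichart c))" by simp
  also have "\<dots> = (\<integral>\<^sup>+x. ennreal (wt c x) * q (ichart c x) \<partial>R)"
    by (subst nn_integral_distr) (simp_all add: nn_integral_density)
  also have "\<dots> = (\<integral>\<^sup>+x. ennreal (wt c x) * q (ichart c x) * indicator P x \<partial>lborel)"
    unfolding R_def by (subst nn_integral_restrict_space) simp_all
  finally show ?thesis by (simp add: nn_integral_density N_def[symmetric] mult.commute)
qed

end

subsection \<open>Volume estimates in charts\<close>

lemma spd_quadratic_nonneg:
  fixes G :: "real ^ 'n ^ 'n" and z :: "'n \<Rightarrow> complex"
  assumes G: "spd G"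
  shows "0 \<le> Re (\<Sum>i\<in>UNIV. \<Sum>j\<in>UNIV. of_real (matrix_inv G $ i $ j) * z i * cnj (z j))"
proof -
  have "0 \<le> v \<bullet> (matrix_inv G *v v)" for v :: "real ^ 'n"
  proof -
    have "G *v (matrix_inv G *v v) = v" by (simp add: matrix_vector_mul_assoc spd_inv[OF G])
    then show ?thesis using spd_nonneg[OF G, of "matrix_inv G *v v"] by (simp add: inner_commute)
  qed
  then show ?thesis unfolding Re_quadratic_form by (intro add_nonneg_nonneg)
qed

lemma continuous_abs_bounded:
  fixes f :: "'b::topological_space \<Rightarrow> real"
  assumes "compact P" "continuous_on P f"
  shows "\<exists>b. 0 \<le> b \<and> (\<forall>x\<in>P. \<bar>f x\<bar> \<le> b)"
proof -
  have "bounded (f ` P)" by (intro compact_imp_bounded compact_continuous_image assms)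
  then obtain b where "\<forall>x\<in>P. \<bar>f x\<bar> \<le> b" unfolding bounded_iff by auto
  then show ?thesis by (intro exI[of _ "\<bar>b\<bar>"]) force
qed

lemma nn_integral_eq_HK:
  fixes F :: "'e::euclidean_space \<Rightarrow> real"
  assumes Q: "compact Q" "continuous_on Q F" and F: "\<And>x. x \<in> Q \<Longrightarrow> 0 \<le> F x"
  shows "(\<integral>\<^sup>+x. ennreal (F x) * indicator Q x \<partial>lborel) = ennreal (integral Q F)"
proof -
  have Qb: "Q \<in> sets borel" by (rule borel_compact[OF Q(1)])
  have "(\<integral>\<^sup>+x. ennreal (F x) * indicator Q x \<partial>lborel) = (\<integral>\<^sup>+x. ennreal (F x) \<partial>restrict_space lborel Q)"
    using Qb by (subst nn_integral_restrict_space) auto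
  also have "\<dots> = ennreal (LINT x|restrict_space lborel Q. F x)"
  proof (rule nn_integral_eq_integral)
    show "integrable (restrict_space lborel Q) F"
      using borel_integrable_compact[OF Q] Qb by (subst integrable_restrict_space) auto
    show "AE x in restrict_space lborel Q. 0 \<le> F x" using F by (intro AE_I2) (simp add: space_restrict_space)
  qed
  finally show ?thesis by (simp add: integral_restrict_eq(1)[OF Q])
qed

context compact_riemannian
begin

text \<open>\<open>X\<close> may stick out of the chart image; boxes and balls around boundary
  points are treated just like those around interior points.\<close>

definition pull :: "('a, 'n) chart \<Rightarrow> (real ^ 'n) set \<Rightarrow> 'a set" where
  "pull c X = fst c \<inter> snd c -` X"

lemma pull_eq: "c \<in> A \<Longrightarrow> pull c X = ichart c ` (img c \<inter> X)"
proof -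
  assume c: "c \<in> A"
  show ?thesis
  proof (intro equalityI subsetI)
    fix p assume "p \<in> pull c X"
    then show "p \<in> ichart c ` (img c \<inter> X)"
      using ichart_chart[OF c, of p] unfolding pull_def by (intro image_eqI[of _ _ "snd c p"]) auto
  next
    fix p assume "p \<in> ichart c ` (img c \<inter> X)"
    then obtain x where x: "p = ichart c x" "x \<in> img c" "x \<in> X" by blast
    then show "p \<in> pull c X" using chart_ichart[OF c x(2)] ichart_in[OF x(2)] unfolding pull_def by simp
  qed
qed

lemma pull_open: "c \<in> A \<Longrightarrow> open X \<Longrightarrow> openin (top_of_set M) (pull c X)"
  unfolding pull_def using continuous_openin_preimage_gen[OF chart_cont] chartD(1) openin_trans by blast

lemma pull_subset: "c \<in> A \<Longrightarrow> pull c X \<subseteq> M"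
  unfolding pull_def using chartD(4) by blast

lemma compact_image_part:
  assumes "c \<in> A" "compact Q" "Q \<subseteq> nbhd c"
  shows "compact (img c \<inter> Q)"
proof -
  have "img c \<inter> Q = Q - (nbhd c - img c)" using assms(3) by blast
  then show ?thesis using compact_diff[OF assms(2) nbhd(3)[OF assms(1)]] by simp
qed

lemma pull_sets:
  assumes "c \<in> A" "compact Q" "Q \<subseteq> nbhd c"
  shows "pull c Q \<in> sets \<mu>"
proof (rule compact_sets_\<mu>)
  have "continuous_on (img c \<inter> Q) (ichart c)" by (rule continuous_on_subset[OF ichart_cont[OF assms(1)]]) simp
  then show "compact (pull c Q)"
    unfolding pull_eq[OF assms(1)] by (rule compact_continuous_image[OF _ compact_image_part[OF assms]])
qed (rule pull_subset[OF assms(1)])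

text \<open>One constant for everything that compares manifold and coordinates;
  \<open>1 \<le> B * wt c x\<close> is the lower bound on the volume density.\<close>

definition bounds :: "('a, 'n) chart \<Rightarrow> (real ^ 'n) set \<Rightarrow> real \<Rightarrow> bool" where
  "bounds c Q B \<longleftrightarrow> 1 \<le> B \<and> (\<forall>x\<in>img c \<inter> Q. 1 \<le> B * wt c x \<and> wt c x \<le> B \<and>
     (\<forall>i j. \<bar>g c (ichart c x) $ i $ j\<bar> \<le> B) \<and> (\<forall>i j. \<bar>matrix_inv (g c (ichart c x)) $ i $ j\<bar> \<le> B))"

lemma bounds_exist:
  assumes c: "c \<in> A" and Q: "compact Q" "Q \<subseteq> nbhd c"
  shows "\<exists>B. bounds c Q B"
proof -
  let ?P = "img c \<inter> Q"
  have P: "compact ?P" by (rule compact_image_part[OF c Q])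
  have sub: "continuous_on (img c) f \<Longrightarrow> continuous_on ?P f" for f :: "real ^ 'n \<Rightarrow> real"
    by (rule continuous_on_subset) auto
  obtain b1 where b1: "0 \<le> b1" "\<forall>x\<in>?P. \<bar>wt c x\<bar> \<le> b1"
    using continuous_abs_bounded[OF P sub[OF wt_continuous[OF c]]] by blast
  have "continuous_on ?P (\<lambda>x. 1 / wt c x)"
  proof (rule continuous_on_divide)
    show "\<forall>x\<in>?P. wt c x \<noteq> 0" using wt_pos[OF c] by fastforce
  qed (auto intro: sub wt_continuous c)
  then obtain b2 where b2: "0 \<le> b2" "\<forall>x\<in>?P. \<bar>1 / wt c x\<bar> \<le> b2"
    using continuous_abs_bounded[OF P] by blast
  have "\<exists>b. 0 \<le> b \<and> (\<forall>x\<in>?P. \<bar>g c (ichart c x) $ i $ j\<bar> \<le> b)" for i j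
    by (rule continuous_abs_bounded[OF P sub[OF metric_entry_continuous[OF c]]])
  then obtain b3 where b3: "\<And>i j. 0 \<le> b3 i j" "\<And>i j. \<forall>x\<in>?P. \<bar>g c (ichart c x) $ i $ j\<bar> \<le> b3 i j" by metis
  have "\<exists>b. 0 \<le> b \<and> (\<forall>x\<in>?P. \<bar>matrix_inv (g c (ichart c x)) $ i $ j\<bar> \<le> b)" for i j
    by (rule continuous_abs_bounded[OF P sub[OF inverse_metric_entry_continuous[OF c]]])
  then obtain b4 where b4: "\<And>i j. 0 \<le> b4 i j" "\<And>i j. \<forall>x\<in>?P. \<bar>matrix_inv (g c (ichart c x)) $ i $ j\<bar> \<le> b4 i j" by metis
  define B where "B = 1 + b1 + b2 + (\<Sum>i\<in>UNIV. \<Sum>j\<in>UNIV. b3 i j) + (\<Sum>i\<in>UNIV. \<Sum>j\<in>UNIV. b4 i j)"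
  have s: "b i j \<le> (\<Sum>i\<in>UNIV. \<Sum>j\<in>UNIV. b i j)" if "\<And>i j. 0 \<le> b i j" for b :: "'n \<Rightarrow> 'n \<Rightarrow> real" and i j
  proof -
    have "b i j \<le> (\<Sum>j\<in>UNIV. b i j)" using that by (intro member_le_sum) auto
    also have "\<dots> \<le> (\<Sum>i\<in>UNIV. \<Sum>j\<in>UNIV. b i j)"
      using that by (intro member_le_sum[of i UNIV "\<lambda>i. \<Sum>j\<in>UNIV. b i j"]) (auto intro: sum_nonneg)
    finally show ?thesis .
  qed
  have nn: "0 \<le> (\<Sum>i\<in>UNIV. \<Sum>j\<in>UNIV. b3 i j)" "0 \<le> (\<Sum>i\<in>UNIV. \<Sum>j\<in>UNIV. b4 i j)"
    using b3(1) b4(1) by (auto intro!: sum_nonneg)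
  have "bounds c Q B"
    unfolding bounds_def
  proof (intro conjI ballI allI)
    show "1 \<le> B" using b1 b2 nn by (simp add: B_def)
    fix x assume x: "x \<in> ?P"
    have w: "0 < wt c x" using wt_pos[OF c] x by blast
    have "1 / wt c x \<le> B" using bspec[OF b2(2) x] b1(1) nn unfolding B_def by linarith
    then show "1 \<le> B * wt c x" using w by (simp add: pos_divide_le_eq)
    show "wt c x \<le> B" using bspec[OF b1(2) x] b2(1) nn unfolding B_def by linarith
    show "\<bar>g c (ichart c x) $ i $ j\<bar> \<le> B" for i j
      using bspec[OF b3(2)[of i j] x] s[of b3 i j, OF b3(1)] b1(1) b2(1) nn unfolding B_def by linarith
    show "\<bar>matrix_inv (g c (ichart c x)) $ i $ j\<bar> \<le> B" for i j
      using bspec[OF b4(2)[of i j] x] s[of b4 i j, OF b4(1)] b1(1) b2(1) nn unfolding B_def by linarith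
  qed
  then show ?thesis by blast
qed

text \<open>Comparison from coordinates to the manifold. \<open>F\<close> must vanish on the part of
  \<open>Q\<close> outside the chart image, which corresponds to no points of \<open>M\<close>; the
  factor \<open>B\<close> inverts the volume density.\<close>

lemma integral_le_chart:
  assumes c: "c \<in> A" and Q: "compact Q" "Q \<subseteq> nbhd c" and B: "bounds c Q B"
    and F: "continuous_on Q F" "\<And>x. x \<in> Q \<Longrightarrow> 0 \<le> F x" "\<And>x. x \<in> Q - img c \<Longrightarrow> F x = 0"
    and f: "integrable \<mu> f" "\<And>p. p \<in> M \<Longrightarrow> 0 \<le> f p" and k: "0 \<le> k"
    and le: "\<And>x. x \<in> img c \<inter> Q \<Longrightarrow> F x \<le> k * f (ichart c x)"
  shows "integral Q F \<le> k * B * (LINT p|\<mu>. f p)"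
proof -
  have [measurable]: "f \<in> borel_measurable \<mu>" using f(1) by simp
  have B1: "1 \<le> B" using B by (simp add: bounds_def)
  have I0: "0 \<le> (LINT p|\<mu>. f p)" by (rule Bochner_Integration.integral_nonneg) (simp add: space_\<mu> f(2))
  have "ennreal (integral Q F) = (\<integral>\<^sup>+x. ennreal (F x) * indicator Q x \<partial>lborel)"
    using nn_integral_eq_HK[OF Q(1) F(1,2)] by simp
  also have "\<dots> \<le> (\<integral>\<^sup>+x. ennreal (k * B * f (ichart c x)) * ennreal (wt c x) * indicator (img c \<inter> Q) x \<partial>lborel)"
  proof (intro nn_integral_mono)
    fix x
    show "ennreal (F x) * indicator Q x \<le> ennreal (k * B * f (ichart c x)) * ennreal (wt c x) * indicator (img c \<inter> Q) x"
    proof (cases "x \<in> img c \<inter> Q")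
      case True
      have f0: "0 \<le> f (ichart c x)" using f(2) ichart_in chartD(4)[OF c] True by blast
      have "F x \<le> k * f (ichart c x) * 1" using le[OF True] by simp
      also have "\<dots> \<le> k * f (ichart c x) * (B * wt c x)"
        using B True k f0 unfolding bounds_def by (intro mult_left_mono) auto
      finally have "F x \<le> k * B * f (ichart c x) * wt c x" by (simp add: mult_ac)
      then show ?thesis
        using True wt_pos[OF c, of x] k f0 B1 by (simp add: ennreal_mult[symmetric] ennreal_leI)
    next
      case False
      then show ?thesis using F(3)[of x] by (auto simp: indicator_def)
    qed
  qed
  also have "\<dots> = (\<integral>\<^sup>+p. ennreal (k * B * f p) * indicator (ichart c ` (img c \<inter> Q)) p \<partial>\<mu>)"
    by (rule nn_integral_chart[symmetric, OF c compact_image_part[OF c Q]]) auto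
  also have "\<dots> \<le> (\<integral>\<^sup>+p. ennreal (k * B * f p) \<partial>\<mu>)"
    by (intro nn_integral_mono) (auto simp: indicator_def)
  also have "\<dots> = ennreal (LINT p|\<mu>. k * B * f p)"
    using f k B1 by (intro nn_integral_eq_integral) (auto simp: space_\<mu>)
  finally have "ennreal (integral Q F) \<le> ennreal (k * B * (LINT p|\<mu>. f p))" by simp
  then show ?thesis using k B1 I0 by (simp add: ennreal_le_iff)
qed

text \<open>The converse comparison, from a piece of the manifold to coordinates. Here the part of
  \<open>Q\<close> outside the image only enlarges the right-hand side, so \<open>F\<close> merely
  has to be nonnegative there.\<close>

lemma nn_integral_le_chart:
  assumes c: "c \<in> A" and Q: "compact Q" "Q \<subseteq> nbhd c" and B: "bounds c Q B"
    and F: "continuous_on Q F" "\<And>x. x \<in> Q \<Longrightarrow> 0 \<le> F x"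
    and f: "f \<in> borel_measurable \<mu>" and k: "0 \<le> k"
    and le: "\<And>x. x \<in> img c \<inter> Q \<Longrightarrow> f (ichart c x) \<le> k * F x"
  shows "(\<integral>\<^sup>+p. ennreal (f p) * indicator (pull c Q) p \<partial>\<mu>) \<le> ennreal (k * B * integral Q F)"
proof -
  have B1: "1 \<le> B" using B by (simp add: bounds_def)
  have Qb: "Q \<in> sets borel" by (rule borel_compact[OF Q(1)])
  have "(\<integral>\<^sup>+p. ennreal (f p) * indicator (pull c Q) p \<partial>\<mu>) =
      (\<integral>\<^sup>+x. ennreal (f (ichart c x)) * ennreal (wt c x) * indicator (img c \<inter> Q) x \<partial>lborel)"
    unfolding pull_eq[OF c] using f by (intro nn_integral_chart[OF c compact_image_part[OF c Q]]) auto
  also have "\<dots> \<le> (\<integral>\<^sup>+x. ennreal (k * B * F x) * indicator Q x \<partial>lborel)"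
  proof (intro nn_integral_mono)
    fix x
    show "ennreal (f (ichart c x)) * ennreal (wt c x) * indicator (img c \<inter> Q) x \<le> ennreal (k * B * F x) * indicator Q x"
    proof (cases "x \<in> img c \<inter> Q")
      case True
      have "ennreal (f (ichart c x)) * ennreal (wt c x) \<le> ennreal (k * F x) * ennreal B"
        using B True unfolding bounds_def by (intro mult_mono ennreal_leI le) auto
      also have "\<dots> = ennreal (k * B * F x)"
        using k F(2)[of x] True B1 by (subst ennreal_mult[symmetric]) (auto simp: mult_ac)
      finally show ?thesis using True by simp
    qed simp
  qed
  also have "\<dots> = ennreal (integral Q (\<lambda>x. k * B * F x))"
    using F k B1 by (intro nn_integral_eq_HK Q continuous_intros) auto
  finally show ?thesis by simp
qed

lemma piece_exists:
  assumes "p \<in> M"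
  obtains c r where "c \<in> A" "p \<in> fst c" "0 < r" "cball (snd c p) r \<subseteq> nbhd c"
proof -
  obtain c where c: "c \<in> A" "p \<in> fst c" using chart_cover[OF assms] by blast
  then have "snd c p \<in> nbhd c" using nbhd(2) by blast
  then obtain r where "0 < r" "cball (snd c p) r \<subseteq> nbhd c"
    using nbhd(1)[OF c(1)] open_contains_cball by blast
  with c that show thesis by blast
qed

text \<open>The open sets \<open>W\<close> feed the compactness of \<open>M\<close>; the property is
  carried by measurable sets \<open>N\<close> around them, which will be preimages of closed balls
  and boxes.\<close>

lemma finite_cover:
  assumes "\<And>p. p \<in> M \<Longrightarrow> \<exists>W N. openin (top_of_set M) W \<and> p \<in> W \<and> W \<subseteq> N \<and> N \<in> sets \<mu> \<and> R N"
  obtains \<N> where "finite \<N>" "\<Union>\<N> = M" "\<And>N. N \<in> \<N> \<Longrightarrow> N \<in> sets \<mu> \<and> R N"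
proof -
  obtain W N where W: "\<And>p. p \<in> M \<Longrightarrow> openin (top_of_set M) (W p) \<and> p \<in> W p \<and> W p \<subseteq> N p \<and> N p \<in> sets \<mu> \<and> R (N p)"
    using assms by metis
  have "\<forall>c\<in>W ` M. openin (top_of_set M) c" "M \<subseteq> \<Union>(W ` M)" using W by blast+
  then obtain D where D: "D \<subseteq> W ` M" "finite D" "M \<subseteq> \<Union>D"
    using compact_M[unfolded compact_eq_openin_cover] by meson
  then obtain T where T: "T \<subseteq> M" "finite T" "D = W ` T" using finite_subset_image by metis
  show thesis
  proof
    show "finite (N ` T)" using T by simp
    show "\<Union>(N ` T) = M"
    proof
      show "\<Union>(N ` T) \<subseteq> M" using W T(1) sets.sets_into_space space_\<mu> by blast
      show "M \<subseteq> \<Union>(N ` T)" using W T D(3) by blast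
    qed
    show "X \<in> sets \<mu> \<and> R X" if "X \<in> N ` T" for X using W T(1) that by blast
  qed
qed

text \<open>Finiteness is a consequence of compactness: on each compact chart piece the volume
  density is bounded.\<close>

lemma finite_volume: "finite_measure \<mu>"
proof -
  have cov: "\<exists>W N. openin (top_of_set M) W \<and> p \<in> W \<and> W \<subseteq> N \<and> N \<in> sets \<mu> \<and> emeasure \<mu> N < top"
    if "p \<in> M" for p
  proof -
    from that obtain c r where c: "c \<in> A" "p \<in> fst c" and r: "0 < r" "cball (snd c p) r \<subseteq> nbhd c"
      using piece_exists by metis
    define Q where "Q = cball (snd c p) r"
    have Q: "compact Q" "Q \<subseteq> nbhd c" using r by (simp_all add: Q_def)
    obtain B where B: "bounds c Q B" using bounds_exist[OF c(1) Q] by blast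
    have "emeasure \<mu> (pull c Q) = (\<integral>\<^sup>+p. ennreal 1 * indicator (pull c Q) p \<partial>\<mu>)"
      using pull_sets[OF c(1) Q] by simp
    also have "\<dots> \<le> ennreal (1 * B * integral Q (\<lambda>x. 1))"
      by (intro nn_integral_le_chart[OF c(1) Q B]) auto
    also have "\<dots> < top" by simp
    finally have "emeasure \<mu> (pull c Q) < top" .
    moreover have "openin (top_of_set M) (pull c (ball (snd c p) r))" by (rule pull_open[OF c(1)]) simp
    moreover have "p \<in> pull c (ball (snd c p) r)" "pull c (ball (snd c p) r) \<subseteq> pull c Q"
      using c(2) r(1) by (auto simp: pull_def Q_def)
    ultimately show ?thesis
      using pull_sets[OF c(1) Q] by blast
  qed
  obtain \<N> where N: "finite \<N>" "\<Union>\<N> = M" "\<And>N. N \<in> \<N> \<Longrightarrow> N \<in> sets \<mu> \<and> emeasure \<mu> N < top"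
    using finite_cover[of "\<lambda>N. emeasure \<mu> N < top", OF cov] by metis
  have "\<N> \<subseteq> sets \<mu>" using N by blast
  then have "emeasure \<mu> M \<le> (\<Sum>N\<in>\<N>. emeasure \<mu> N)"
    unfolding N(2)[symmetric] using emeasure_subadditive_finite[of \<N> "\<lambda>x. x" \<mu>] N by (simp add: image_subset_iff)
  also have "\<dots> < top" using N by simp
  finally show ?thesis by (intro finite_measureI) (simp add: space_\<mu>)
qed

lemma integrable_continuous_\<mu>:
  fixes f :: "'a \<Rightarrow> 'b::{banach, second_countable_topology}"
  assumes "continuous_on M f"
  shows "integrable \<mu> f"
proof -
  interpret finite_measure \<mu> by (rule finite_volume)
  obtain B where "\<forall>x\<in>M. norm (f x) \<le> B"
    using compact_imp_bounded[OF compact_continuous_image[OF assms compact_M]] unfolding bounded_iff by blast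
  then show ?thesis
    by (intro integrable_const_bound[where B=B] measurable_continuous_\<mu> assms AE_I2) (simp add: space_\<mu>)
qed

section \<open>The energy form on test functions\<close>

abbreviation E where "E \<equiv> test_E_inner A g \<mu>"

lemma V_L2: "V \<subseteq> L2 \<mu>"
proof
  fix u assume "u \<in> V"
  then have u: "continuous_on M u" by (rule test_function_continuous)
  have "integrable \<mu> (\<lambda>p. (cmod (u p))\<^sup>2)" by (intro integrable_continuous_\<mu> continuous_intros u)
  then show "u \<in> L2 \<mu>" using measurable_continuous_\<mu>[OF u] by (simp add: L2_def)
qed

lemma dual_product_cnj:
  assumes "c \<in> A" "v \<in> V" "p \<in> fst c"
  shows "dual_product c u (\<lambda>q. cnj (v q)) p = (\<Sum>i\<in>UNIV. \<Sum>j\<in>UNIV. of_real (matrix_inv (g c p) $ i $ j) *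
     pd (lift c u) i (snd c p) * cnj (pd (lift c v) j (snd c p)))"
proof -
  have "snd c p \<in> nbhd c" using nbhd(2) assms(1,3) by blast
  then show ?thesis unfolding dual_product_def by (simp add: pd_lift_cnj[OF assms(1,2)])
qed

definition edens :: "('a \<Rightarrow> complex) \<Rightarrow> 'a \<Rightarrow> real" where
  "edens u p = Re (grad_product A g u (\<lambda>q. cnj (u q)) p)"

lemma edens_eq:
  assumes "c \<in> A" "u \<in> V" "p \<in> fst c"
  shows "edens u p = Re (\<Sum>i\<in>UNIV. \<Sum>j\<in>UNIV. of_real (matrix_inv (g c p) $ i $ j) *
     pd (lift c u) i (snd c p) * cnj (pd (lift c u) j (snd c p)))"
  unfolding edens_def grad_product_eq[OF assms(1,2) test_functions_cnj[OF assms(2)] assms(3)]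
    dual_product_cnj[OF assms(1,2,3)] ..

lemma edens_nonneg:
  assumes "u \<in> V" "p \<in> M"
  shows "0 \<le> edens u p"
proof -
  obtain c where c: "c \<in> A" "p \<in> fst c" using chart_cover[OF assms(2)] by blast
  show ?thesis unfolding edens_eq[OF c(1) assms(1) c(2)] by (rule spd_quadratic_nonneg[OF metric_spd[OF c]])
qed

lemma edens_continuous: "u \<in> V \<Longrightarrow> continuous_on M (edens u)"
  unfolding edens_def by (intro continuous_intros grad_product_continuous test_functions_cnj)

lemma E_self: "u \<in> V \<Longrightarrow> Re (E u u) = (LINT p|\<mu>. edens u p)"
  unfolding test_E_inner_def edens_def
  by (intro integral_Re[symmetric] integrable_continuous_\<mu> grad_product_continuous test_functions_cnj)

lemma E_semi_inner: "semi_inner V E"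
proof
  fix u v w a b assume u: "u \<in> V" and v: "v \<in> V"
  show uv: "(\<lambda>p. a * u p + b * v p) \<in> V" by (rule test_functions_lincomb[OF u v])
  show "E v u = cnj (E u v)"
    unfolding test_E_inner_def Bochner_Integration.integral_cnj[symmetric]
  proof (intro Bochner_Integration.integral_cong refl)
    fix p assume "p \<in> space \<mu>"
    then obtain c where c: "c \<in> A" "p \<in> fst c" using chart_cover space_\<mu> by blast
    define H where "H = matrix_inv (g c p)"
    have sym: "H $ i $ j = H $ j $ i" for i j
    proof -
      have "H $ i $ j = transpose H $ j $ i" by (simp add: transpose_def)
      then show ?thesis unfolding H_def using spd_inv_sym[OF metric_spd[OF c]] by simp
    qed
    have "cnj (\<Sum>i\<in>UNIV. \<Sum>j\<in>UNIV. of_real (H $ i $ j) * pd (lift c u) i (snd c p) * cnj (pd (lift c v) j (snd c p))) =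
        (\<Sum>i\<in>UNIV. \<Sum>j\<in>UNIV. of_real (H $ i $ j) * cnj (pd (lift c u) i (snd c p)) * pd (lift c v) j (snd c p))"
      by simp
    also have "\<dots> = (\<Sum>j\<in>UNIV. \<Sum>i\<in>UNIV. of_real (H $ i $ j) * cnj (pd (lift c u) i (snd c p)) * pd (lift c v) j (snd c p))"
      by (rule sum.swap)
    also have "\<dots> = (\<Sum>j\<in>UNIV. \<Sum>i\<in>UNIV. of_real (H $ j $ i) * pd (lift c v) j (snd c p) * cnj (pd (lift c u) i (snd c p)))"
      by (intro sum.cong refl) (simp add: sym mult_ac)
    finally show "grad_product A g v (\<lambda>q. cnj (u q)) p = cnj (grad_product A g u (\<lambda>q. cnj (v q)) p)"
      by (simp only: grad_product_eq[OF c(1) _ test_functions_cnj c(2)] u v dual_product_cnj[OF c(1) _ c(2)] H_def)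
  qed
  assume w: "w \<in> V"
  have "E (\<lambda>p. a * u p + b * v p) w = (LINT p|\<mu>. a * grad_product A g u (\<lambda>q. cnj (w q)) p + b * grad_product A g v (\<lambda>q. cnj (w q)) p)"
    unfolding test_E_inner_def
  proof (intro Bochner_Integration.integral_cong refl)
    fix p assume "p \<in> space \<mu>"
    then obtain c where c: "c \<in> A" "p \<in> fst c" using chart_cover space_\<mu> by blast
    have x: "snd c p \<in> nbhd c" using nbhd(2) c by blast
    show "grad_product A g (\<lambda>p. a * u p + b * v p) (\<lambda>q. cnj (w q)) p =
        a * grad_product A g u (\<lambda>q. cnj (w q)) p + b * grad_product A g v (\<lambda>q. cnj (w q)) p"
      by (simp add: grad_product_eq[OF c(1) _ test_functions_cnj[OF w] c(2)] u v uv dual_product_def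
          pd_lift_lincomb[OF c(1) u v x] sum_distrib_left sum.distrib[symmetric] algebra_simps)
  qed
  also have "\<dots> = a * E u w + b * E v w"
  proof -
    have "integrable \<mu> (grad_product A g u (\<lambda>q. cnj (w q)))" "integrable \<mu> (grad_product A g v (\<lambda>q. cnj (w q)))"
      by (intro integrable_continuous_\<mu> grad_product_continuous test_functions_cnj u v w)+
    then show ?thesis unfolding test_E_inner_def by simp
  qed
  finally show "E (\<lambda>p. a * u p + b * v p) w = a * E u w + b * E v w" .
next
  fix u assume u: "u \<in> V"
  show "0 \<le> Re (E u u)"
    unfolding E_self[OF u] by (rule Bochner_Integration.integral_nonneg) (simp add: edens_nonneg u space_\<mu>)
qed

end

sublocale compact_riemannian \<subseteq> E: semi_inner V E
  by (rule E_semi_inner)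

context compact_riemannian
begin

lemma lift_outside:
  assumes c: "c \<in> A" and u: "u \<in> V" and x: "x \<in> nbhd c - img c"
  shows "lift c u x = 0" "gsq (lift c u) x = 0"
proof -
  show "lift c u x = 0" using x by (simp add: lift_def)
  have "pd (lift c u) i x = 0" for i using pd_lift_zero[OF c u, of x i] x by blast
  then show "gsq (lift c u) x = 0" by (simp add: gsq_def)
qed

lemma lift_continuous: "c \<in> A \<Longrightarrow> u \<in> V \<Longrightarrow> Q \<subseteq> nbhd c \<Longrightarrow> continuous_on Q (lift c u)"
  using C1_onD(2)[OF nbhd(1) lift_C1] continuous_on_subset by blast

lemma gsq_lift_continuous: "c \<in> A \<Longrightarrow> u \<in> V \<Longrightarrow> Q \<subseteq> nbhd c \<Longrightarrow> continuous_on Q (gsq (lift c u))"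
  by (rule continuous_on_gsq[OF nbhd(1) lift_C1])

context
  fixes c Q B
  assumes c: "c \<in> A" and Q: "compact Q" "Q \<subseteq> nbhd c" and B: "bounds c Q B"
begin

lemma B_ge_1: "1 \<le> B"
  using B by (simp add: bounds_def)

lemma lift_L2_le:
  assumes u: "u \<in> V"
  shows "integral Q (\<lambda>x. (cmod (lift c u x))\<^sup>2) \<le> B * (L2_norm \<mu> u)\<^sup>2"
proof -
  have "integral Q (\<lambda>x. (cmod (lift c u x))\<^sup>2) \<le> 1 * B * (LINT p|\<mu>. (cmod (u p))\<^sup>2)"
  proof (rule integral_le_chart[OF c Q B])
    show "integrable \<mu> (\<lambda>p. (cmod (u p))\<^sup>2)" using V_L2 u by (auto simp: L2_def)
  qed (use lift_continuous[OF c u Q(2)] lift_outside[OF c u] Q(2) in \<open>auto simp: lift_def intro!: continuous_intros\<close>)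
  also have "(LINT p|\<mu>. (cmod (u p))\<^sup>2) = (L2_norm \<mu> u)\<^sup>2"
    using L2.nrm_sq[OF subsetD[OF V_L2 u]] by (simp add: L2_inner_self L2_nrm)
  finally show ?thesis by simp
qed

text \<open>Ellipticity: the bound on the metric entries yields the lower bound
  \<open>spd_quadratic_lower\<close> on the inverse metric with factor \<open>n * n * B\<close>; the
  second \<open>B\<close> pays for the volume density.\<close>

lemma lift_gsq_le:
  assumes u: "u \<in> V"
  shows "integral Q (gsq (lift c u)) \<le> real (CARD('n)) * real (CARD('n)) * B * B * Re (E u u)"
proof -
  have "integral Q (gsq (lift c u)) \<le> (real (CARD('n)) * real (CARD('n)) * B) * B * (LINT p|\<mu>. edens u p)"
  proof (rule integral_le_chart[OF c Q B])
    show "integrable \<mu> (edens u)" by (intro integrable_continuous_\<mu> edens_continuous u)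
    show "continuous_on Q (gsq (lift c u))" by (rule gsq_lift_continuous[OF c u Q(2)])
    show "gsq (lift c u) x = 0" if "x \<in> Q - img c" for x using lift_outside(2)[OF c u] Q(2) that by blast
    show "gsq (lift c u) x \<le> real (CARD('n)) * real (CARD('n)) * B * edens u (ichart c x)" if x: "x \<in> img c \<inter> Q" for x
    proof -
      have p: "ichart c x \<in> fst c" using ichart_in x by blast
      have sx: "snd c (ichart c x) = x" using chart_ichart[OF c] x by blast
      have "\<bar>g c (ichart c x) $ i $ j\<bar> \<le> B" for i j using B x unfolding bounds_def by blast
      then show ?thesis
        using spd_quadratic_lower[OF metric_spd[OF c p], of B "\<lambda>i. pd (lift c u) i x"] B_ge_1
        unfolding edens_eq[OF c u p] sx gsq_def by simp
    qed
  qed (use B_ge_1 edens_nonneg[OF u] gsq_nonneg in auto)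
  then show ?thesis by (simp add: E_self[OF u])
qed

lemma nn_L2_le_lift:
  assumes u: "u \<in> V"
  shows "(\<integral>\<^sup>+p. ennreal ((cmod (u p))\<^sup>2) * indicator (pull c Q) p \<partial>\<mu>) \<le> ennreal (B * integral Q (\<lambda>x. (cmod (lift c u x))\<^sup>2))"
proof -
  have "(\<integral>\<^sup>+p. ennreal ((cmod (u p))\<^sup>2) * indicator (pull c Q) p \<partial>\<mu>) \<le> ennreal (1 * B * integral Q (\<lambda>x. (cmod (lift c u x))\<^sup>2))"
  proof (rule nn_integral_le_chart[OF c Q B])
    show "(\<lambda>p. (cmod (u p))\<^sup>2) \<in> borel_measurable \<mu>"
      by (intro measurable_continuous_\<mu> continuous_intros test_function_continuous u)
  qed (use lift_continuous[OF c u Q(2)] in \<open>auto simp: lift_def intro!: continuous_intros\<close>)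
  then show ?thesis by simp
qed

text \<open>One factor \<open>B\<close> bounds the entries of the inverse metric, the dimension
  comes from summing them, and the other \<open>B\<close> bounds the volume density.\<close>

lemma nn_edens_le_lift:
  assumes u: "u \<in> V"
  shows "(\<integral>\<^sup>+p. ennreal (edens u p) * indicator (pull c Q) p \<partial>\<mu>) \<le>
    ennreal (B * real (CARD('n)) * B * integral Q (gsq (lift c u)))"
proof (rule nn_integral_le_chart[OF c Q B])
  show "edens u \<in> borel_measurable \<mu>" by (intro measurable_continuous_\<mu> edens_continuous u)
  show "continuous_on Q (gsq (lift c u))" by (rule gsq_lift_continuous[OF c u Q(2)])
  show "edens u (ichart c x) \<le> B * real (CARD('n)) * gsq (lift c u) x" if x: "x \<in> img c \<inter> Q" for x
  proof -
    have p: "ichart c x \<in> fst c" using ichart_in x by blast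
    have sx: "snd c (ichart c x) = x" using chart_ichart[OF c] x by blast
    have "\<bar>matrix_inv (g c (ichart c x)) $ i $ j\<bar> \<le> B" for i j using B x unfolding bounds_def by blast
    then show ?thesis
      using quadratic_form_upper[of "matrix_inv (g c (ichart c x))" B "\<lambda>i. pd (lift c u) i x"]
      unfolding edens_eq[OF c u p] sx gsq_def by simp
  qed
qed (use B_ge_1 gsq_nonneg in auto)

end

end

subsection \<open>The energy form of the manifold\<close>

lemma finite_rank_on_Union:
  assumes V: "V \<subseteq> L2 M" and E: "\<And>u. u \<in> V \<Longrightarrow> 0 \<le> Re (E u u)"
    and fin: "finite \<N>" and N: "\<And>N. N \<in> \<N> \<Longrightarrow> N \<in> sets M \<and> finite_rank_on M V E N"
  shows "finite_rank_on M V E (\<Union>\<N>)"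
proof -
  have "finite_rank_on M V E (\<Union>\<N>) \<and> \<Union>\<N> \<in> sets M"
    using fin N
  proof (induction \<N> rule: finite_induct)
    case empty
    then show ?case using finite_rank_on_empty[of V E M] E by simp
  next
    case (insert X \<N>)
    have "X \<in> sets M \<and> finite_rank_on M V E X" using insert.prems by blast
    moreover have "finite_rank_on M V E (\<Union>\<N>) \<and> \<Union>\<N> \<in> sets M" using insert.IH insert.prems by blast
    ultimately have "finite_rank_on M V E (X \<union> \<Union>\<N>) \<and> X \<union> \<Union>\<N> \<in> sets M"
      by (intro conjI finite_rank_on_Un[of V M E X "\<Union>\<N>"] V E sets.Un) blast+
    then show ?case by simp
  qed
  then show ?thesis ..
qed

context compact_riemannian
begin

text \<open>The averages of the lift over the cells of the box become functionals on
  \<open>M\<close>. They are bounded in \<open>L2\<close> of \<open>M\<close> because the lift of a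
  test function is controlled by the function itself, also on cells that cross the boundary.\<close>

lemma finite_rank_chart_box:
  assumes c: "c \<in> A" and Q: "cbox a b \<subseteq> nbhd c"
  shows "finite_rank_on \<mu> V E (pull c (cbox a b))"
  unfolding finite_rank_on_def
proof (intro allI impI)
  fix \<epsilon> :: real assume e: "0 < \<epsilon>"
  let ?Q = "cbox a b"
  obtain B where B: "bounds c ?Q B" using bounds_exist[OF c compact_cbox Q] by blast
  note est = c compact_cbox Q B
  have B1: "1 \<le> B" by (rule B_ge_1[OF est])
  \<comment> \<open>The total loss in passing to coordinates and back; the box estimate is therefore
    used with \<open>\<epsilon> / K\<close>.\<close>
  define K where "K = B * (real (CARD('n)) * real (CARD('n)) * B * B)"
  have K: "0 < K" unfolding K_def using B1 by (intro mult_pos_pos) auto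
  then have eK: "0 < \<epsilon> / K" using e by simp
  obtain P :: "((real ^ 'n) \<times> (real ^ 'n) set) set" where P: "finite P" "\<And>x X. (x, X) \<in> P \<Longrightarrow> compact X \<and> X \<subseteq> ?Q \<and> 0 < measure lborel X"
    and Pest: "\<And>u. Ck_on 1 (nbhd c) u \<Longrightarrow> integral ?Q (\<lambda>x. (cmod (u x))\<^sup>2) \<le>
        (\<Sum>(x, X)\<in>P. (cmod (integral X u))\<^sup>2 / measure lborel X) + \<epsilon> / K * integral ?Q (gsq u)"
    using box_compactness[OF nbhd(1)[OF c] Q eK] by blast
  define \<Phi> where "\<Phi> = (\<lambda>(x, X) u. integral X (lift c u)) ` P"
  define C where "C = (\<Sum>(x, X)\<in>P. 1 / measure lborel X)"
  have C: "0 \<le> C" unfolding C_def by (intro sum_nonneg) auto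
  have fin: "finite \<Phi>" unfolding \<Phi>_def using P(1) by simp
  have cont: "continuous_on X (lift c u)" if "(x, X) \<in> P" "u \<in> V" for x X u
    using lift_continuous[OF c that(2)] P(2)[OF that(1)] Q by blast
  have "rank_estimate \<mu> V E (pull c ?Q) \<epsilon> \<Phi> (B * C)"
    unfolding rank_estimate_def
  proof (intro conjI ballI fin)
    show "0 \<le> B * C" using B1 C by simp
  next
    fix L assume "L \<in> \<Phi>"
    then obtain x X where X: "(x, X) \<in> P" and L: "L = (\<lambda>u. integral X (lift c u))" by (auto simp: \<Phi>_def)
    have cX: "compact X" "X \<subseteq> ?Q" using P(2)[OF X] by blast+
    show "L (\<lambda>p. u p - v p) = L u - L v" if "u \<in> V" "v \<in> V" for u v
      unfolding L lift_diff
      by (intro Henstock_Kurzweil_Integration.integral_diff integral_restrict_eq(2) cX cont[OF X] that)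
    define R where "R = restrict_space lborel X"
    interpret R: finite_measure R unfolding R_def by (rule finite_measure_compact[OF cX(1)])
    have "cmod (L u) \<le> (sqrt B * sqrt (measure R (space R))) * L2_norm \<mu> u" if u: "u \<in> V" for u
    proof -
      have wL: "lift c u \<in> L2 R" unfolding R_def by (rule continuous_L2[OF cX(1) cont[OF X u]])
      have "cmod (L u) = cmod (LINT x|R. lift c u x)"
        unfolding L R_def by (simp add: integral_restrict_eq(1)[OF cX(1) cont[OF X u]])
      also have "\<dots> \<le> (LINT x|R. cmod (lift c u x))" by (rule integral_norm_bound)
      also have "\<dots> \<le> L2_norm R (lift c u) * sqrt (measure R (space R))" by (rule R.L2_integrable(2)[OF wL])
      also have "L2_norm R (lift c u) \<le> sqrt B * L2_norm \<mu> u"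
      proof (rule power2_le_imp_le)
        have "(L2_norm R (lift c u))\<^sup>2 = integral X (\<lambda>x. (cmod (lift c u x))\<^sup>2)"
          unfolding R_def by (rule L2_norm_sq_eq_integral[OF cX(1) cont[OF X u]])
        also have "\<dots> \<le> integral ?Q (\<lambda>x. (cmod (lift c u x))\<^sup>2)"
          by (intro integral_subset_le cX integral_restrict_eq(2) continuous_intros compact_cbox cont[OF X u] lift_continuous[OF c u Q]) simp
        also have "\<dots> \<le> B * (L2_norm \<mu> u)\<^sup>2" by (rule lift_L2_le[OF est u])
        finally show "(L2_norm R (lift c u))\<^sup>2 \<le> (sqrt B * L2_norm \<mu> u)\<^sup>2"
          using B1 by (simp add: power_mult_distrib)
        show "0 \<le> sqrt B * L2_norm \<mu> u" using B1 by (simp add: L2_norm_def L2_inner_self)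
      qed
      then have "L2_norm R (lift c u) * sqrt (measure R (space R)) \<le> sqrt B * L2_norm \<mu> u * sqrt (measure R (space R))"
        by (intro mult_right_mono) auto
      finally show ?thesis by (simp add: mult_ac)
    qed
    then show "\<exists>b. \<forall>u\<in>V. cmod (L u) \<le> b * L2_norm \<mu> u" by blast
  next
    fix u assume u: "u \<in> V"
    define s where "s = (\<Sum>L\<in>\<Phi>. (cmod (L u))\<^sup>2)"
    \<comment> \<open>\<open>\<Phi>\<close> is a set, so different cells may give the same
      functional. Each summand is compared with the whole sum \<open>s\<close>, and the weights are
      collected in \<open>C\<close>.\<close>
    have "(\<Sum>(x, X)\<in>P. (cmod (integral X (lift c u)))\<^sup>2 / measure lborel X) \<le> (\<Sum>(x, X)\<in>P. s * (1 / measure lborel X))"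
    proof (intro sum_mono, clarify)
      fix x X assume X: "(x, X) \<in> P"
      have "(\<lambda>u. integral X (lift c u)) \<in> \<Phi>" unfolding \<Phi>_def using X by force
      then have "(cmod (integral X (lift c u)))\<^sup>2 \<le> s"
        unfolding s_def using member_le_sum[of "\<lambda>u. integral X (lift c u)" \<Phi> "\<lambda>L. (cmod (L u))\<^sup>2"] fin by simp
      then show "(cmod (integral X (lift c u)))\<^sup>2 / measure lborel X \<le> s * (1 / measure lborel X)"
        by (simp add: divide_right_mono)
    qed
    also have "\<dots> = s * C" unfolding C_def by (simp add: sum_distrib_left case_prod_unfold)
    finally have 1: "(\<Sum>(x, X)\<in>P. (cmod (integral X (lift c u)))\<^sup>2 / measure lborel X) \<le> s * C" .
    have "\<epsilon> / K * integral ?Q (gsq (lift c u)) \<le> \<epsilon> / K * (real (CARD('n)) * real (CARD('n)) * B * B * Re (E u u))"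
      using e K by (intro mult_left_mono lift_gsq_le[OF est u]) auto
    with 1 Pest[OF lift_C1[OF c u]] have "integral ?Q (\<lambda>x. (cmod (lift c u x))\<^sup>2) \<le>
        s * C + \<epsilon> / K * (real (CARD('n)) * real (CARD('n)) * B * B * Re (E u u))" by linarith
    then have "B * integral ?Q (\<lambda>x. (cmod (lift c u x))\<^sup>2) \<le>
        B * (s * C + \<epsilon> / K * (real (CARD('n)) * real (CARD('n)) * B * B * Re (E u u)))"
      using B1 by (intro mult_left_mono) auto
    also have "\<dots> = B * C * s + (\<epsilon> / K * K) * Re (E u u)"
      unfolding K_def by (simp add: algebra_simps)
    also have "\<epsilon> / K * K = \<epsilon>" using K by simp
    finally have "ennreal (B * integral ?Q (\<lambda>x. (cmod (lift c u x))\<^sup>2)) \<le> ennreal (B * C * s + \<epsilon> * Re (E u u))"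
      by (rule ennreal_leI)
    then show "(\<integral>\<^sup>+p. ennreal ((cmod (u p))\<^sup>2) * indicator (pull c ?Q) p \<partial>\<mu>) \<le>
        ennreal (B * C * (\<Sum>L\<in>\<Phi>. (cmod (L u))\<^sup>2) + \<epsilon> * Re (E u u))"
      using nn_L2_le_lift[OF est u] unfolding s_def by (rule order_trans[rotated])
  qed
  then show "\<exists>\<Phi> c'. rank_estimate \<mu> V E (pull c ?Q) \<epsilon> \<Phi> c'" by blast
qed

lemma finite_rank_M: "finite_rank_on \<mu> V E (space \<mu>)"
proof -
  have cov: "\<exists>W N. openin (top_of_set M) W \<and> p \<in> W \<and> W \<subseteq> N \<and> N \<in> sets \<mu> \<and> finite_rank_on \<mu> V E N"
    if pM: "p \<in> M" for p
  proof -
    obtain c where c: "c \<in> A" "p \<in> fst c" using chart_cover[OF pM] by blast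
    then have "snd c p \<in> nbhd c" using nbhd(2) by blast
    then obtain a b where ab: "cbox a b \<subseteq> nbhd c" "snd c p \<in> box a b"
      using open_contains_cbox[OF nbhd(1)[OF c(1)]] by metis
    have "pull c (box a b) \<subseteq> pull c (cbox a b)" using box_subset_cbox unfolding pull_def by blast
    moreover have "p \<in> pull c (box a b)" using c ab by (simp add: pull_def)
    moreover have "openin (top_of_set M) (pull c (box a b))" by (rule pull_open[OF c(1) open_box])
    ultimately show ?thesis
      using pull_sets[OF c(1) compact_cbox ab(1)] finite_rank_chart_box[OF c(1) ab(1)] by blast
  qed
  obtain \<N> where N: "finite \<N>" "\<Union>\<N> = M" "\<And>N. N \<in> \<N> \<Longrightarrow> N \<in> sets \<mu> \<and> finite_rank_on \<mu> V E N"
    using finite_cover[of "finite_rank_on \<mu> V E", OF cov] by metis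
  have "finite_rank_on \<mu> V E (\<Union>\<N>)"
    by (rule finite_rank_on_Union[OF V_L2 E.nonneg N(1,3)])
  then show ?thesis unfolding N(2) space_\<mu> .
qed

text \<open>Closability localized in its conclusion only: the hypotheses on the sequence stay
  global, so finitely many pieces can simply be added.\<close>

definition energy_vanishes_on :: "'a set \<Rightarrow> bool" where
  "energy_vanishes_on N \<longleftrightarrow> (\<forall>\<phi>. (\<forall>n. \<phi> n \<in> V) \<longrightarrow> E.nCauchy \<phi> \<longrightarrow> (\<lambda>n. L2_norm \<mu> (\<phi> n)) \<longlonglongrightarrow> 0 \<longrightarrow>
     (\<lambda>n. \<integral>\<^sup>+p. ennreal (edens (\<phi> n) p) * indicator N p \<partial>\<mu>) \<longlonglongrightarrow> 0)"

lemma gsq_integral_eq: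
  assumes "compact Q" "\<And>i. continuous_on Q (pd u i)"
  shows "integral Q (gsq u) = (\<Sum>i\<in>UNIV. (L2_norm (restrict_space lborel Q) (pd u i))\<^sup>2)"
proof -
  have "integral Q (gsq u) = (\<Sum>i\<in>UNIV. integral Q (\<lambda>x. (cmod (pd u i x))\<^sup>2))"
    unfolding gsq_def by (intro Henstock_Kurzweil_Integration.integral_sum integral_restrict_eq(2) assms continuous_intros) simp
  then show ?thesis by (simp add: L2_norm_sq_eq_integral[OF assms(1,2)])
qed

text \<open>Global energy and \<open>L2\<close> norms control the gradient and the values of the
  lifts on the ball; Euclidean closability then gives vanishing on the half ball, and the energy
  density there is bounded by the coordinate gradient.\<close>

lemma energy_vanishes_chart_ball:
  assumes c: "c \<in> A" and r: "0 < r" and Q: "cball x0 r \<subseteq> nbhd c"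
  shows "energy_vanishes_on (pull c (cball x0 (r / 2)))"
  unfolding energy_vanishes_on_def
proof (intro allI impI)
  fix \<phi> assume \<phi>: "\<forall>n. \<phi> n \<in> V" and EC: "E.nCauchy \<phi>" and lim: "(\<lambda>n. L2_norm \<mu> (\<phi> n)) \<longlonglongrightarrow> 0"
  let ?Q = "cball x0 r" and ?Q' = "cball x0 (r / 2)"
  have sub: "?Q' \<subseteq> ?Q" using r by auto
  have Q': "?Q' \<subseteq> nbhd c" using sub Q by blast
  obtain B where B: "bounds c ?Q B" using bounds_exist[OF c compact_cball Q] by blast
  have B': "bounds c ?Q' B" using B sub unfolding bounds_def by blast
  note est = c compact_cball Q B
  have B1: "1 \<le> B" by (rule B_ge_1[OF est])
  define u where "u n = lift c (\<phi> n)" for n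
  have u2: "Ck_on 2 (nbhd c) (u n)" for n unfolding u_def by (rule lift_Ck[OF c]) (use \<phi> in blast)
  define R where "R = restrict_space lborel ?Q"
  have pc: "continuous_on X (pd (lift c v) i)" if "X \<subseteq> nbhd c" "v \<in> V" for X v i
    using C1_onD(3)[OF nbhd(1)[OF c] lift_C1[OF c that(2)]] that(1) by (rule continuous_on_subset)
  have grad: "(\<lambda>n. L2_norm (restrict_space lborel ?Q') (pd (u n) i)) \<longlonglongrightarrow> 0" for i
  proof (rule gradient_closable_ball[OF nbhd(1)[OF c] Q r u2])
    show "L2.nCauchy (restrict_space lborel ?Q) (\<lambda>n. pd (u n) i)"
      unfolding L2.nCauchy_def R_def[symmetric]
    proof (intro allI impI)
      fix e :: real assume e: "0 < e"
      \<comment> \<open>The square root of the constant in \<open>lift_gsq_le\<close>: each partial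
        derivative of a lift has norm at most \<open>K\<close> times the energy norm.\<close>
      define K where "K = sqrt (real (CARD('n)) * real (CARD('n)) * B * B)"
      have K: "0 < K" unfolding K_def using B1 by simp
      then have "0 < e / K" using e by simp
      then obtain N where N: "\<forall>m\<ge>N. \<forall>n\<ge>N. E.nrm (\<lambda>p. \<phi> m p - \<phi> n p) < e / K"
        using EC unfolding E.nCauchy_def by blast
      have "L2.nrm R (\<lambda>p. pd (u m) i p - pd (u n) i p) < e" if mn: "m \<ge> N" "n \<ge> N" for m n
      proof -
        let ?d = "\<lambda>p. \<phi> m p - \<phi> n p"
        have d: "?d \<in> V" by (intro E.diff_closed) (use \<phi> in blast)+
        have cm: "continuous_on ?Q (\<lambda>x. pd (u m) i x - pd (u n) i x)"
          unfolding u_def by (intro continuous_intros pc[OF Q]) (use \<phi> in blast)+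
        have "(L2_norm R (\<lambda>x. pd (u m) i x - pd (u n) i x))\<^sup>2 = integral ?Q (\<lambda>x. (cmod (pd (u m) i x - pd (u n) i x))\<^sup>2)"
          unfolding R_def by (rule L2_norm_sq_eq_integral[OF compact_cball cm])
        also have "\<dots> \<le> integral ?Q (gsq (lift c ?d))"
        proof (rule integral_le)
          show "(\<lambda>x. (cmod (pd (u m) i x - pd (u n) i x))\<^sup>2) integrable_on ?Q"
            by (intro integral_restrict_eq(2) compact_cball continuous_intros cm)
          show "gsq (lift c ?d) integrable_on ?Q"
            by (intro integral_restrict_eq(2) compact_cball gsq_lift_continuous[OF c d Q])
          fix x assume "x \<in> ?Q"
          then have "pd (u m) i x - pd (u n) i x = pd (lift c ?d) i x"
            unfolding u_def using \<phi> Q by (subst pd_lift_diff[OF c]) auto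
          then show "(cmod (pd (u m) i x - pd (u n) i x))\<^sup>2 \<le> gsq (lift c ?d) x"
            unfolding gsq_def using member_le_sum[of i UNIV "\<lambda>i. (cmod (pd (lift c ?d) i x))\<^sup>2"] by simp
        qed
        also have "\<dots> \<le> real (CARD('n)) * real (CARD('n)) * B * B * Re (E ?d ?d)" by (rule lift_gsq_le[OF est d])
        also have "\<dots> = (K * E.nrm ?d)\<^sup>2"
          unfolding K_def using B1 E.nrm_sq[OF d] by (simp add: power_mult_distrib)
        finally have "L2_norm R (\<lambda>x. pd (u m) i x - pd (u n) i x) \<le> K * E.nrm ?d"
          by (rule power2_le_imp_le) (use K E.nrm_nonneg[OF d] in simp)
        also have "\<dots> < K * (e / K)" using N mn K by (intro mult_strict_left_mono) blast+
        finally show ?thesis using K by (simp add: L2_nrm)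
      qed
      then show "\<exists>N. \<forall>m\<ge>N. \<forall>n\<ge>N. L2.nrm R (\<lambda>p. pd (u m) i p - pd (u n) i p) < e" by blast
    qed
    show "(\<lambda>n. L2_norm (restrict_space lborel ?Q) (u n)) \<longlonglongrightarrow> 0"
    proof (rule Lim_null_comparison[OF always_eventually])
      show "(\<lambda>n. sqrt B * L2_norm \<mu> (\<phi> n)) \<longlonglongrightarrow> 0" using tendsto_mult_left[OF lim, of "sqrt B"] by simp
      show "\<forall>n. norm (L2_norm (restrict_space lborel ?Q) (u n)) \<le> sqrt B * L2_norm \<mu> (\<phi> n)"
      proof
        fix n
        have \<phi>n: "\<phi> n \<in> V" using \<phi> by blast
        have "L2_norm (restrict_space lborel ?Q) (u n) \<le> sqrt B * L2_norm \<mu> (\<phi> n)"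
        proof (rule power2_le_imp_le)
          show "(L2_norm (restrict_space lborel ?Q) (u n))\<^sup>2 \<le> (sqrt B * L2_norm \<mu> (\<phi> n))\<^sup>2"
            using lift_L2_le[OF est \<phi>n] L2_norm_sq_eq_integral[OF compact_cball lift_continuous[OF c \<phi>n Q]] B1
            by (simp add: power_mult_distrib u_def)
          show "0 \<le> sqrt B * L2_norm \<mu> (\<phi> n)" using B1 by (simp add: L2_norm_def L2_inner_self)
        qed
        moreover have "0 \<le> L2_norm (restrict_space lborel ?Q) (u n)" by (simp add: L2_norm_def L2_inner_self)
        ultimately show "norm (L2_norm (restrict_space lborel ?Q) (u n)) \<le> sqrt B * L2_norm \<mu> (\<phi> n)" by simp
      qed
    qed
  qed
  have "(\<lambda>n. \<Sum>i\<in>UNIV. (L2_norm (restrict_space lborel ?Q') (pd (u n) i))\<^sup>2) \<longlonglongrightarrow> (\<Sum>i\<in>(UNIV :: 'n set). 0\<^sup>2)"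
    by (intro tendsto_sum tendsto_power grad)
  moreover have "integral ?Q' (gsq (u n)) = (\<Sum>i\<in>UNIV. (L2_norm (restrict_space lborel ?Q') (pd (u n) i))\<^sup>2)" for n
    unfolding u_def using \<phi> by (intro gsq_integral_eq compact_cball pc[OF Q']) blast
  ultimately have "(\<lambda>n. integral ?Q' (gsq (u n))) \<longlonglongrightarrow> 0" by simp
  then have "(\<lambda>n. B * real (CARD('n)) * B * integral ?Q' (gsq (u n))) \<longlonglongrightarrow> B * real (CARD('n)) * B * 0"
    by (intro tendsto_mult_left)
  then have "(\<lambda>n. ennreal (B * real (CARD('n)) * B * integral ?Q' (gsq (u n)))) \<longlonglongrightarrow> ennreal 0"
    by (intro tendsto_ennrealI) simp
  then have up: "(\<lambda>n. ennreal (B * real (CARD('n)) * B * integral ?Q' (gsq (u n)))) \<longlonglongrightarrow> 0" by simp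
  show "(\<lambda>n. \<integral>\<^sup>+p. ennreal (edens (\<phi> n) p) * indicator (pull c ?Q') p \<partial>\<mu>) \<longlonglongrightarrow> 0"
  proof (rule tendsto_sandwich[OF _ _ tendsto_const up])
    show "\<forall>\<^sub>F n in sequentially. (\<integral>\<^sup>+p. ennreal (edens (\<phi> n) p) * indicator (pull c ?Q') p \<partial>\<mu>) \<le>
        ennreal (B * real (CARD('n)) * B * integral ?Q' (gsq (u n)))"
      unfolding u_def using \<phi> nn_edens_le_lift[OF c compact_cball Q' B'] by (intro always_eventually) blast
  qed simp
qed

text \<open>The preimages of the half balls still cover \<open>M\<close>. A finite subcover bounds
  the total energy by a finite sum of local energies, each of which tends to zero.\<close>

lemma energy_closable:
  assumes \<phi>: "\<And>n. \<phi> n \<in> V" and EC: "E.nCauchy \<phi>" and lim: "(\<lambda>n. L2_norm \<mu> (\<phi> n)) \<longlonglongrightarrow> 0"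
  shows "(\<lambda>n. E.nrm (\<phi> n)) \<longlonglongrightarrow> 0"
proof -
  have cov: "\<exists>W N. openin (top_of_set M) W \<and> p \<in> W \<and> W \<subseteq> N \<and> N \<in> sets \<mu> \<and> energy_vanishes_on N"
    if pM: "p \<in> M" for p
  proof -
    obtain c r where c: "c \<in> A" "p \<in> fst c" and r: "0 < r" "cball (snd c p) r \<subseteq> nbhd c"
      using piece_exists[OF pM] by metis
    have "cball (snd c p) (r / 2) \<subseteq> cball (snd c p) r" using r(1) by (intro subset_cball) simp
    then have Q: "cball (snd c p) (r / 2) \<subseteq> nbhd c" using r(2) by blast
    have "openin (top_of_set M) (pull c (ball (snd c p) (r / 2)))" by (rule pull_open[OF c(1)]) simp
    moreover have "p \<in> pull c (ball (snd c p) (r / 2))" using c(2) r(1) by (simp add: pull_def)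
    moreover have "pull c (ball (snd c p) (r / 2)) \<subseteq> pull c (cball (snd c p) (r / 2))"
      unfolding pull_def using ball_subset_cball by blast
    ultimately show ?thesis
      using pull_sets[OF c(1) compact_cball Q] energy_vanishes_chart_ball[OF c(1) r] by blast
  qed
  obtain \<N> where N: "finite \<N>" "\<Union>\<N> = M" "\<And>N. N \<in> \<N> \<Longrightarrow> N \<in> sets \<mu> \<and> energy_vanishes_on N"
    using finite_cover[of energy_vanishes_on, OF cov] by metis
  have "(\<lambda>n. \<integral>\<^sup>+p. ennreal (edens (\<phi> n) p) * indicator N p \<partial>\<mu>) \<longlonglongrightarrow> 0" if "N \<in> \<N>" for N
    using N(3)[OF that] \<phi> EC lim unfolding energy_vanishes_on_def by blast
  then have "(\<lambda>n. \<Sum>N\<in>\<N>. \<integral>\<^sup>+p. ennreal (edens (\<phi> n) p) * indicator N p \<partial>\<mu>) \<longlonglongrightarrow> (\<Sum>N\<in>\<N>. 0)"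
    by (intro tendsto_sum)
  then have up: "(\<lambda>n. \<Sum>N\<in>\<N>. \<integral>\<^sup>+p. ennreal (edens (\<phi> n) p) * indicator N p \<partial>\<mu>) \<longlonglongrightarrow> 0" by simp
  have le: "ennreal (Re (E (\<phi> n) (\<phi> n))) \<le> (\<Sum>N\<in>\<N>. \<integral>\<^sup>+p. ennreal (edens (\<phi> n) p) * indicator N p \<partial>\<mu>)" for n
  proof -
    have m[measurable]: "edens (\<phi> n) \<in> borel_measurable \<mu>" by (intro measurable_continuous_\<mu> edens_continuous \<phi>)
    have "ennreal (Re (E (\<phi> n) (\<phi> n))) = (\<integral>\<^sup>+p. ennreal (edens (\<phi> n) p) \<partial>\<mu>)"
      unfolding E_self[OF \<phi>]
      by (rule nn_integral_eq_integral[symmetric])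
         (auto simp: space_\<mu> intro!: integrable_continuous_\<mu> edens_continuous edens_nonneg \<phi>)
    also have "\<dots> \<le> (\<integral>\<^sup>+p. (\<Sum>N\<in>\<N>. ennreal (edens (\<phi> n) p) * indicator N p) \<partial>\<mu>)"
    proof (intro nn_integral_mono)
      fix p assume "p \<in> space \<mu>"
      then obtain N where Np: "N \<in> \<N>" "p \<in> N" using N(2) space_\<mu> by blast
      have "ennreal (edens (\<phi> n) p) = ennreal (edens (\<phi> n) p) * indicator N p" using Np by simp
      also have "\<dots> \<le> (\<Sum>N\<in>\<N>. ennreal (edens (\<phi> n) p) * indicator N p)"
        using N(1) Np by (intro member_le_sum) auto
      finally show "ennreal (edens (\<phi> n) p) \<le> (\<Sum>N\<in>\<N>. ennreal (edens (\<phi> n) p) * indicator N p)" .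
    qed
    also have "\<dots> = (\<Sum>N\<in>\<N>. \<integral>\<^sup>+p. ennreal (edens (\<phi> n) p) * indicator N p \<partial>\<mu>)"
    proof (rule nn_integral_sum)
      fix N assume "N \<in> \<N>"
      then have [measurable]: "N \<in> sets \<mu>" using N(3) by blast
      show "(\<lambda>p. ennreal (edens (\<phi> n) p) * indicator N p) \<in> borel_measurable \<mu>" by measurable
    qed
    finally show ?thesis .
  qed
  have "(\<lambda>n. ennreal (Re (E (\<phi> n) (\<phi> n)))) \<longlonglongrightarrow> 0"
    by (rule tendsto_sandwich[OF _ _ tendsto_const up]) (use le in \<open>auto intro!: always_eventually\<close>)
  then have "(\<lambda>n. Re (E (\<phi> n) (\<phi> n))) \<longlonglongrightarrow> 0"
    by (subst (asm) ennreal_tendsto_0_iff) (use E.nonneg \<phi> in auto)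
  then show ?thesis unfolding E.nrm_def using tendsto_real_sqrt[of _ 0] by simp
qed

lemma energy_form_manifold: "energy_form \<mu> V E"
proof (intro energy_form.intro energy_form_axioms.intro finite_volume E_semi_inner V_L2)
  show "(\<lambda>n. E.nrm (\<phi> n)) \<longlonglongrightarrow> 0"
    if "\<And>n. \<phi> n \<in> V" "E.nCauchy \<phi>" "(\<lambda>n. L2_norm \<mu> (\<phi> n)) \<longlonglongrightarrow> 0" for \<phi>
    by (rule energy_closable[OF that])
  show "\<exists>r::nat \<Rightarrow> nat. strict_mono r \<and> L2.nCauchy \<mu> (\<phi> \<circ> r)"
    if "\<And>n. \<phi> n \<in> V" "\<And>n. L2_norm \<mu> (\<phi> n) \<le> K" "\<And>n. E.nrm (\<phi> n) \<le> K" for \<phi> K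
    by (rule finite_rank_compact[OF E_semi_inner V_L2 finite_rank_M that])
qed

end

sublocale compact_riemannian \<subseteq> energy_form \<mu> V E
  by (rule energy_form_manifold)

context compact_riemannian
begin

lemma approx_eq: "H1_approx M A g \<mu> = approx"
  by (intro ext) (simp add: H1_approx_def approx_def test_H1_norm_def)

lemma H_eq: "H01 M A g \<mu> = H"
  by (simp add: H01_def H_def approx_eq)

lemma Ext_eq: "E_inner M A g \<mu> = Ext"
  by (intro ext) (simp add: E_inner_def Ext_def approx_eq)

section \<open>From the first eigenvalue to the semilinear problem\<close>

theorem poincare_of_first_eigenvalue:
  assumes "first_dirichlet_eigenvalue M A g \<mu> lam"
  obtains \<phi>0 where "\<phi>0 \<in> V" "\<And>\<phi>. \<phi> \<in> V \<Longrightarrow> lam * (L2_norm \<mu> \<phi>)\<^sup>2 \<le> Re (E \<phi> \<phi>)"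
proof -
  obtain w where w: "w \<in> H" "\<not> (AE p in \<mu>. w p = 0)"
  proof -
    have "dirichlet_eigenvalue M A g \<mu> lam" using assms by (simp add: first_dirichlet_eigenvalue_def)
    then show thesis using that unfolding dirichlet_eigenvalue_def H_eq by (elim bexE conjE)
  qed
  have null: "AE p in \<mu>. v p = 0" if v: "v \<in> L2 \<mu>" "L2_norm \<mu> v = 0" for v
  proof -
    have "(LINT p|\<mu>. (cmod (v p))\<^sup>2) = 0"
      using L2.nrm_sq[OF v(1)] v(2) by (simp add: L2_nrm L2_inner_self)
    then have "AE p in \<mu>. (cmod (v p))\<^sup>2 = 0"
      using v(1) by (subst (asm) integral_nonneg_eq_0_iff_AE) (auto simp: L2_def)
    then show ?thesis by simp
  qed
  obtain \<phi> where \<phi>: "approx \<phi> w" and wL: "w \<in> L2 \<mu>" using w(1) by (auto simp: H_def)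
  \<comment> \<open>The Rayleigh quotient needs a test function of positive norm. The eigenfunction
    provides one: if its approximants all had norm zero, it would vanish almost everywhere.\<close>
  have "\<exists>n. L2_norm \<mu> (\<phi> n) \<noteq> 0"
  proof (rule ccontr)
    assume "\<nexists>n. L2_norm \<mu> (\<phi> n) \<noteq> 0"
    then have "(\<lambda>n. 0) \<longlonglongrightarrow> L2_norm \<mu> w"
      using L2_norm_limit[OF approxD(2)[OF \<phi>] wL approxD(3)[OF \<phi>]] by simp
    then have "L2_norm \<mu> w = 0" by (simp add: LIMSEQ_const_iff)
    then show False using null[OF wL] w(2) by blast
  qed
  then obtain n where "L2_norm \<mu> (\<phi> n) \<noteq> 0" by blast
  then have pos: "0 < L2_norm \<mu> (\<phi> n)" using L2.nrm_nonneg[OF approxD(2)[OF \<phi>]] by (simp add: L2_nrm less_le)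
  obtain \<nu> u where \<nu>: "u \<in> H" "L2_norm \<mu> u = 1" "\<And>v. v \<in> H \<Longrightarrow> Ext u v = of_real \<nu> * L2_inner \<mu> u v"
    "\<And>\<phi>. \<phi> \<in> V \<Longrightarrow> \<nu> * (L2_norm \<mu> \<phi>)\<^sup>2 \<le> Re (E \<phi> \<phi>)"
    using rayleigh_minimizer[OF approxD(1)[OF \<phi>] pos] by metis
  have "\<not> (AE p in \<mu>. u p = 0)"
  proof
    assume "AE p in \<mu>. u p = 0"
    then have "(LINT p|\<mu>. (cmod (u p))\<^sup>2) = (LINT p|\<mu>. 0)"
      using \<nu>(1) by (intro integral_cong_AE) (auto simp: H_def L2_def)
    then have "L2_norm \<mu> u = 0" by (simp add: L2_norm_def L2_inner_self)
    then show False using \<nu>(2) by simp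
  qed
  then have "dirichlet_eigenvalue M A g \<mu> \<nu>"
    unfolding dirichlet_eigenvalue_def H_eq Ext_eq using \<nu>(1,3) by blast
  \<comment> \<open>Minimality of \<open>lam\<close> among eigenvalues applies because the infimum
    \<open>\<nu>\<close> is attained and hence is an eigenvalue itself.\<close>
  then have le: "lam \<le> \<nu>" using assms unfolding first_dirichlet_eigenvalue_def by blast
  show thesis
  proof
    show "\<phi> n \<in> V" by (rule approxD(1)[OF \<phi>])
    show "lam * (L2_norm \<mu> \<psi>)\<^sup>2 \<le> Re (E \<psi> \<psi>)" if "\<psi> \<in> V" for \<psi>
      using \<nu>(4)[OF that] mult_right_mono[OF le, of "(L2_norm \<mu> \<psi>)\<^sup>2"] by simp
  qed
qed

end

theorem theorem3p4:
  fixes M :: "'a::t2_space set"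
    and A :: "('a, 'n::finite) chart set"
    and g :: "('a, 'n) chart \<Rightarrow> 'a \<Rightarrow> real ^ 'n ^ 'n"
    and \<mu> :: "'a measure"
    and F :: "complex \<Rightarrow> complex"
    and f :: "'a \<Rightarrow> complex"
    and lambda1 C C1 :: real
  assumes "smooth_manifold_C1_boundary M A"
    and "compact M"
    and "connected M"
    and "riemannian_metric A g"
    and "riemannian_volume M A g \<mu>"
    and "first_dirichlet_eigenvalue M A g \<mu> lambda1"
    and "lambda1 > 0"
    and "C = lambda1 powr (- 1 / 2)"
    and "C1-lipschitz_on UNIV F"
    and "f \<in> L2 \<mu>"
    and "C1 * C\<^sup>2 < 1"
  shows "\<exists>u. weak_solution M A g \<mu> F f u"
proof -
  interpret compact_riemannian M A g \<mu>
    using assms by unfold_locales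
  obtain \<phi>0 where \<phi>0: "\<phi>0 \<in> V" "\<And>\<phi>. \<phi> \<in> V \<Longrightarrow> lambda1 * (L2_norm \<mu> \<phi>)\<^sup>2 \<le> Re (E \<phi> \<phi>)"
    using poincare_of_first_eigenvalue[OF assms(6)] by metis
  \<comment> \<open>This turns the smallness condition into \<open>C1 < lambda1\<close>, the form in
    which the contraction uses it.\<close>
  have C: "C\<^sup>2 = 1 / lambda1"
  proof -
    have "C\<^sup>2 = lambda1 powr (- 1 / 2 + - 1 / 2)"
      unfolding assms(8) power2_eq_square by (rule powr_add[symmetric])
    then show ?thesis using assms(7) by (simp add: powr_minus_divide)
  qed
  then have small: "C1 < lambda1" using assms(7) assms(11)[unfolded C] by (simp add: pos_divide_less_eq)
  obtain u where "u \<in> H" "\<forall>v\<in>H. Ext u v + L2_inner \<mu> (\<lambda>p. F (u p)) v = L2_inner \<mu> f v"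
    using semilinear_solution[OF assms(7) \<phi>0(2,1) assms(9,10) small] by blast
  then show ?thesis unfolding weak_solution_def H_eq Ext_eq by blast
qed

end
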